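(* Let $L$ be a finite extension of $\mathbb{Q}_p$, let $K$ be a complete discretely valued field extension of $L$, and let $H$ be a compact $L$-analytic group. Then the natural map $KH\otimes_K D(H,K)_1\to D(H,K)$ is an injection.
   Context: Let $R$ be the ring of integers of $K$. $RH := \varprojlim R[H/U]$ (limit over all open normal subgroups $U$ of $H$) is the completed group ring and $KH := K\otimes_R RH$ is the Iwasawa algebra of continuous $K$-valued distributions on $H$. For a locally $L$-analytic manifold $M$, $D(M,K)$ is the strong dual of the space $C^{an}(M,K)$ of $K$-valued locally $L$-analytic functions on $M$. $D(H,K)$ is a unital associative $K$-algebra under convolution. There is a natural algebra map $KH\to D(H,K)$, because every locally $L$-analytic function on $H$ is continuous. For every open subgroup $U$ of $H$, $D(U,K)$ is regarded as the subalgebra of $D(H,K)$ of distributions supported on $U$. $D(H,K)_1 := \bigcap_{U} D(U,K)$, the intersection being over all open subgroups $U$ of $H$, is the subalgebra of distributions supported at the identity. The natural map in the claim sends $\mu\otimes\nu$ to the product in $D(H,K)$ of the image of $\mu$ with $\nu$. *)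

theory Defs
  imports
    "HOL-Analysis.Analysis"
    "HOL-Algebra.Module"
    "HOL-Algebra.Coset"
    "HOL-Library.Poly_Mapping"
begin

section \<open>Non-archimedean fields\<close>

class nonarch_field = field + metric_space +
  fixes absv :: "'a \<Rightarrow> real"
  assumes dist_absv: "dist x y = absv (x - y)"
    and absv_mult: "absv (x * y) = absv x * absv y"
    and absv_add: "absv (x + y) \<le> max (absv x) (absv y)"

lemma absv_pos: "x \<noteq> 0 \<Longrightarrow> 0 < absv (x :: 'a::nonarch_field)"
  by (metis diff_zero dist_absv zero_less_dist_iff)

definition padic_abs :: "nat \<Rightarrow> rat \<Rightarrow> real" where
  "padic_abs p x =
    (if x = 0 then 0
     else real p powi (int (multiplicity (int p) (snd (quotient_of x)))
                     - int (multiplicity (int p) (fst (quotient_of x)))))"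

text \<open>
  A finite extension of \<open>Q\<^sub>p\<close> carries a unique absolute value extending the \<open>p\<close>-adic one. Inside it,
  \<open>Q\<^sub>p\<close> is the closure of the prime field, required here to be complete, so that it is the completion
  of the rationals for the \<open>p\<close>-adic absolute value.
\<close>

definition finite_extension_of_Qp :: "nat \<Rightarrow> 'l::{nonarch_field, field_char_0} itself \<Rightarrow> bool" where
  "finite_extension_of_Qp p TL \<longleftrightarrow>
    (\<forall>x. absv (of_rat x :: 'l) = padic_abs p x) \<and>
    complete (closure (\<rat> :: 'l set)) \<and>
    (\<exists>B :: 'l set. finite B \<and>
      (\<forall>x. \<exists>c. (\<forall>b\<in>B. c b \<in> closure \<rat>) \<and> x = (\<Sum>b\<in>B. c b * b)))"

text \<open>Completeness of \<open>K\<close> is the sort \<open>complete_space\<close>.\<close>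

definition discretely_valued_extension ::
    "('l::nonarch_field \<Rightarrow> 'k::{nonarch_field, complete_space}) \<Rightarrow> bool" where
  "discretely_valued_extension \<iota> \<longleftrightarrow>
    \<iota> 1 = 1 \<and> (\<forall>x y. \<iota> (x + y) = \<iota> x + \<iota> y) \<and> (\<forall>x y. \<iota> (x * y) = \<iota> x * \<iota> y) \<and>
    (\<forall>x. absv (\<iota> x) = absv x) \<and>
    (\<exists>\<pi> :: 'k. \<pi> \<noteq> 0 \<and> absv \<pi> < 1 \<and> (\<forall>x :: 'k. x \<noteq> 0 \<longrightarrow> (\<exists>n :: int. absv x = absv \<pi> powi n)))"

definition valuation_ring :: "'k::nonarch_field set" where
  "valuation_ring = {c. absv c \<le> 1}"


section \<open>Locally analytic functions and manifolds\<close>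

text \<open>
  Vectors of length \<open>d\<close> (with entries in \<open>L\<close>) and multi-indices (with entries in \<open>nat\<close>) are functions
  on \<open>nat\<close> vanishing from \<open>d\<close> on. The subspace topology inherited from the product topology on
  \<open>nat \<Rightarrow> L\<close> is the usual topology of \<open>L\<^sup>d\<close>.
\<close>

definition vecs :: "nat \<Rightarrow> (nat \<Rightarrow> 'a::zero) set" where
  "vecs d = {x. \<forall>i\<ge>d. x i = 0}"

definition polydisc :: "nat \<Rightarrow> (nat \<Rightarrow> 'l::nonarch_field) \<Rightarrow> real \<Rightarrow> (nat \<Rightarrow> 'l) set" where
  "polydisc d x \<epsilon> = {y \<in> vecs d. \<forall>i<d. absv (y i - x i) \<le> \<epsilon>}"

text \<open>
  On the polydisc of radius \<open>\<epsilon>\<close> around \<open>x\<close>, \<open>f\<close> is the power series with coefficients \<open>a\<close>, where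
  \<open>\<bar>a \<alpha>\<bar> \<epsilon>\<^bsup>\<bar>\<alpha>\<bar>\<^esup>\<close> tends to zero. Here \<open>\<iota>\<close> embeds the coordinate field into the coefficient field.
\<close>

definition expands_on ::
    "('l::nonarch_field \<Rightarrow> 'k::nonarch_field) \<Rightarrow> nat \<Rightarrow> (nat \<Rightarrow> 'l) \<Rightarrow> real
      \<Rightarrow> ((nat \<Rightarrow> nat) \<Rightarrow> 'k) \<Rightarrow> ((nat \<Rightarrow> 'l) \<Rightarrow> 'k) \<Rightarrow> bool" where
  "expands_on \<iota> d x \<epsilon> a f \<longleftrightarrow>
    (\<forall>e>0. finite {\<alpha> \<in> vecs d. e \<le> absv (a \<alpha>) * \<epsilon> ^ (\<Sum>i<d. \<alpha> i)}) \<and>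
    (\<forall>y \<in> polydisc d x \<epsilon>.
      ((\<lambda>\<alpha>. a \<alpha> * (\<Prod>i<d. \<iota> (y i - x i) ^ \<alpha> i)) has_sum f y) (vecs d))"

definition locally_analytic_on ::
    "('l::nonarch_field \<Rightarrow> 'k::nonarch_field) \<Rightarrow> nat \<Rightarrow> (nat \<Rightarrow> 'l) set
      \<Rightarrow> ((nat \<Rightarrow> 'l) \<Rightarrow> 'k) \<Rightarrow> bool" where
  "locally_analytic_on \<iota> d V f \<longleftrightarrow>
    (\<forall>x\<in>V. \<exists>\<epsilon>>0. polydisc d x \<epsilon> \<subseteq> V \<and> (\<exists>a. expands_on \<iota> d x \<epsilon> a f))"

definition locally_analytic_map_on ::
    "nat \<Rightarrow> nat \<Rightarrow> (nat \<Rightarrow> 'l::nonarch_field) set \<Rightarrow> ((nat \<Rightarrow> 'l) \<Rightarrow> nat \<Rightarrow> 'l) \<Rightarrow> bool" where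
  "locally_analytic_map_on d e V F \<longleftrightarrow> (\<forall>j<e. locally_analytic_on (\<lambda>z. z) d V (\<lambda>y. F y j))"

text \<open>A chart is a pair \<open>(U, \<phi>)\<close>; the values of \<open>\<phi>\<close> outside \<open>U\<close> are irrelevant.\<close>

record ('m, 'l) manifold =
  mtop :: "'m topology"
  mdim :: nat
  atlas :: "('m set \<times> ('m \<Rightarrow> nat \<Rightarrow> 'l)) set"

definition is_chart ::
    "'m topology \<Rightarrow> nat \<Rightarrow> 'm set \<Rightarrow> ('m \<Rightarrow> nat \<Rightarrow> 'l::nonarch_field) \<Rightarrow> bool" where
  "is_chart X d U \<phi> \<longleftrightarrow>
    openin X U \<and> openin (top_of_set (vecs d)) (\<phi> ` U) \<and>
    homeomorphic_map (subtopology X U) (top_of_set (\<phi> ` U)) \<phi>"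

definition compatible_charts ::
    "nat \<Rightarrow> 'm set \<Rightarrow> ('m \<Rightarrow> nat \<Rightarrow> 'l::nonarch_field) \<Rightarrow> 'm set \<Rightarrow> ('m \<Rightarrow> nat \<Rightarrow> 'l) \<Rightarrow> bool" where
  "compatible_charts d U \<phi> V \<psi> \<longleftrightarrow>
    locally_analytic_map_on d d (\<phi> ` (U \<inter> V)) (\<psi> \<circ> inv_into U \<phi>) \<and>
    locally_analytic_map_on d d (\<psi> ` (U \<inter> V)) (\<phi> \<circ> inv_into V \<psi>)"

definition locally_analytic_manifold :: "('m, 'l::nonarch_field) manifold \<Rightarrow> bool" where
  "locally_analytic_manifold M \<longleftrightarrow>
    Hausdorff_space (mtop M) \<and>
    (\<forall>(U, \<phi>) \<in> atlas M. is_chart (mtop M) (mdim M) U \<phi>) \<and>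
    (\<Union>(U, \<phi>) \<in> atlas M. U) = topspace (mtop M) \<and>
    (\<forall>(U, \<phi>) \<in> atlas M. \<forall>(V, \<psi>) \<in> atlas M. compatible_charts (mdim M) U \<phi> V \<psi>) \<and>
    (\<forall>U \<phi>. is_chart (mtop M) (mdim M) U \<phi> \<and>
        (\<forall>(V, \<psi>) \<in> atlas M. compatible_charts (mdim M) U \<phi> V \<psi>) \<longrightarrow> (U, \<phi>) \<in> atlas M)"

text \<open>The product atlas is not maximal, which makes no difference to the analyticity of maps.\<close>

definition prod_manifold ::
    "('m, 'l::nonarch_field) manifold \<Rightarrow> ('n, 'l) manifold \<Rightarrow> ('m \<times> 'n, 'l) manifold" where
  "prod_manifold M N =
    \<lparr>mtop = prod_topology (mtop M) (mtop N),
     mdim = mdim M + mdim N,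
     atlas = {(U \<times> V, \<lambda>(x, y) i. if i < mdim M then \<phi> x i else \<psi> y (i - mdim M)) | U \<phi> V \<psi>.
                (U, \<phi>) \<in> atlas M \<and> (V, \<psi>) \<in> atlas N}\<rparr>"

definition locally_analytic_map ::
    "('m, 'l::nonarch_field) manifold \<Rightarrow> ('n, 'l) manifold \<Rightarrow> ('m \<Rightarrow> 'n) \<Rightarrow> bool" where
  "locally_analytic_map M N f \<longleftrightarrow>
    continuous_map (mtop M) (mtop N) f \<and>
    (\<forall>(U, \<phi>) \<in> atlas M. \<forall>(V, \<psi>) \<in> atlas N.
      locally_analytic_map_on (mdim M) (mdim N) (\<phi> ` (U \<inter> f -` V)) (\<psi> \<circ> f \<circ> inv_into U \<phi>))"

definition analytic_group :: "('h, 'b) monoid_scheme \<Rightarrow> ('h, 'l::nonarch_field) manifold \<Rightarrow> bool" where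
  "analytic_group G M \<longleftrightarrow>
    group G \<and> locally_analytic_manifold M \<and> topspace (mtop M) = carrier G \<and>
    locally_analytic_map (prod_manifold M M) M (\<lambda>(x, y). x \<otimes>\<^bsub>G\<^esub> y) \<and>
    locally_analytic_map M M (\<lambda>x. inv\<^bsub>G\<^esub> x)"


section \<open>Locally analytic functions and distributions\<close>

text \<open>Functions on a manifold are extended by zero outside the underlying space.\<close>

definition Can ::
    "('l::nonarch_field \<Rightarrow> 'k::nonarch_field) \<Rightarrow> ('m, 'l) manifold \<Rightarrow> ('m \<Rightarrow> 'k) set" where
  "Can \<iota> M = {f. (\<forall>x. x \<notin> topspace (mtop M) \<longrightarrow> f x = 0) \<and>
    (\<forall>(U, \<phi>) \<in> atlas M. locally_analytic_on \<iota> (mdim M) (\<phi> ` U) (f \<circ> inv_into U \<phi>))}"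

text \<open>
  \<open>Can \<iota> M\<close> carries the locally convex inductive limit topology over all coverings of \<open>M\<close> by pairwise
  disjoint charts whose images are polydiscs. Each such covering \<open>I\<close> contributes the product over
  its charts of the Banach spaces of functions given by one convergent power series, with norm
  \<open>sup \<bar>a \<alpha>\<bar> \<epsilon>\<^bsup>\<bar>\<alpha>\<bar>\<^esup>\<close>; the coefficients \<open>a\<close> are uniquely determined by the function.
\<close>

type_synonym ('m, 'l) chart_family = "('m set \<times> ('m \<Rightarrow> nat \<Rightarrow> 'l) \<times> (nat \<Rightarrow> 'l) \<times> real) set"

definition polydisc_covering ::
    "('m, 'l::nonarch_field) manifold \<Rightarrow> ('m, 'l) chart_family \<Rightarrow> bool" where
  "polydisc_covering M I \<longleftrightarrow>
    (\<forall>(U, \<phi>, x, \<epsilon>) \<in> I. (U, \<phi>) \<in> atlas M \<and> x \<in> vecs (mdim M) \<and> 0 < \<epsilon> \<and>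
        \<phi> ` U = polydisc (mdim M) x \<epsilon>) \<and>
    (\<Union>(U, \<phi>, x, \<epsilon>) \<in> I. U) = topspace (mtop M) \<and>
    pairwise (\<lambda>c c'. disjnt (fst c) (fst c')) I"

definition Can_on ::
    "('l::nonarch_field \<Rightarrow> 'k::nonarch_field) \<Rightarrow> ('m, 'l) manifold \<Rightarrow> ('m, 'l) chart_family
      \<Rightarrow> ('m \<Rightarrow> 'k) set" where
  "Can_on \<iota> M I = {f. (\<forall>x. x \<notin> topspace (mtop M) \<longrightarrow> f x = 0) \<and>
    (\<forall>(U, \<phi>, x, \<epsilon>) \<in> I. \<exists>a. expands_on \<iota> (mdim M) x \<epsilon> a (f \<circ> inv_into U \<phi>))}"

text \<open>For finite \<open>J \<subseteq> I\<close> and \<open>\<delta> > 0\<close> these are the basic neighbourhoods of zero in \<open>Can_on \<iota> M I\<close>.\<close>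

definition Can_on_nhd ::
    "('l::nonarch_field \<Rightarrow> 'k::nonarch_field) \<Rightarrow> ('m, 'l) manifold \<Rightarrow> ('m, 'l) chart_family
      \<Rightarrow> ('m, 'l) chart_family \<Rightarrow> real \<Rightarrow> ('m \<Rightarrow> 'k) set" where
  "Can_on_nhd \<iota> M I J \<delta> = {f \<in> Can_on \<iota> M I.
    \<forall>(U, \<phi>, x, \<epsilon>) \<in> J. \<exists>a. expands_on \<iota> (mdim M) x \<epsilon> a (f \<circ> inv_into U \<phi>) \<and>
      (\<forall>\<alpha> \<in> vecs (mdim M). absv (a \<alpha>) * \<epsilon> ^ (\<Sum>i<mdim M. \<alpha> i) \<le> \<delta>)}"

definition open_lattice ::
    "('l::nonarch_field \<Rightarrow> 'k::nonarch_field) \<Rightarrow> ('m, 'l) manifold \<Rightarrow> ('m \<Rightarrow> 'k) set \<Rightarrow> bool" where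
  "open_lattice \<iota> M V \<longleftrightarrow>
    V \<subseteq> Can \<iota> M \<and> (\<lambda>_. 0) \<in> V \<and>
    (\<forall>f\<in>V. \<forall>g\<in>V. (\<lambda>x. f x + g x) \<in> V) \<and>
    (\<forall>c\<in>valuation_ring. \<forall>f\<in>V. (\<lambda>x. c * f x) \<in> V) \<and>
    (\<forall>f\<in>Can \<iota> M. \<exists>c. c \<noteq> 0 \<and> (\<lambda>x. c * f x) \<in> V) \<and>
    (\<forall>I. polydisc_covering M I \<longrightarrow>
      (\<exists>J \<delta>. finite J \<and> J \<subseteq> I \<and> 0 < \<delta> \<and> Can_on_nhd \<iota> M I J \<delta> \<subseteq> V))"

definition Can_topology ::
    "('l::nonarch_field \<Rightarrow> 'k::nonarch_field) \<Rightarrow> ('m, 'l) manifold \<Rightarrow> ('m \<Rightarrow> 'k) topology" where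
  "Can_topology \<iota> M = topology (\<lambda>T. T \<subseteq> Can \<iota> M \<and>
    (\<forall>f\<in>T. \<exists>V. open_lattice \<iota> M V \<and> (\<lambda>v x. f x + v x) ` V \<subseteq> T))"

lemma Can_on_nhd_mono:
  assumes "f \<in> Can_on_nhd \<iota> M I (J \<union> J') (min \<delta> \<delta>')"
  shows "f \<in> Can_on_nhd \<iota> M I J \<delta>" and "f \<in> Can_on_nhd \<iota> M I J' \<delta>'"
  using assms unfolding Can_on_nhd_def by fastforce+

lemma open_lattice_smult:
  "open_lattice \<iota> M V \<Longrightarrow> c \<in> valuation_ring \<Longrightarrow> f \<in> V \<Longrightarrow> (\<lambda>x. c * f x) \<in> V"
  by (simp add: open_lattice_def)

lemma open_lattice_Int:
  assumes V: "open_lattice \<iota> M V" and W: "open_lattice \<iota> M W"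
  shows "open_lattice \<iota> M (V \<inter> W)"
  unfolding open_lattice_def
proof (intro conjI)
  show "\<forall>f\<in>Can \<iota> M. \<exists>c. c \<noteq> 0 \<and> (\<lambda>x. c * f x) \<in> V \<inter> W"
  proof
    fix f assume "f \<in> Can \<iota> M"
    then obtain c d where c: "c \<noteq> 0" "(\<lambda>x. c * f x) \<in> V" and d: "d \<noteq> 0" "(\<lambda>x. d * f x) \<in> W"
      using V W unfolding open_lattice_def by meson
    have scale: "(\<lambda>x. a * (b * f x)) = (\<lambda>x. (a * b) * f x)" for a b
      by (simp add: mult.assoc)
    show "\<exists>c. c \<noteq> 0 \<and> (\<lambda>x. c * f x) \<in> V \<inter> W"
    proof (cases "absv c \<le> absv d")
      case True
      then have "absv (c / d) * absv d \<le> 1 * absv d"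
        using d by (simp flip: absv_mult)
      moreover have "0 < absv d"
        using d by (simp add: absv_pos)
      ultimately have "c / d \<in> valuation_ring"
        unfolding valuation_ring_def by simp
      then have "(\<lambda>x. (c / d) * (d * f x)) \<in> W"
        by (rule open_lattice_smult[OF W _ d(2)])
      then have "(\<lambda>x. c * f x) \<in> W"
        using d(1) unfolding scale by simp
      then show ?thesis using c by blast
    next
      case False
      then have "absv (d / c) * absv c \<le> 1 * absv c"
        using c by (simp flip: absv_mult)
      moreover have "0 < absv c"
        using c by (simp add: absv_pos)
      ultimately have "d / c \<in> valuation_ring"
        unfolding valuation_ring_def by simp
      then have "(\<lambda>x. (d / c) * (c * f x)) \<in> V"
        by (rule open_lattice_smult[OF V _ c(2)])
      then have "(\<lambda>x. d * f x) \<in> V"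
        using c(1) unfolding scale by simp
      then show ?thesis using d by blast
    qed
  qed
  show "\<forall>I. polydisc_covering M I \<longrightarrow>
    (\<exists>J \<delta>. finite J \<and> J \<subseteq> I \<and> 0 < \<delta> \<and> Can_on_nhd \<iota> M I J \<delta> \<subseteq> V \<inter> W)"
  proof (intro allI impI)
    fix I assume I: "polydisc_covering M I"
    obtain J \<delta> where J: "finite J" "J \<subseteq> I" "0 < \<delta>" "Can_on_nhd \<iota> M I J \<delta> \<subseteq> V"
      using V I unfolding open_lattice_def by meson
    obtain J' \<delta>' where J': "finite J'" "J' \<subseteq> I" "0 < \<delta>'" "Can_on_nhd \<iota> M I J' \<delta>' \<subseteq> W"
      using W I unfolding open_lattice_def by meson
    have "Can_on_nhd \<iota> M I (J \<union> J') (min \<delta> \<delta>') \<subseteq> V \<inter> W"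
      using Can_on_nhd_mono J(4) J'(4) by blast
    then show "\<exists>J \<delta>. finite J \<and> J \<subseteq> I \<and> 0 < \<delta> \<and> Can_on_nhd \<iota> M I J \<delta> \<subseteq> V \<inter> W"
      using J J' by (intro exI[of _ "J \<union> J'"] exI[of _ "min \<delta> \<delta>'"]) auto
  qed
qed (use V W in \<open>auto simp: open_lattice_def\<close>)

lemma openin_Can_topology:
  "openin (Can_topology \<iota> M) T \<longleftrightarrow> T \<subseteq> Can \<iota> M \<and>
    (\<forall>f\<in>T. \<exists>V. open_lattice \<iota> M V \<and> (\<lambda>v x. f x + v x) ` V \<subseteq> T)"
proof -
  have "istopology (\<lambda>T. T \<subseteq> Can \<iota> M \<and>
    (\<forall>f\<in>T. \<exists>V. open_lattice \<iota> M V \<and> (\<lambda>v x. f x + v x) ` V \<subseteq> T))"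
    unfolding istopology_def
  proof (intro conjI allI impI ballI)
    fix S T f
    assume S: "S \<subseteq> Can \<iota> M \<and> (\<forall>f\<in>S. \<exists>V. open_lattice \<iota> M V \<and> (\<lambda>v x. f x + v x) ` V \<subseteq> S)"
      and T: "T \<subseteq> Can \<iota> M \<and> (\<forall>f\<in>T. \<exists>V. open_lattice \<iota> M V \<and> (\<lambda>v x. f x + v x) ` V \<subseteq> T)"
      and f: "f \<in> S \<inter> T"
    obtain V where V: "open_lattice \<iota> M V" "(\<lambda>v x. f x + v x) ` V \<subseteq> S"
      using S f by blast
    obtain W where W: "open_lattice \<iota> M W" "(\<lambda>v x. f x + v x) ` W \<subseteq> T"
      using T f by blast
    have "(\<lambda>v x. f x + v x) ` (V \<inter> W) \<subseteq> S \<inter> T"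
      using V(2) W(2) by blast
    then show "\<exists>V. open_lattice \<iota> M V \<and> (\<lambda>v x. f x + v x) ` V \<subseteq> S \<inter> T"
      using open_lattice_Int[OF V(1) W(1)] by blast
  next
    fix \<K> f
    assume K: "\<forall>K\<in>\<K>. K \<subseteq> Can \<iota> M \<and>
        (\<forall>f\<in>K. \<exists>V. open_lattice \<iota> M V \<and> (\<lambda>v x. f x + v x) ` V \<subseteq> K)"
      and "f \<in> \<Union>\<K>"
    then obtain K V where "K \<in> \<K>" "open_lattice \<iota> M V" "(\<lambda>v x. f x + v x) ` V \<subseteq> K"
      by blast
    then show "\<exists>V. open_lattice \<iota> M V \<and> (\<lambda>v x. f x + v x) ` V \<subseteq> \<Union>\<K>"
      by blast
  qed auto
  then show ?thesis
    unfolding Can_topology_def by (simp add: topology_inverse')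
qed

text \<open>
  Only the vector space underlying the strong dual is needed; functionals are extended by zero
  outside \<open>Can \<iota> M\<close>.
\<close>

definition distributions ::
    "('l::nonarch_field \<Rightarrow> 'k::nonarch_field) \<Rightarrow> ('m, 'l) manifold \<Rightarrow> (('m \<Rightarrow> 'k) \<Rightarrow> 'k) set" where
  "distributions \<iota> M = {\<mu>. (\<forall>f. f \<notin> Can \<iota> M \<longrightarrow> \<mu> f = 0) \<and>
    (\<forall>f\<in>Can \<iota> M. \<forall>g\<in>Can \<iota> M. \<mu> (\<lambda>x. f x + g x) = \<mu> f + \<mu> g) \<and>
    (\<forall>c. \<forall>f\<in>Can \<iota> M. \<mu> (\<lambda>x. c * f x) = c * \<mu> f) \<and>
    continuous_map (Can_topology \<iota> M) euclidean \<mu>}"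

definition convolution ::
    "('l::nonarch_field \<Rightarrow> 'k::nonarch_field) \<Rightarrow> ('h, 'b) monoid_scheme \<Rightarrow> ('h, 'l) manifold
      \<Rightarrow> (('h \<Rightarrow> 'k) \<Rightarrow> 'k) \<Rightarrow> (('h \<Rightarrow> 'k) \<Rightarrow> 'k) \<Rightarrow> ('h \<Rightarrow> 'k) \<Rightarrow> 'k" where
  "convolution \<iota> G M \<mu> \<nu> f =
    (if f \<in> Can \<iota> M
     then \<mu> (\<lambda>x. if x \<in> carrier G
                then \<nu> (\<lambda>y. if y \<in> carrier G then f (x \<otimes>\<^bsub>G\<^esub> y) else 0) else 0)
     else 0)"

definition dist_algebra ::
    "('l::nonarch_field \<Rightarrow> 'k::nonarch_field) \<Rightarrow> ('h, 'b) monoid_scheme \<Rightarrow> ('h, 'l) manifold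
      \<Rightarrow> ('k, ('h \<Rightarrow> 'k) \<Rightarrow> 'k) module" where
  "dist_algebra \<iota> G M =
    \<lparr>carrier = distributions \<iota> M,
     mult = convolution \<iota> G M,
     one = (\<lambda>f. if f \<in> Can \<iota> M then f \<one>\<^bsub>G\<^esub> else 0),
     zero = (\<lambda>_. 0),
     add = (\<lambda>\<mu> \<nu> f. \<mu> f + \<nu> f),
     smult = (\<lambda>c \<mu> f. c * \<mu> f)\<rparr>"

definition distributions_supported_on ::
    "('l::nonarch_field \<Rightarrow> 'k::nonarch_field) \<Rightarrow> ('m, 'l) manifold \<Rightarrow> 'm set
      \<Rightarrow> (('m \<Rightarrow> 'k) \<Rightarrow> 'k) set" where
  "distributions_supported_on \<iota> M U =
    {\<mu> \<in> distributions \<iota> M. \<forall>f\<in>Can \<iota> M. (\<forall>x\<in>U. f x = 0) \<longrightarrow> \<mu> f = 0}"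

definition dist_algebra_at_one ::
    "('l::nonarch_field \<Rightarrow> 'k::nonarch_field) \<Rightarrow> ('h, 'b) monoid_scheme \<Rightarrow> ('h, 'l) manifold
      \<Rightarrow> ('k, ('h \<Rightarrow> 'k) \<Rightarrow> 'k) module" where
  "dist_algebra_at_one \<iota> G M = (dist_algebra \<iota> G M)
    \<lparr>carrier := \<Inter>U \<in> {U. subgroup U G \<and> openin (mtop M) U}. distributions_supported_on \<iota> M U\<rparr>"


section \<open>Tensor products\<close>

text \<open>
  \<open>M \<otimes>\<^sub>R N\<close> is the free abelian group on pairs modulo the subgroup generated by the usual relations.
  The scalars of \<open>M\<close> may form a larger ring than the set \<open>R\<close> over which the tensor product is taken;
  they act on the tensor product through \<open>M\<close>. The multiplication is the one of a tensor product of
  algebras, and has no meaning if \<open>M\<close> and \<open>N\<close> are not \<open>R\<close>-algebras.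
\<close>

inductive_set tensor_relations ::
    "'r set \<Rightarrow> ('r, 'm, 'c) module_scheme \<Rightarrow> ('r, 'n, 'd) module_scheme \<Rightarrow> (('m \<times> 'n) \<Rightarrow>\<^sub>0 int) set"
  for R M N where
  zero: "0 \<in> tensor_relations R M N"
| diff: "z \<in> tensor_relations R M N \<Longrightarrow> w \<in> tensor_relations R M N \<Longrightarrow> z - w \<in> tensor_relations R M N"
| add_left: "m \<in> carrier M \<Longrightarrow> m' \<in> carrier M \<Longrightarrow> n \<in> carrier N \<Longrightarrow>
    frag_of (m \<oplus>\<^bsub>M\<^esub> m', n) - frag_of (m, n) - frag_of (m', n) \<in> tensor_relations R M N"
| add_right: "m \<in> carrier M \<Longrightarrow> n \<in> carrier N \<Longrightarrow> n' \<in> carrier N \<Longrightarrow>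
    frag_of (m, n \<oplus>\<^bsub>N\<^esub> n') - frag_of (m, n) - frag_of (m, n') \<in> tensor_relations R M N"
| balanced: "r \<in> R \<Longrightarrow> m \<in> carrier M \<Longrightarrow> n \<in> carrier N \<Longrightarrow>
    frag_of (r \<odot>\<^bsub>M\<^esub> m, n) - frag_of (m, r \<odot>\<^bsub>N\<^esub> n) \<in> tensor_relations R M N"

definition free_pairs ::
    "('r, 'm, 'c) module_scheme \<Rightarrow> ('r, 'n, 'd) module_scheme \<Rightarrow> (('m \<times> 'n) \<Rightarrow>\<^sub>0 int) set" where
  "free_pairs M N = {z. Poly_Mapping.keys z \<subseteq> carrier M \<times> carrier N}"

definition tensor_class ::
    "'r set \<Rightarrow> ('r, 'm, 'c) module_scheme \<Rightarrow> ('r, 'n, 'd) module_scheme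
      \<Rightarrow> (('m \<times> 'n) \<Rightarrow>\<^sub>0 int) \<Rightarrow> (('m \<times> 'n) \<Rightarrow>\<^sub>0 int) set" where
  "tensor_class R M N z = {w \<in> free_pairs M N. w - z \<in> tensor_relations R M N}"

definition tensor_product ::
    "'r set \<Rightarrow> ('r, 'm, 'c) module_scheme \<Rightarrow> ('r, 'n, 'd) module_scheme
      \<Rightarrow> ('r, (('m \<times> 'n) \<Rightarrow>\<^sub>0 int) set) module" where
  "tensor_product R M N =
    \<lparr>carrier = tensor_class R M N ` free_pairs M N,
     mult = (\<lambda>A B. \<Union>a\<in>A. \<Union>b\<in>B. tensor_class R M N
       (frag_extend (\<lambda>(m, n). frag_extend (\<lambda>(m', n'). frag_of (m \<otimes>\<^bsub>M\<^esub> m', n \<otimes>\<^bsub>N\<^esub> n')) b) a)),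
     one = tensor_class R M N (frag_of (\<one>\<^bsub>M\<^esub>, \<one>\<^bsub>N\<^esub>)),
     zero = tensor_class R M N 0,
     add = (\<lambda>A B. \<Union>a\<in>A. \<Union>b\<in>B. tensor_class R M N (a + b)),
     smult = (\<lambda>s A. \<Union>a\<in>A. tensor_class R M N (frag_extend (\<lambda>(m, n). frag_of (s \<odot>\<^bsub>M\<^esub> m, n)) a))\<rparr>"

text \<open>
  The additive map on a tensor product sending \<open>m \<otimes> n\<close> to \<open>\<beta> m n\<close>, for a balanced biadditive map \<open>\<beta>\<close>
  whose values are \<open>'k\<close>-valued functions.
\<close>

definition tensor_eval ::
    "('m \<Rightarrow> 'n \<Rightarrow> 'f \<Rightarrow> 'k::comm_ring_1) \<Rightarrow> (('m \<times> 'n) \<Rightarrow>\<^sub>0 int) \<Rightarrow> 'f \<Rightarrow> 'k" where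
  "tensor_eval \<beta> z f =
    (\<Sum>(m, n) \<in> Poly_Mapping.keys z. of_int (Poly_Mapping.lookup z (m, n)) * \<beta> m n f)"

definition tensor_lift ::
    "('m \<Rightarrow> 'n \<Rightarrow> 'f \<Rightarrow> 'k::comm_ring_1) \<Rightarrow> (('m \<times> 'n) \<Rightarrow>\<^sub>0 int) set \<Rightarrow> 'f \<Rightarrow> 'k" where
  "tensor_lift \<beta> C = tensor_eval \<beta> (SOME z. z \<in> C)"

lemma tensor_eval_superset:
  assumes "finite S" "Poly_Mapping.keys z \<subseteq> S"
  shows "tensor_eval \<beta> z f = (\<Sum>(m, n) \<in> S. of_int (Poly_Mapping.lookup z (m, n)) * \<beta> m n f)"
  unfolding tensor_eval_def using assms
  by (intro sum.mono_neutral_left) (auto simp: in_keys_iff)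

lemma tensor_eval_frag_of: "tensor_eval \<beta> (frag_of (m, n)) f = \<beta> m n f"
  unfolding tensor_eval_def by simp

lemma tensor_eval_diff: "tensor_eval \<beta> (z - w) f = tensor_eval \<beta> z f - tensor_eval \<beta> w f"
proof -
  let ?S = "Poly_Mapping.keys z \<union> Poly_Mapping.keys w"
  have "Poly_Mapping.keys (z - w) \<subseteq> ?S" by (rule keys_diff)
  then show ?thesis
    by (simp add: tensor_eval_superset[of ?S] lookup_minus sum_subtractf[symmetric]
        left_diff_distrib case_prod_unfold)
qed

lemma tensor_lift_class:
  assumes add_left: "\<And>m m' n f. m \<in> carrier M \<Longrightarrow> m' \<in> carrier M \<Longrightarrow> n \<in> carrier N \<Longrightarrow>
      \<beta> (m \<oplus>\<^bsub>M\<^esub> m') n f = \<beta> m n f + \<beta> m' n f"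
    and add_right: "\<And>m n n' f. m \<in> carrier M \<Longrightarrow> n \<in> carrier N \<Longrightarrow> n' \<in> carrier N \<Longrightarrow>
      \<beta> m (n \<oplus>\<^bsub>N\<^esub> n') f = \<beta> m n f + \<beta> m n' f"
    and balanced: "\<And>r m n f. r \<in> R \<Longrightarrow> m \<in> carrier M \<Longrightarrow> n \<in> carrier N \<Longrightarrow>
      \<beta> (r \<odot>\<^bsub>M\<^esub> m) n f = \<beta> m (r \<odot>\<^bsub>N\<^esub> n) f"
    and z: "z \<in> free_pairs M N"
  shows "tensor_lift \<beta> (tensor_class R M N z) = tensor_eval \<beta> z"
proof -
  have null: "tensor_eval \<beta> w f = 0" if "w \<in> tensor_relations R M N" for w f
    using that
  proof induction
    case zero
    then show ?case by (simp add: tensor_eval_def)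
  qed (simp_all add: tensor_eval_diff tensor_eval_frag_of add_left add_right balanced)
  have "z \<in> tensor_class R M N z"
    using z tensor_relations.zero[of R M N] by (simp add: tensor_class_def)
  then have "(SOME w. w \<in> tensor_class R M N z) \<in> tensor_class R M N z"
    by (rule someI)
  then have "(SOME w. w \<in> tensor_class R M N z) - z \<in> tensor_relations R M N"
    by (simp add: tensor_class_def)
  then have "tensor_eval \<beta> ((SOME w. w \<in> tensor_class R M N z) - z) f = 0" for f
    by (rule null)
  then show ?thesis
    by (simp add: tensor_lift_def tensor_eval_diff fun_eq_iff)
qed


section \<open>Completed group rings\<close>

definition group_ring :: "'k::comm_ring_1 set \<Rightarrow> ('q, 'b) monoid_scheme \<Rightarrow> ('k, 'q \<Rightarrow> 'k) module" where
  "group_ring R Q =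
    \<lparr>carrier = {a. finite {q. a q \<noteq> 0} \<and> (\<forall>q. a q \<in> R) \<and> (\<forall>q. q \<notin> carrier Q \<longrightarrow> a q = 0)},
     mult = (\<lambda>a b q. if q \<in> carrier Q then \<Sum>r | a r \<noteq> 0. a r * b (inv\<^bsub>Q\<^esub> r \<otimes>\<^bsub>Q\<^esub> q) else 0),
     one = (\<lambda>q. if q = \<one>\<^bsub>Q\<^esub> then 1 else 0),
     zero = (\<lambda>_. 0),
     add = (\<lambda>a b q. a q + b q),
     smult = (\<lambda>c a q. c * a q)\<rparr>"

definition open_normal_subgroups :: "('h, 'b) monoid_scheme \<Rightarrow> 'h topology \<Rightarrow> 'h set set" where
  "open_normal_subgroups G X = {U. U \<lhd> G \<and> openin X U}"

text \<open>The map \<open>R[G/U] \<rightarrow> R[G/V]\<close> for \<open>U \<subseteq> V\<close>.\<close>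

definition group_ring_projection ::
    "('h, 'b) monoid_scheme \<Rightarrow> 'h set \<Rightarrow> 'h set \<Rightarrow> ('h set \<Rightarrow> 'k::comm_ring_1) \<Rightarrow> 'h set \<Rightarrow> 'k" where
  "group_ring_projection G U V a =
    (\<lambda>C. if C \<in> carrier (G Mod V) then \<Sum>D | D \<in> carrier (G Mod U) \<and> D \<subseteq> C. a D else 0)"

text \<open>Families indexed by the open normal subgroups are extended by zero to all other sets.\<close>

definition completed_group_ring ::
    "'k::comm_ring_1 set \<Rightarrow> ('h, 'b) monoid_scheme \<Rightarrow> 'h topology \<Rightarrow> ('k, 'h set \<Rightarrow> 'h set \<Rightarrow> 'k) module" where
  "completed_group_ring R G X =
    \<lparr>carrier = {\<xi>.
        (\<forall>U \<in> open_normal_subgroups G X. \<xi> U \<in> carrier (group_ring R (G Mod U))) \<and>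
        (\<forall>U. U \<notin> open_normal_subgroups G X \<longrightarrow> \<xi> U = (\<lambda>_. 0)) \<and>
        (\<forall>U \<in> open_normal_subgroups G X. \<forall>V \<in> open_normal_subgroups G X.
          U \<subseteq> V \<longrightarrow> \<xi> V = group_ring_projection G U V (\<xi> U))},
     mult = (\<lambda>\<xi> \<eta> U. if U \<in> open_normal_subgroups G X
        then \<xi> U \<otimes>\<^bsub>group_ring R (G Mod U)\<^esub> \<eta> U else (\<lambda>_. 0)),
     one = (\<lambda>U. if U \<in> open_normal_subgroups G X then \<one>\<^bsub>group_ring R (G Mod U)\<^esub> else (\<lambda>_. 0)),
     zero = (\<lambda>U C. 0),
     add = (\<lambda>\<xi> \<eta> U C. \<xi> U C + \<eta> U C),
     smult = (\<lambda>c \<xi> U C. c * \<xi> U C)\<rparr>"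

definition field_algebra :: "('k::field, 'k) module" where
  "field_algebra =
    \<lparr>carrier = UNIV, mult = (*), one = 1, zero = 0, add = (+), smult = (*)\<rparr>"

definition iwasawa_algebra ::
    "('h, 'b) monoid_scheme \<Rightarrow> 'h topology
      \<Rightarrow> ('k::nonarch_field, (('k \<times> ('h set \<Rightarrow> 'h set \<Rightarrow> 'k)) \<Rightarrow>\<^sub>0 int) set) module" where
  "iwasawa_algebra G X =
    tensor_product valuation_ring field_algebra (completed_group_ring valuation_ring G X)"

text \<open>
  The pairing of \<open>\<xi>\<close> in the completed group ring with a continuous function \<open>f\<close>: the limit, over the
  open normal subgroups \<open>U\<close>, of \<open>f\<close> evaluated on lifts of \<open>\<xi> U\<close> to the group ring of \<open>G\<close>. It is the
  unique extension of evaluation at group elements that is \<open>R\<close>-linear and continuous.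
\<close>

definition measure_pairing ::
    "('h, 'b) monoid_scheme \<Rightarrow> 'h topology \<Rightarrow> ('h set \<Rightarrow> 'h set \<Rightarrow> 'k::nonarch_field) \<Rightarrow> ('h \<Rightarrow> 'k) \<Rightarrow> 'k" where
  "measure_pairing G X \<xi> f = (THE s. \<forall>e>0. \<exists>U\<^sub>0 \<in> open_normal_subgroups G X.
    \<forall>U \<in> open_normal_subgroups G X. U \<subseteq> U\<^sub>0 \<longrightarrow>
      (\<forall>r. (\<forall>C \<in> carrier (G Mod U). r C \<in> C) \<longrightarrow>
        dist (\<Sum>C \<in> carrier (G Mod U). \<xi> U C * f (r C)) s < e))"

definition iwasawa_to_dist ::
    "('l::nonarch_field \<Rightarrow> 'k::nonarch_field) \<Rightarrow> ('h, 'b) monoid_scheme \<Rightarrow> ('h, 'l) manifold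
      \<Rightarrow> (('k \<times> ('h set \<Rightarrow> 'h set \<Rightarrow> 'k)) \<Rightarrow>\<^sub>0 int) set \<Rightarrow> ('h \<Rightarrow> 'k) \<Rightarrow> 'k" where
  "iwasawa_to_dist \<iota> G M =
    tensor_lift (\<lambda>c \<xi> f. if f \<in> Can \<iota> M then c * measure_pairing G (mtop M) \<xi> f else 0)"

definition iwasawa_tensor_dist_at_one ::
    "('l::nonarch_field \<Rightarrow> 'k::nonarch_field) \<Rightarrow> ('h, 'b) monoid_scheme \<Rightarrow> ('h, 'l) manifold
      \<Rightarrow> ('k, (((('k \<times> ('h set \<Rightarrow> 'h set \<Rightarrow> 'k)) \<Rightarrow>\<^sub>0 int) set \<times> (('h \<Rightarrow> 'k) \<Rightarrow> 'k)) \<Rightarrow>\<^sub>0 int) set) module" where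
  "iwasawa_tensor_dist_at_one \<iota> G M =
    tensor_product UNIV (iwasawa_algebra G (mtop M)) (dist_algebra_at_one \<iota> G M)"

definition natural_map ::
    "('l::nonarch_field \<Rightarrow> 'k::nonarch_field) \<Rightarrow> ('h, 'b) monoid_scheme \<Rightarrow> ('h, 'l) manifold
      \<Rightarrow> (((('k \<times> ('h set \<Rightarrow> 'h set \<Rightarrow> 'k)) \<Rightarrow>\<^sub>0 int) set \<times> (('h \<Rightarrow> 'k) \<Rightarrow> 'k)) \<Rightarrow>\<^sub>0 int) set
      \<Rightarrow> ('h \<Rightarrow> 'k) \<Rightarrow> 'k" where
  "natural_map \<iota> G M =
    tensor_lift (\<lambda>\<mu> \<nu>. iwasawa_to_dist \<iota> G M \<mu> \<otimes>\<^bsub>dist_algebra \<iota> G M\<^esub> \<nu>)"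

end

theory Submission
  imports Defs
begin

text \<open>
  Write an element of the tensor product as \<open>\<Sum>\<^sub>i \<mu>\<^sub>i \<otimes> \<nu>\<^sub>i\<close> with as few terms as possible. Then no \<open>\<nu>\<^sub>i\<close> is a
  linear combination of the others (\<open>shorten_dependent_sum\<close>), so there are analytic functions
  \<open>f\<^sub>j\<close> with \<open>\<nu>\<^sub>i (f\<^sub>j) = \<delta>\<^sub>i\<^sub>j\<close> (\<open>functional_in_span\<close>). A distribution \<open>\<nu>\<close> acts on analytic functions by
  \<open>(\<nu> \<cdot> f) x = \<nu> (y \<mapsto> f (x y))\<close>, and the image of the tensor sends \<open>f\<close> to \<open>\<Sum>\<^sub>i \<mu>\<^sub>i (\<nu>\<^sub>i \<cdot> f)\<close>.

  A distribution supported at the identity acts locally: multiplying \<open>f\<close> by the indicator function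
  of a small coset multiplies \<open>\<nu> \<cdot> f\<close> by the same indicator function (\<open>act_indicator\<close>). So if the
  image is zero, then for every \<open>f\<close> the measure \<open>\<Sum>\<^sub>i (\<nu>\<^sub>i \<cdot> f) \<mu>\<^sub>i\<close> is zero, and not only its total mass.
  Translating the \<open>f\<^sub>j\<close> to a point \<open>p\<close> gives continuous functions \<open>h\<^sub>i\<^sub>j\<close> with \<open>h\<^sub>i\<^sub>j (p) = \<delta>\<^sub>i\<^sub>j\<close> and
  \<open>\<Sum>\<^sub>i h\<^sub>i\<^sub>j \<mu>\<^sub>i = 0\<close>. Near \<open>p\<close> the matrix \<open>h\<close> is close to the identity matrix, so that
  \<open>\<mu>\<^sub>j = \<Sum>\<^sub>i (\<delta>\<^sub>i\<^sub>j - h\<^sub>i\<^sub>j) \<mu>\<^sub>i\<close> bounds the masses of small cosets near \<open>p\<close> by half of themselves. Since the masses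
  are bounded, all \<open>\<mu>\<^sub>j\<close> vanish near \<open>p\<close> (\<open>measures_vanish_near\<close>), hence everywhere by compactness,
  and the tensor is zero (\<open>conv_kernel\<close>).

  Two analytic facts make this meaningful. First, \<open>\<nu> \<cdot> f\<close> is again analytic (\<open>act_Can\<close>): \<open>f (x y)\<close> has
  a joint power series expansion near \<open>(x\<^sub>0, 1)\<close>, because compositions of analytic maps are analytic
  (\<open>expands_on_compose_map\<close>), and \<open>\<nu>\<close> can be applied to it term by term, because continuity of
  \<open>\<nu>\<close> bounds it on the power series that converge on one fixed polydisc around \<open>1\<close>
  (\<open>distribution_bound\<close>, \<open>expands_on_functional\<close>). Second, an analytic function on \<open>H\<close> is uniformly
  continuous for the cosets of open normal subgroups (\<open>Can_varies_le\<close>), so that its integral against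
  an element of the completed group ring is a limit of finite sums with explicit error bounds
  (\<open>pairing_approx\<close>).
\<close>


section \<open>Summation over a complete non-archimedean field\<close>

lemma absv_0 [simp]: "absv (0::'a::nonarch_field) = 0"
  by (metis diff_self dist_absv dist_self)

lemma absv_nonneg [simp]: "0 \<le> absv (x::'a::nonarch_field)"
  by (metis absv_0 absv_pos less_eq_real_def)

lemma absv_eq_0_iff [simp]: "absv (x::'a::nonarch_field) = 0 \<longleftrightarrow> x = 0"
  using absv_pos by force

lemma absv_1 [simp]: "absv (1::'a::nonarch_field) = 1"
proof -
  have "absv (1::'a) * absv (1::'a) = absv (1::'a)" by (simp flip: absv_mult)
  then show ?thesis by simp
qed

lemma absv_minus [simp]: "absv (- x::'a::nonarch_field) = absv x"
  by (metis diff_0 diff_zero dist_absv dist_commute)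

lemma absv_diff_commute: "absv (x - y::'a::nonarch_field) = absv (y - x)"
  by (metis absv_minus minus_diff_eq)

lemma absv_diff: "absv (x - y::'a::nonarch_field) \<le> max (absv x) (absv y)"
  by (metis absv_add absv_minus add_uminus_conv_diff)

lemma absv_add_le: "absv x \<le> B \<Longrightarrow> absv y \<le> B \<Longrightarrow> absv (x + y::'a::nonarch_field) \<le> B"
  by (rule order_trans[OF absv_add]) simp

lemma absv_diff_le: "absv x \<le> B \<Longrightarrow> absv y \<le> B \<Longrightarrow> absv (x - y::'a::nonarch_field) \<le> B"
  by (rule order_trans[OF absv_diff]) simp

lemma absv_power: "absv (x ^ n::'a::nonarch_field) = absv x ^ n"
  by (induction n) (simp_all add: absv_mult)

lemma absv_prod: "absv (prod f A::'a::nonarch_field) = (\<Prod>i\<in>A. absv (f i))"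
  by (induction A rule: infinite_finite_induct) (simp_all add: absv_mult)

lemma absv_inverse: "absv (inverse x::'a::nonarch_field) = inverse (absv x)"
proof (cases "x = 0")
  case False
  then have "absv x * absv (inverse x) = 1" by (simp flip: absv_mult)
  then show ?thesis by (metis inverse_unique)
qed simp

lemma absv_sum_le:
  "(\<And>i. i \<in> F \<Longrightarrow> absv (u i::'a::nonarch_field) \<le> B) \<Longrightarrow> 0 \<le> B \<Longrightarrow> absv (sum u F) \<le> B"
  by (induction F rule: infinite_finite_induct) (simp_all add: absv_add_le)

text \<open>
  Over a complete non-archimedean field, families tending to zero are already summable, in any order.
\<close>

definition c0_on :: "'i set \<Rightarrow> ('i \<Rightarrow> 'a::nonarch_field) \<Rightarrow> bool" where
  "c0_on A u \<longleftrightarrow> (\<forall>e>0. finite {i \<in> A. e \<le> absv (u i)})"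

lemma c0_onD: "c0_on A u \<Longrightarrow> e > 0 \<Longrightarrow> finite {i \<in> A. e \<le> absv (u i)}"
  by (simp add: c0_on_def)

lemma c0_on_dominated:
  assumes "\<And>e. e > 0 \<Longrightarrow> finite {i \<in> A. e \<le> (B i::real)}" "\<And>i. i \<in> A \<Longrightarrow> absv (u i) \<le> B i"
  shows "c0_on A u"
  unfolding c0_on_def
proof (intro allI impI)
  fix e :: real assume "e > 0"
  from assms(1)[OF this] show "finite {i \<in> A. e \<le> absv (u i)}"
    by (rule finite_subset[rotated]) (use order_trans[OF _ assms(2)] in blast)
qed

lemma has_sum_absv_iff:
  fixes u :: "'i \<Rightarrow> 'a::nonarch_field"
  shows "(u has_sum s) A \<longleftrightarrow> (\<forall>e>0. \<exists>F. finite F \<and> F \<subseteq> A \<and>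
    (\<forall>F'. finite F' \<and> F \<subseteq> F' \<and> F' \<subseteq> A \<longrightarrow> absv (sum u F' - s) < e))"
  unfolding has_sum_def tendsto_iff eventually_finite_subsets_at_top dist_absv by (rule refl)

lemma has_sum_unique_nonarch:
  fixes u :: "'i \<Rightarrow> 'a::nonarch_field"
  assumes "(u has_sum s) A" "(u has_sum t) A"
  shows "s = t"
  using assms unfolding has_sum_def by (rule tendsto_unique[OF finite_subsets_at_top_neq_bot])

text \<open>
  By the ultrametric inequality the error of a partial sum is at most the largest omitted term, with
  no summation of errors. All estimates of power series below come from this.
\<close>

lemma has_sum_tail:
  fixes u :: "'i \<Rightarrow> 'a::nonarch_field"
  assumes s: "(u has_sum s) A" and F: "finite F" "F \<subseteq> A"
    and le: "\<And>i. i \<in> A - F \<Longrightarrow> absv (u i) \<le> e" and e: "0 \<le> e"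
  shows "absv (sum u F - s) \<le> e"
proof (rule ccontr)
  assume "\<not> ?thesis"
  then have gt: "e < absv (sum u F - s)" by simp
  then have "0 < absv (sum u F - s)" using e by linarith
  from s[unfolded has_sum_absv_iff, rule_format, OF this]
  obtain X where X: "finite X" "X \<subseteq> A"
    "\<And>F'. finite F' \<Longrightarrow> X \<subseteq> F' \<Longrightarrow> F' \<subseteq> A \<Longrightarrow> absv (sum u F' - s) < absv (sum u F - s)"
    by metis
  have 1: "absv (sum u (X \<union> F) - s) < absv (sum u F - s)"
    using X F by simp
  have "X \<union> F = F \<union> (X - F)" by blast
  then have "sum u (X \<union> F) = sum u F + sum u (X - F)"
    using X(1) F(1) by (metis Diff_disjoint finite_Diff sum.union_disjoint)
  then have eq: "sum u F - s = (sum u (X \<union> F) - s) - sum u (X - F)" by simp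
  have 2: "absv (sum u (X - F)) \<le> e"
    by (rule absv_sum_le) (use le X e in auto)
  show False
    using absv_diff[of "sum u (X \<union> F) - s" "sum u (X - F)"] 1 2 gt unfolding eq[symmetric] by linarith
qed

lemma has_sum_absv_le:
  fixes u :: "'i \<Rightarrow> 'a::nonarch_field"
  assumes "(u has_sum s) A" "\<And>i. i \<in> A \<Longrightarrow> absv (u i) \<le> B" "0 \<le> B"
  shows "absv s \<le> B"
  using has_sum_tail[OF assms(1), of "{}" B] assms by simp

text \<open>
  The partial sums over the finite sets of members exceeding \<open>1 / (n + 1)\<close> form a Cauchy sequence.
\<close>

lemma c0_summable:
  fixes u :: "'i \<Rightarrow> 'a::{nonarch_field, complete_space}"
  assumes c0: "c0_on A u"
  obtains s where "(u has_sum s) A"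
proof -
  define F where "F n = {i \<in> A. inverse (real (Suc n)) \<le> absv (u i)}" for n
  have finF: "finite (F n)" for n
    using c0 by (simp add: F_def c0_on_def)
  have mono: "F m \<subseteq> F n" if "m \<le> n" for m n
  proof
    fix i assume "i \<in> F m"
    moreover have "inverse (real (Suc n)) \<le> inverse (real (Suc m))"
      using that by simp
    ultimately show "i \<in> F n"
      unfolding F_def mem_Collect_eq by linarith
  qed
  have tail: "absv (sum u F' - sum u (F n)) \<le> e"
    if "finite F'" "F n \<subseteq> F'" "F' \<subseteq> A" "inverse (real (Suc n)) \<le> e" for F' n e
  proof -
    have "sum u F' - sum u (F n) = sum u (F' - F n)"
      using that by (simp add: sum_diff)
    moreover have "0 < inverse (real (Suc n))" by simp
    then have "0 \<le> e" using that(4) by linarith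
    ultimately show ?thesis
      using that by (simp only:) (rule absv_sum_le, force simp: F_def simp del: of_nat_Suc)
  qed
  have "Cauchy (\<lambda>n. sum u (F n))"
  proof (rule metric_CauchyI)
    fix e :: real assume "e > 0"
    then obtain N where N: "inverse (real (Suc N)) < e"
      using reals_Archimedean by blast
    have *: "dist (sum u (F n)) (sum u (F N)) \<le> inverse (real (Suc N))" if "n \<ge> N" for n
      unfolding dist_absv by (rule tail) (use finF mono that in \<open>auto simp: F_def\<close>)
    show "\<exists>N. \<forall>m\<ge>N. \<forall>n\<ge>N. dist (sum u (F m)) (sum u (F n)) < e"
    proof (intro exI[of _ N] allI impI)
      fix m n assume "N \<le> m" "N \<le> n"
      from *[OF this(1)] *[OF this(2)]
      have "absv ((sum u (F m) - sum u (F N)) - (sum u (F n) - sum u (F N))) \<le> inverse (real (Suc N))"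
        unfolding dist_absv by (rule absv_diff_le)
      then show "dist (sum u (F m)) (sum u (F n)) < e"
        using N by (simp add: dist_absv)
    qed
  qed
  then obtain s where s: "(\<lambda>n. sum u (F n)) \<longlonglongrightarrow> s"
    using Cauchy_convergent convergent_def by blast
  have "(u has_sum s) A"
    unfolding has_sum_absv_iff
  proof (intro allI impI)
    fix e :: real assume e: "e > 0"
    then obtain N where N: "\<And>n. n \<ge> N \<Longrightarrow> dist (sum u (F n)) s < e"
      using s unfolding lim_sequentially by meson
    obtain N' where N': "inverse (real (Suc N')) < e"
      using e reals_Archimedean by blast
    define n where "n = max N N'"
    have n: "inverse (real (Suc n)) \<le> inverse (real (Suc N'))" "n \<ge> N"
      unfolding n_def by (auto intro: le_imp_inverse_le)
    show "\<exists>F. finite F \<and> F \<subseteq> A \<and> (\<forall>F'. finite F' \<and> F \<subseteq> F' \<and> F' \<subseteq> A \<longrightarrow> absv (sum u F' - s) < e)"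
    proof (intro exI[of _ "F n"] conjI allI impI)
      fix F' assume F': "finite F' \<and> F n \<subseteq> F' \<and> F' \<subseteq> A"
      have "absv (sum u F' - sum u (F n)) \<le> inverse (real (Suc n))"
        using tail F' by blast
      moreover have "absv (sum u (F n) - s) < e" using N[OF n(2)] by (simp add: dist_absv)
      ultimately have "max (absv (sum u F' - sum u (F n))) (absv (sum u (F n) - s)) < e"
        using N' n(1) by linarith
      moreover have "sum u F' - s = (sum u F' - sum u (F n)) + (sum u (F n) - s)" by simp
      ultimately show "absv (sum u F' - s) < e"
        by (metis absv_add order_le_less_trans)
    qed (use finF in \<open>auto simp: F_def\<close>)
  qed
  then show thesis by (rule that)
qed

lemma has_sum_cmult_nonarch:
  fixes u :: "'i \<Rightarrow> 'a::nonarch_field"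
  assumes "(u has_sum s) A"
  shows "((\<lambda>i. c * u i) has_sum c * s) A"
proof (cases "c = 0")
  case True
  then show ?thesis by simp
next
  case False
  then have c: "absv c > 0" by (rule absv_pos)
  show ?thesis
    unfolding has_sum_absv_iff
  proof (intro allI impI)
    fix e :: real assume "e > 0"
    then have "e / absv c > 0" using c by simp
    from assms[unfolded has_sum_absv_iff, rule_format, OF this] obtain F where "finite F" "F \<subseteq> A"
      "\<And>F'. finite F' \<Longrightarrow> F \<subseteq> F' \<Longrightarrow> F' \<subseteq> A \<Longrightarrow> absv (sum u F' - s) < e / absv c"
      by metis
    then show "\<exists>F. finite F \<and> F \<subseteq> A \<and>
        (\<forall>F'. finite F' \<and> F \<subseteq> F' \<and> F' \<subseteq> A \<longrightarrow> absv (sum (\<lambda>i. c * u i) F' - c * s) < e)"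
      using c by (intro exI[of _ F]) (auto simp: sum_distrib_left[symmetric]
          right_diff_distrib[symmetric] absv_mult pos_less_divide_eq mult.commute)
  qed
qed

text \<open>
  Fubini: outside a finite set of pairs the terms are small, and then all inner and outer errors are
  small as well, each being at most the largest omitted term.
\<close>

lemma has_sum_iterated:
  fixes u :: "'i \<times> 'j \<Rightarrow> 'a::nonarch_field"
  assumes c0: "c0_on (I \<times> J) u"
    and v: "\<And>i. i \<in> I \<Longrightarrow> ((\<lambda>j. u (i, j)) has_sum v i) J"
    and s: "(u has_sum s) (I \<times> J)"
  shows "(v has_sum s) I"
  unfolding has_sum_absv_iff
proof (intro allI impI)
  fix e :: real assume e: "e > 0"
  define E where "E = {p \<in> I \<times> J. e / 2 \<le> absv (u p)}"
  have E: "finite E" "E \<subseteq> I \<times> J" using c0_onD[OF c0, of "e / 2"] e by (auto simp: E_def)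
  have fE: "absv (sum u E - s) \<le> e / 2"
    by (rule has_sum_tail[OF s E]) (use e in \<open>auto simp: E_def\<close>)
  show "\<exists>F. finite F \<and> F \<subseteq> I \<and> (\<forall>F'. finite F' \<and> F \<subseteq> F' \<and> F' \<subseteq> I \<longrightarrow> absv (sum v F' - s) < e)"
  proof (intro exI[of _ "fst ` E"] conjI allI impI)
    fix F assume F: "finite F \<and> fst ` E \<subseteq> F \<and> F \<subseteq> I"
    have finr: "finite {j. (i, j) \<in> E}" for i
      using E(1) by (rule finite_surj[of _ _ snd]) force
    have "E = Sigma F (\<lambda>i. {j. (i, j) \<in> E})" using F by force
    then have "sum u E = (\<Sum>i\<in>F. \<Sum>j\<in>{j. (i, j) \<in> E}. u (i, j))"
      using F finr by (subst sum.Sigma) auto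
    then have "sum v F - sum u E = (\<Sum>i\<in>F. v i - (\<Sum>j\<in>{j. (i, j) \<in> E}. u (i, j)))"
      by (simp add: sum_subtractf)
    moreover have "absv (v i - (\<Sum>j\<in>{j. (i, j) \<in> E}. u (i, j))) \<le> e / 2" if "i \<in> F" for i
    proof -
      have "absv ((\<Sum>j\<in>{j. (i, j) \<in> E}. u (i, j)) - v i) \<le> e / 2"
        by (rule has_sum_tail[OF v]) (use that F finr E e in \<open>auto simp: E_def\<close>)
      then show ?thesis by (simp add: absv_diff_commute)
    qed
    ultimately have "absv (sum v F - sum u E) \<le> e / 2"
      using e by (simp only:) (rule absv_sum_le, auto)
    with fE have "absv ((sum v F - sum u E) + (sum u E - s)) \<le> e / 2" by (intro absv_add_le)
    then show "absv (sum v F - s) < e" using e by simp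
  qed (use E in auto)
qed

lemma has_sum_swap_nonarch:
  fixes u :: "'i \<Rightarrow> 'j \<Rightarrow> 'a::{nonarch_field, complete_space}"
  assumes c0: "c0_on (I \<times> J) (\<lambda>(i, j). u i j)"
    and v: "\<And>i. i \<in> I \<Longrightarrow> ((\<lambda>j. u i j) has_sum v i) J"
    and w: "\<And>j. j \<in> J \<Longrightarrow> ((\<lambda>i. u i j) has_sum w j) I"
    and s: "(v has_sum s) I"
  shows "(w has_sum s) J"
proof -
  obtain t where t: "((\<lambda>(i, j). u i j) has_sum t) (I \<times> J)" using c0_summable[OF c0] .
  have "(v has_sum t) I" by (rule has_sum_iterated[OF c0 _ t]) (use v in simp)
  from has_sum_unique_nonarch[OF this s] have ts: "t = s" .
  have bij: "bij_betw prod.swap (J \<times> I) (I \<times> J)"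
    by (auto simp: bij_betw_def product_swap)
  have c0': "c0_on (J \<times> I) (\<lambda>(j, i). u i j)"
    unfolding c0_on_def
  proof (intro allI impI)
    fix e :: real assume "e > 0"
    from c0_onD[OF c0 this] have "finite (prod.swap ` {p \<in> I \<times> J. e \<le> absv (case p of (i, j) \<Rightarrow> u i j)})"
      by (rule finite_imageI)
    then show "finite {p \<in> J \<times> I. e \<le> absv (case p of (j, i) \<Rightarrow> u i j)}"
      by (rule finite_subset[rotated]) force
  qed
  have "((\<lambda>(j, i). u i j) has_sum s) (J \<times> I)"
    using has_sum_reindex_bij_betw[OF bij, of "\<lambda>(i, j). u i j" s] t ts
    by (simp add: case_prod_unfold)
  then show ?thesis
    by (intro has_sum_iterated[OF c0']) (use w in simp_all)
qed


section \<open>Convergent power series on polydiscs\<close>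

lemma polydisc_mono: "\<epsilon>' \<le> \<epsilon> \<Longrightarrow> polydisc d x \<epsilon>' \<subseteq> polydisc d x \<epsilon>"
  by (force simp: polydisc_def)

lemma polydisc_center: "x \<in> vecs d \<Longrightarrow> 0 \<le> \<epsilon> \<Longrightarrow> x \<in> polydisc d x \<epsilon>"
  by (auto simp: polydisc_def)

lemma zero_in_vecs [simp]: "(\<lambda>_. 0) \<in> vecs d"
  by (simp add: vecs_def)

lemma expands_on_cong:
  assumes "expands_on \<iota> d x \<epsilon> a f" "\<And>y. y \<in> polydisc d x \<epsilon> \<Longrightarrow> f y = g y"
  shows "expands_on \<iota> d x \<epsilon> a g"
  using assms unfolding expands_on_def by simp

lemma expands_on_mono:
  assumes a: "expands_on \<iota> d x \<epsilon> a f" and e: "0 \<le> \<epsilon>'" "\<epsilon>' \<le> \<epsilon>"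
  shows "expands_on \<iota> d x \<epsilon>' a f"
proof -
  have le: "absv (a \<alpha>) * \<epsilon>' ^ (\<Sum>i<d. \<alpha> i) \<le> absv (a \<alpha>) * \<epsilon> ^ (\<Sum>i<d. \<alpha> i)" for \<alpha>
    using e by (intro mult_left_mono power_mono) auto
  have "finite {\<alpha> \<in> vecs d. r \<le> absv (a \<alpha>) * \<epsilon>' ^ (\<Sum>i<d. \<alpha> i)}" if "r > 0" for r
  proof (rule finite_subset)
    show "{\<alpha> \<in> vecs d. r \<le> absv (a \<alpha>) * \<epsilon>' ^ (\<Sum>i<d. \<alpha> i)}
        \<subseteq> {\<alpha> \<in> vecs d. r \<le> absv (a \<alpha>) * \<epsilon> ^ (\<Sum>i<d. \<alpha> i)}"
      using le by (auto intro: order_trans)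
    show "finite {\<alpha> \<in> vecs d. r \<le> absv (a \<alpha>) * \<epsilon> ^ (\<Sum>i<d. \<alpha> i)}"
      using a that unfolding expands_on_def by blast
  qed
  moreover have "polydisc d x \<epsilon>' \<subseteq> polydisc d x \<epsilon>" using e by (intro polydisc_mono)
  ultimately show ?thesis using a unfolding expands_on_def by blast
qed

lemma expands_on_bounded:
  assumes "expands_on \<iota> d x \<epsilon> a f"
  obtains B where "0 \<le> B" "\<And>\<alpha>. \<alpha> \<in> vecs d \<Longrightarrow> absv (a \<alpha>) * \<epsilon> ^ (\<Sum>i<d. \<alpha> i) \<le> B"
proof -
  let ?t = "\<lambda>\<alpha>. absv (a \<alpha>) * \<epsilon> ^ (\<Sum>i<d. \<alpha> i)"
  let ?S = "{\<alpha> \<in> vecs d. 1 \<le> ?t \<alpha>}"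
  have fin: "finite ?S" using assms unfolding expands_on_def by (meson zero_less_one)
  show thesis
  proof (rule that[of "Max (insert 1 (?t ` ?S))"])
    show "0 \<le> Max (insert 1 (?t ` ?S))"
      using fin by (intro order_trans[OF _ Max_ge[of _ 1]]) auto
    show "?t \<alpha> \<le> Max (insert 1 (?t ` ?S))" if "\<alpha> \<in> vecs d" for \<alpha>
    proof (cases "1 \<le> ?t \<alpha>")
      case True
      then show ?thesis using fin that by (intro Max_ge) auto
    next
      case False
      then show ?thesis using fin by (intro order_trans[OF _ Max_ge[of _ 1]]) auto
    qed
  qed
qed

text \<open>
  The bound \<open>B\<close> is one for the norm \<open>sup \<bar>a \<alpha>\<bar> \<epsilon>\<^bsup>\<bar>\<alpha>\<bar>\<^esup>\<close> of the Banach algebra of power series converging on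
  the polydisc. The closure properties of this predicate replace computations with coefficients.
\<close>

definition expands_le ::
    "('l::nonarch_field \<Rightarrow> 'k::nonarch_field) \<Rightarrow> nat \<Rightarrow> (nat \<Rightarrow> 'l) \<Rightarrow> real
      \<Rightarrow> ((nat \<Rightarrow> 'l) \<Rightarrow> 'k) \<Rightarrow> real \<Rightarrow> bool" where
  "expands_le \<iota> d x \<epsilon> f B \<longleftrightarrow> (\<exists>a. expands_on \<iota> d x \<epsilon> a f \<and>
    (\<forall>\<alpha>\<in>vecs d. absv (a \<alpha>) * \<epsilon> ^ (\<Sum>i<d. \<alpha> i) \<le> B))"

lemma expands_leE:
  assumes "expands_le \<iota> d x \<epsilon> f B"
  obtains a where "expands_on \<iota> d x \<epsilon> a f"
    "\<And>\<alpha>. \<alpha> \<in> vecs d \<Longrightarrow> absv (a \<alpha>) * \<epsilon> ^ (\<Sum>i<d. \<alpha> i) \<le> B"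
  using assms unfolding expands_le_def by blast

lemma expands_le_cong:
  assumes "expands_le \<iota> d x \<epsilon> f B" "\<And>y. y \<in> polydisc d x \<epsilon> \<Longrightarrow> f y = g y"
  shows "expands_le \<iota> d x \<epsilon> g B"
  using assms(1) expands_on_cong[OF _ assms(2)] unfolding expands_le_def by fast

lemma expands_le_nonneg:
  fixes f :: "(nat \<Rightarrow> 'l::nonarch_field) \<Rightarrow> 'k::nonarch_field"
  assumes "expands_le \<iota> d x \<epsilon> f B" "0 \<le> \<epsilon>"
  shows "0 \<le> B"
proof -
  obtain a :: "(nat \<Rightarrow> nat) \<Rightarrow> 'k"
    where "\<And>\<alpha>. \<alpha> \<in> vecs d \<Longrightarrow> absv (a \<alpha>) * \<epsilon> ^ (\<Sum>i<d. \<alpha> i) \<le> B"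
    using expands_leE[OF assms(1)] by metis
  from this[OF zero_in_vecs] have "absv (a (\<lambda>_. 0::nat)) * \<epsilon> ^ (\<Sum>i<d. 0) \<le> B" .
  moreover have "0 \<le> absv (a (\<lambda>_. 0::nat)) * \<epsilon> ^ (\<Sum>i<d. 0)" using assms(2) by simp
  ultimately show ?thesis by linarith
qed

lemma expands_leI_le:
  assumes "expands_le \<iota> d x \<epsilon> f B" "B \<le> C"
  shows "expands_le \<iota> d x \<epsilon> f C"
  using assms unfolding expands_le_def by fastforce

text \<open>
  Coordinates lie in \<open>'l\<close> and values in \<open>'k\<close>; everything is computed in the complete field \<open>'k\<close>.
\<close>

locale isometric_embedding =
  fixes \<iota> :: "'l::nonarch_field \<Rightarrow> 'k::{nonarch_field, complete_space}"
  assumes \<iota>_1: "\<iota> 1 = 1" and \<iota>_add: "\<iota> (x + y) = \<iota> x + \<iota> y"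
    and \<iota>_mult: "\<iota> (x * y) = \<iota> x * \<iota> y" and absv_\<iota>: "absv (\<iota> x) = absv x"
begin

lemma \<iota>_0 [simp]: "\<iota> 0 = 0"
  using absv_\<iota>[of 0] by simp

lemma \<iota>_uminus: "\<iota> (- x) = - \<iota> x"
  using \<iota>_add[of x "- x"] by (simp add: eq_neg_iff_add_eq_0 add.commute)

lemma \<iota>_diff: "\<iota> (x - y) = \<iota> x - \<iota> y"
  using \<iota>_add[of x "- y"] by (simp add: \<iota>_uminus)

lemma \<iota>_power: "\<iota> (x ^ n) = \<iota> x ^ n"
  by (induction n) (simp_all add: \<iota>_1 \<iota>_mult)

lemma \<iota>_sum: "\<iota> (sum f A) = (\<Sum>i\<in>A. \<iota> (f i))"
  by (induction A rule: infinite_finite_induct) (simp_all add: \<iota>_add)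

lemma \<iota>_prod: "\<iota> (prod f A) = (\<Prod>i\<in>A. \<iota> (f i))"
  by (induction A rule: infinite_finite_induct) (simp_all add: \<iota>_mult \<iota>_1)

lemma has_sum_\<iota>: "(u has_sum s) A \<Longrightarrow> ((\<lambda>i. \<iota> (u i)) has_sum \<iota> s) A"
  unfolding has_sum_absv_iff by (simp add: \<iota>_sum[symmetric] \<iota>_diff[symmetric] absv_\<iota>)

lemma absv_monomial_le:
  assumes "y \<in> polydisc d x \<epsilon>" "0 \<le> \<epsilon>"
  shows "absv (\<Prod>i<d. \<iota> (y i - x i) ^ \<alpha> i) \<le> \<epsilon> ^ (\<Sum>i<d. \<alpha> i)"
proof -
  have "absv (\<Prod>i<d. \<iota> (y i - x i) ^ \<alpha> i) = (\<Prod>i<d. absv (y i - x i) ^ \<alpha> i)"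
    by (simp add: absv_prod absv_power absv_\<iota>)
  also have "\<dots> \<le> (\<Prod>i<d. \<epsilon> ^ \<alpha> i)"
    using assms by (intro prod_mono conjI power_mono zero_le_power) (auto simp: polydisc_def)
  also have "\<dots> = \<epsilon> ^ (\<Sum>i<d. \<alpha> i)" by (simp add: power_sum)
  finally show ?thesis .
qed

lemma absv_term_le:
  assumes "y \<in> polydisc d x \<epsilon>" "0 \<le> \<epsilon>"
  shows "absv (c * (\<Prod>i<d. \<iota> (y i - x i) ^ \<alpha> i)) \<le> absv c * \<epsilon> ^ (\<Sum>i<d. \<alpha> i)"
  unfolding absv_mult by (intro mult_left_mono absv_monomial_le assms absv_nonneg)

lemma expands_le_absv:
  assumes "expands_le \<iota> d x \<epsilon> f B" "0 \<le> \<epsilon>" "y \<in> polydisc d x \<epsilon>"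
  shows "absv (f y) \<le> B"
proof -
  obtain a where a: "expands_on \<iota> d x \<epsilon> a f"
    "\<And>\<alpha>. \<alpha> \<in> vecs d \<Longrightarrow> absv (a \<alpha>) * \<epsilon> ^ (\<Sum>i<d. \<alpha> i) \<le> B"
    using assms(1) by (rule expands_leE) blast
  show ?thesis
  proof (rule has_sum_absv_le)
    show "((\<lambda>\<alpha>. a \<alpha> * (\<Prod>i<d. \<iota> (y i - x i) ^ \<alpha> i)) has_sum f y) (vecs d)"
      using a(1) assms(3) by (simp add: expands_on_def)
    show "absv (a \<alpha> * (\<Prod>i<d. \<iota> (y i - x i) ^ \<alpha> i)) \<le> B" if "\<alpha> \<in> vecs d" for \<alpha>
      using absv_term_le[OF assms(3,2)] a(2)[OF that] by (rule order_trans)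
    show "0 \<le> B" using assms(1,2) by (rule expands_le_nonneg)
  qed
qed

lemma expands_le_const:
  assumes "0 \<le> \<epsilon>"
  shows "expands_le \<iota> d x \<epsilon> (\<lambda>_. c) (absv c)"
proof -
  let ?a = "\<lambda>\<alpha>::nat \<Rightarrow> nat. if \<alpha> = (\<lambda>_. 0) then c else 0"
  have "((\<lambda>\<alpha>. ?a \<alpha> * (\<Prod>i<d. \<iota> (y i - x i) ^ \<alpha> i)) has_sum c) (vecs d)" for y
  proof -
    have "((\<lambda>\<alpha>. ?a \<alpha> * (\<Prod>i<d. \<iota> (y i - x i) ^ \<alpha> i)) has_sum c) {\<lambda>_. 0}"
      using has_sum_finite[of "{\<lambda>_. 0}" "\<lambda>\<alpha>. ?a \<alpha> * (\<Prod>i<d. \<iota> (y i - x i) ^ \<alpha> i)"] by simp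
    then show ?thesis
      by (rule has_sum_cong_neutral[THEN iffD1, rotated -1]) auto
  qed
  moreover have "finite {\<alpha> \<in> vecs d. e \<le> absv (?a \<alpha>) * \<epsilon> ^ (\<Sum>i<d. \<alpha> i)}" if "e > 0" for e
    by (rule finite_subset[of _ "{\<lambda>_. 0}"]) (use that in \<open>auto split: if_splits\<close>)
  ultimately have "expands_on \<iota> d x \<epsilon> ?a (\<lambda>_. c)"
    unfolding expands_on_def by blast
  then show ?thesis unfolding expands_le_def by (intro exI[of _ ?a]) auto
qed

text \<open>
  The Banach space of power series is complete: a family of series whose norms tend to zero is summed
  coefficientwise. Products and compositions of power series reduce to this, since both are infinite
  sums of simpler series.
\<close>

lemma expands_le_sum:
  fixes g :: "'i \<Rightarrow> (nat \<Rightarrow> 'l) \<Rightarrow> 'k"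
  assumes \<epsilon>: "0 < \<epsilon>" and C: "0 \<le> C"
    and B0: "\<And>e. e > 0 \<Longrightarrow> finite {i \<in> I. e \<le> B i}"
    and g: "\<And>i. i \<in> I \<Longrightarrow> expands_le \<iota> d x \<epsilon> (g i) (B i)"
    and BC: "\<And>i. i \<in> I \<Longrightarrow> B i \<le> C"
    and G: "\<And>y. y \<in> polydisc d x \<epsilon> \<Longrightarrow> ((\<lambda>i. g i y) has_sum G y) I"
  shows "expands_le \<iota> d x \<epsilon> G C"
proof -
  let ?n = "\<lambda>\<alpha>. \<epsilon> ^ (\<Sum>i<d. \<alpha> i)"
  have n: "0 < ?n \<alpha>" for \<alpha> using \<epsilon> by simp
  have "\<forall>i. \<exists>a. i \<in> I \<longrightarrow> expands_on \<iota> d x \<epsilon> a (g i) \<and> (\<forall>\<alpha>\<in>vecs d. absv (a \<alpha>) * ?n \<alpha> \<le> B i)"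
    using g unfolding expands_le_def by blast
  then obtain a where a: "\<And>i. i \<in> I \<Longrightarrow> expands_on \<iota> d x \<epsilon> (a i) (g i)"
    and aB: "\<And>i \<alpha>. i \<in> I \<Longrightarrow> \<alpha> \<in> vecs d \<Longrightarrow> absv (a i \<alpha>) * ?n \<alpha> \<le> B i"
    by metis
  have joint: "finite {(i, \<alpha>). i \<in> I \<and> \<alpha> \<in> vecs d \<and> e \<le> absv (a i \<alpha>) * ?n \<alpha>}" if e: "e > 0" for e
  proof (rule finite_subset)
    show "{(i, \<alpha>). i \<in> I \<and> \<alpha> \<in> vecs d \<and> e \<le> absv (a i \<alpha>) * ?n \<alpha>}
      \<subseteq> (SIGMA i:{i \<in> I. e \<le> B i}. {\<alpha> \<in> vecs d. e \<le> absv (a i \<alpha>) * ?n \<alpha>})"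
      using aB by (auto intro: order_trans)
    show "finite (SIGMA i:{i \<in> I. e \<le> B i}. {\<alpha> \<in> vecs d. e \<le> absv (a i \<alpha>) * ?n \<alpha>})"
      using B0 a e unfolding expands_on_def by (intro finite_SigmaI) auto
  qed
  have "\<exists>c. ((\<lambda>i. a i \<alpha>) has_sum c) I" if \<alpha>: "\<alpha> \<in> vecs d" for \<alpha>
  proof -
    have "c0_on I (\<lambda>i. a i \<alpha>)"
    proof (rule c0_on_dominated[of _ "\<lambda>i. B i / ?n \<alpha>"])
      show "finite {i \<in> I. e \<le> B i / ?n \<alpha>}" if "e > 0" for e
        using B0[of "e * ?n \<alpha>"] that n[of \<alpha>] by (simp add: pos_le_divide_eq)
      show "absv (a i \<alpha>) \<le> B i / ?n \<alpha>" if "i \<in> I" for i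
        using aB[OF that \<alpha>] n[of \<alpha>] by (simp add: pos_le_divide_eq)
    qed
    then show ?thesis using c0_summable by blast
  qed
  then obtain c where c: "\<And>\<alpha>. \<alpha> \<in> vecs d \<Longrightarrow> ((\<lambda>i. a i \<alpha>) has_sum c \<alpha>) I" by metis
  have c_le: "absv (c \<alpha>) * ?n \<alpha> \<le> D"
    if \<alpha>: "\<alpha> \<in> vecs d" and D: "\<And>i. i \<in> I \<Longrightarrow> absv (a i \<alpha>) * ?n \<alpha> \<le> D" "0 \<le> D" for \<alpha> D
  proof -
    have "absv (c \<alpha>) \<le> D / ?n \<alpha>"
      by (rule has_sum_absv_le[OF c[OF \<alpha>]])
        (use D n[of \<alpha>] in \<open>simp_all add: pos_le_divide_eq\<close>)
    then show ?thesis using n[of \<alpha>] by (simp add: pos_le_divide_eq)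
  qed
  have "finite {\<alpha> \<in> vecs d. e \<le> absv (c \<alpha>) * ?n \<alpha>}" if e: "e > 0" for e
  proof (rule finite_subset)
    show "{\<alpha> \<in> vecs d. e \<le> absv (c \<alpha>) * ?n \<alpha>}
      \<subseteq> snd ` {(i, \<alpha>). i \<in> I \<and> \<alpha> \<in> vecs d \<and> e / 2 \<le> absv (a i \<alpha>) * ?n \<alpha>}" (is "_ \<subseteq> ?R")
    proof
      fix \<alpha> assume \<alpha>: "\<alpha> \<in> {\<alpha> \<in> vecs d. e \<le> absv (c \<alpha>) * ?n \<alpha>}"
      show "\<alpha> \<in> ?R"
      proof (rule ccontr)
        assume "\<alpha> \<notin> ?R"
        then have "absv (a i \<alpha>) * ?n \<alpha> \<le> e / 2" if "i \<in> I" for i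
          using that \<alpha> by force
        then have "absv (c \<alpha>) * ?n \<alpha> \<le> e / 2" using \<alpha> e by (intro c_le) auto
        then show False using \<alpha> e by simp
      qed
    qed
    show "finite ?R" using joint[of "e / 2"] e by simp
  qed
  moreover have "((\<lambda>\<alpha>. c \<alpha> * (\<Prod>i<d. \<iota> (y i - x i) ^ \<alpha> i)) has_sum G y) (vecs d)"
    if y: "y \<in> polydisc d x \<epsilon>" for y
  proof (rule has_sum_swap_nonarch[of I "vecs d" "\<lambda>i \<alpha>. a i \<alpha> * (\<Prod>i<d. \<iota> (y i - x i) ^ \<alpha> i)"
        "\<lambda>i. g i y"])
    show "c0_on (I \<times> vecs d) (\<lambda>(i, \<alpha>). a i \<alpha> * (\<Prod>i<d. \<iota> (y i - x i) ^ \<alpha> i))"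
    proof (rule c0_on_dominated[of _ "\<lambda>(i, \<alpha>). absv (a i \<alpha>) * ?n \<alpha>"])
      show "finite {p \<in> I \<times> vecs d. e \<le> (case p of (i, \<alpha>) \<Rightarrow> absv (a i \<alpha>) * ?n \<alpha>)}" if "e > 0" for e
        using joint[OF that] by (rule finite_subset[rotated]) auto
    qed (use absv_term_le[OF y] \<epsilon> in auto)
    show "((\<lambda>\<alpha>. a i \<alpha> * (\<Prod>i<d. \<iota> (y i - x i) ^ \<alpha> i)) has_sum g i y) (vecs d)" if "i \<in> I" for i
      using a[OF that] y by (simp add: expands_on_def)
    show "((\<lambda>i. a i \<alpha> * (\<Prod>i<d. \<iota> (y i - x i) ^ \<alpha> i)) has_sum
        c \<alpha> * (\<Prod>i<d. \<iota> (y i - x i) ^ \<alpha> i)) I" if "\<alpha> \<in> vecs d" for \<alpha>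
      using has_sum_cmult_nonarch[OF c[OF that], of "\<Prod>i<d. \<iota> (y i - x i) ^ \<alpha> i"]
      by (simp add: mult.commute)
    show "((\<lambda>i. g i y) has_sum G y) I" using G[OF y] .
  qed
  ultimately have "expands_on \<iota> d x \<epsilon> c G" unfolding expands_on_def by blast
  moreover have "absv (c \<alpha>) * ?n \<alpha> \<le> C" if "\<alpha> \<in> vecs d" for \<alpha>
    by (rule c_le[OF that _ C]) (use aB BC that in \<open>blast intro: order_trans\<close>)
  ultimately show ?thesis unfolding expands_le_def by blast
qed

lemma expands_le_cmult:
  assumes "expands_le \<iota> d x \<epsilon> g B" "0 \<le> \<epsilon>"
  shows "expands_le \<iota> d x \<epsilon> (\<lambda>y. c * g y) (absv c * B)"
proof (cases "c = 0")
  case True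
  then show ?thesis using expands_le_const[OF assms(2), of d x 0] by simp
next
  case False
  obtain a where a: "expands_on \<iota> d x \<epsilon> a g"
    and B: "\<And>\<alpha>. \<alpha> \<in> vecs d \<Longrightarrow> absv (a \<alpha>) * \<epsilon> ^ (\<Sum>i<d. \<alpha> i) \<le> B"
    using expands_leE[OF assms(1)] by metis
  have c: "absv c > 0" using False by (rule absv_pos)
  have "finite {\<alpha> \<in> vecs d. e \<le> absv (c * a \<alpha>) * \<epsilon> ^ (\<Sum>i<d. \<alpha> i)}" if "e > 0" for e
  proof -
    have "{\<alpha> \<in> vecs d. e \<le> absv (c * a \<alpha>) * \<epsilon> ^ (\<Sum>i<d. \<alpha> i)}
      = {\<alpha> \<in> vecs d. e / absv c \<le> absv (a \<alpha>) * \<epsilon> ^ (\<Sum>i<d. \<alpha> i)}"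
      using c by (auto simp: absv_mult pos_divide_le_eq mult_ac)
    then show ?thesis using a that c unfolding expands_on_def by simp
  qed
  moreover have "((\<lambda>\<alpha>. c * a \<alpha> * (\<Prod>i<d. \<iota> (y i - x i) ^ \<alpha> i)) has_sum c * g y) (vecs d)"
    if "y \<in> polydisc d x \<epsilon>" for y
    using a that has_sum_cmult_nonarch[of "\<lambda>\<alpha>. a \<alpha> * (\<Prod>i<d. \<iota> (y i - x i) ^ \<alpha> i)" "vecs d" "g y" c]
    unfolding expands_on_def by (simp add: mult.assoc)
  ultimately have "expands_on \<iota> d x \<epsilon> (\<lambda>\<alpha>. c * a \<alpha>) (\<lambda>y. c * g y)"
    unfolding expands_on_def by blast
  moreover have "absv (c * a \<alpha>) * \<epsilon> ^ (\<Sum>i<d. \<alpha> i) \<le> absv c * B" if "\<alpha> \<in> vecs d" for \<alpha>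
    using B[OF that] c by (simp add: absv_mult mult.assoc mult_left_mono)
  ultimately show ?thesis unfolding expands_le_def by (intro exI[of _ "\<lambda>\<alpha>. c * a \<alpha>"]) auto
qed

lemma expands_le_add:
  assumes \<epsilon>: "0 < \<epsilon>" and g: "expands_le \<iota> d x \<epsilon> g B" and h: "expands_le \<iota> d x \<epsilon> h B"
  shows "expands_le \<iota> d x \<epsilon> (\<lambda>y. g y + h y) B"
proof (rule expands_le_sum[OF \<epsilon>, of _ UNIV "\<lambda>_. B" d x "\<lambda>b. if b then g else h"])
  show "((\<lambda>b. (if b then g else h) y) has_sum g y + h y) UNIV" for y
    using has_sum_finite[of UNIV "\<lambda>b. (if b then g else h) y"] by (simp add: UNIV_bool add.commute)
qed (use g h expands_le_nonneg[OF g] \<epsilon> in auto)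

lemma expands_le_shift:
  assumes g: "expands_le \<iota> d x \<epsilon> g B" and k: "k < d" and \<epsilon>: "0 < \<epsilon>"
  shows "expands_le \<iota> d x \<epsilon> (\<lambda>y. \<iota> (y k - x k) * g y) (\<epsilon> * B)"
proof -
  obtain a where a: "expands_on \<iota> d x \<epsilon> a g"
    and B: "\<And>\<alpha>. \<alpha> \<in> vecs d \<Longrightarrow> absv (a \<alpha>) * \<epsilon> ^ (\<Sum>i<d. \<alpha> i) \<le> B"
    using expands_leE[OF g] by metis
  define up where "up \<alpha> = \<alpha>(k := Suc (\<alpha> k))" for \<alpha> :: "nat \<Rightarrow> nat"
  define a' where "a' \<alpha> = (if \<alpha> k = 0 then 0 else a (\<alpha>(k := \<alpha> k - 1)))" for \<alpha>
  have bij: "bij_betw up (vecs d) {\<alpha> \<in> vecs d. \<alpha> k \<noteq> 0}"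
    by (rule bij_betwI[of _ _ _ "\<lambda>\<alpha>. \<alpha>(k := \<alpha> k - 1)"]) (use k in \<open>auto simp: up_def vecs_def\<close>)
  have a'_up: "a' (up \<alpha>) = a \<alpha>" for \<alpha> by (simp add: a'_def up_def)
  have deg: "(\<Sum>i<d. up \<alpha> i) = Suc (\<Sum>i<d. \<alpha> i)" for \<alpha>
    using k by (simp add: up_def sum.remove[of "{..<d}" k])
  have mon: "(\<Prod>i<d. \<iota> (y i - x i) ^ up \<alpha> i) = \<iota> (y k - x k) * (\<Prod>i<d. \<iota> (y i - x i) ^ \<alpha> i)" for y \<alpha>
    using k by (simp add: up_def prod.remove[of "{..<d}" k])
  have range: "{\<alpha> \<in> vecs d. P \<alpha> \<and> \<alpha> k \<noteq> 0} = up ` {\<alpha> \<in> vecs d. P (up \<alpha>)}" for P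
  proof -
    have "up ` vecs d = {\<alpha> \<in> vecs d. \<alpha> k \<noteq> 0}" using bij by (simp add: bij_betw_def)
    then have "{\<alpha> \<in> vecs d. P \<alpha> \<and> \<alpha> k \<noteq> 0} = {\<alpha> \<in> up ` vecs d. P \<alpha>}" by auto
    then show ?thesis by auto
  qed
  have "finite {\<alpha> \<in> vecs d. e \<le> absv (a' \<alpha>) * \<epsilon> ^ (\<Sum>i<d. \<alpha> i)}" if e: "e > 0" for e
  proof -
    have "{\<alpha> \<in> vecs d. e \<le> absv (a' \<alpha>) * \<epsilon> ^ (\<Sum>i<d. \<alpha> i)}
      = {\<alpha> \<in> vecs d. e \<le> absv (a' \<alpha>) * \<epsilon> ^ (\<Sum>i<d. \<alpha> i) \<and> \<alpha> k \<noteq> 0}"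
      using e by (auto simp: a'_def)
    also have "\<dots> = up ` {\<alpha> \<in> vecs d. e / \<epsilon> \<le> absv (a \<alpha>) * \<epsilon> ^ (\<Sum>i<d. \<alpha> i)}"
      unfolding range a'_up deg using \<epsilon> by (simp add: pos_divide_le_eq mult_ac)
    also have "finite \<dots>" using a e \<epsilon> unfolding expands_on_def by simp
    finally show ?thesis .
  qed
  moreover have "((\<lambda>\<alpha>. a' \<alpha> * (\<Prod>i<d. \<iota> (y i - x i) ^ \<alpha> i)) has_sum \<iota> (y k - x k) * g y) (vecs d)"
    if y: "y \<in> polydisc d x \<epsilon>" for y
  proof -
    have "((\<lambda>\<alpha>. \<iota> (y k - x k) * (a \<alpha> * (\<Prod>i<d. \<iota> (y i - x i) ^ \<alpha> i))) has_sum \<iota> (y k - x k) * g y) (vecs d)"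
      using a y unfolding expands_on_def by (intro has_sum_cmult_nonarch) blast
    then have "((\<lambda>\<alpha>. a' (up \<alpha>) * (\<Prod>i<d. \<iota> (y i - x i) ^ up \<alpha> i)) has_sum \<iota> (y k - x k) * g y) (vecs d)"
      unfolding a'_up mon by (simp add: mult_ac)
    then have "((\<lambda>\<alpha>. a' \<alpha> * (\<Prod>i<d. \<iota> (y i - x i) ^ \<alpha> i)) has_sum \<iota> (y k - x k) * g y) {\<alpha> \<in> vecs d. \<alpha> k \<noteq> 0}"
      by (subst (asm) has_sum_reindex_bij_betw[OF bij])
    then show ?thesis
      by (rule has_sum_cong_neutral[THEN iffD1, rotated -1]) (auto simp: a'_def)
  qed
  ultimately have "expands_on \<iota> d x \<epsilon> a' (\<lambda>y. \<iota> (y k - x k) * g y)"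
    unfolding expands_on_def by blast
  moreover have "absv (a' \<alpha>) * \<epsilon> ^ (\<Sum>i<d. \<alpha> i) \<le> \<epsilon> * B" if "\<alpha> \<in> vecs d" for \<alpha>
  proof (cases "\<alpha> k = 0")
    case True
    then show ?thesis using expands_le_nonneg[OF g] \<epsilon> by (simp add: a'_def)
  next
    case False
    then have "\<alpha> \<in> up ` vecs d" using bij that by (simp add: bij_betw_def)
    then obtain \<beta> where \<beta>: "\<alpha> = up \<beta>" "\<beta> \<in> vecs d" by blast
    have "\<epsilon> * (absv (a \<beta>) * \<epsilon> ^ (\<Sum>i<d. \<beta> i)) \<le> \<epsilon> * B"
      using B[OF \<beta>(2)] \<epsilon> by (intro mult_left_mono) auto
    then show ?thesis unfolding \<beta>(1) a'_up deg by (simp add: mult_ac)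
  qed
  ultimately show ?thesis unfolding expands_le_def by blast
qed

lemma expands_le_shift_power:
  assumes "expands_le \<iota> d x \<epsilon> g B" "k < d" "0 < \<epsilon>"
  shows "expands_le \<iota> d x \<epsilon> (\<lambda>y. \<iota> (y k - x k) ^ n * g y) (\<epsilon> ^ n * B)"
proof (induction n)
  case 0
  then show ?case using assms by simp
next
  case (Suc n)
  from expands_le_shift[OF Suc assms(2,3)] show ?case by (simp add: mult.assoc)
qed

lemma expands_le_monomial:
  assumes g: "expands_le \<iota> d x \<epsilon> g B" and "S \<subseteq> {..<d}" and \<epsilon>: "0 < \<epsilon>"
  shows "expands_le \<iota> d x \<epsilon> (\<lambda>y. (\<Prod>i\<in>S. \<iota> (y i - x i) ^ \<alpha> i) * g y) (\<epsilon> ^ (\<Sum>i\<in>S. \<alpha> i) * B)"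
proof -
  have "finite S" using assms(2) finite_subset by blast
  then show ?thesis using assms(2)
  proof (induction S)
    case empty
    then show ?case using g by simp
  next
    case (insert k S)
    then have "expands_le \<iota> d x \<epsilon> (\<lambda>y. (\<Prod>i\<in>S. \<iota> (y i - x i) ^ \<alpha> i) * g y) (\<epsilon> ^ (\<Sum>i\<in>S. \<alpha> i) * B)"
      and "k < d" by auto
    from expands_le_shift_power[OF this \<epsilon>, of "\<alpha> k"] insert show ?case
      by (simp add: mult.assoc power_add)
  qed
qed

text \<open>
  Expanding only the first factor, the product is the sum of the series \<open>h\<close> multiplied by monomials,
  and multiplication by a coordinate merely shifts the multi-indices (\<open>expands_le_shift\<close>).
\<close>

lemma expands_le_mult:
  assumes g: "expands_le \<iota> d x \<epsilon> g B" and h: "expands_le \<iota> d x \<epsilon> h C" and \<epsilon>: "0 < \<epsilon>"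
  shows "expands_le \<iota> d x \<epsilon> (\<lambda>y. g y * h y) (B * C)"
proof -
  obtain a where a: "expands_on \<iota> d x \<epsilon> a g"
    and B: "\<And>\<alpha>. \<alpha> \<in> vecs d \<Longrightarrow> absv (a \<alpha>) * \<epsilon> ^ (\<Sum>i<d. \<alpha> i) \<le> B"
    using expands_leE[OF g] by metis
  have nonneg: "0 \<le> B" "0 \<le> C" using g h expands_le_nonneg \<epsilon> by (metis less_imp_le)+
  let ?b = "\<lambda>\<alpha>. absv (a \<alpha>) * (\<epsilon> ^ (\<Sum>i<d. \<alpha> i) * C)"
  show ?thesis
  proof (rule expands_le_sum[OF \<epsilon>, of _ "vecs d" ?b])
    show "finite {\<alpha> \<in> vecs d. e \<le> ?b \<alpha>}" if e: "e > 0" for e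
    proof (cases "C = 0")
      case False
      then have "C > 0" using nonneg by simp
      then have "{\<alpha> \<in> vecs d. e \<le> ?b \<alpha>} = {\<alpha> \<in> vecs d. e / C \<le> absv (a \<alpha>) * \<epsilon> ^ (\<Sum>i<d. \<alpha> i)}"
        by (simp add: pos_divide_le_eq mult.assoc)
      then show ?thesis using a e \<open>C > 0\<close> unfolding expands_on_def by simp
    qed (use e in auto)
    show "expands_le \<iota> d x \<epsilon> (\<lambda>y. a \<alpha> * ((\<Prod>i<d. \<iota> (y i - x i) ^ \<alpha> i) * h y)) (?b \<alpha>)" for \<alpha>
      using \<epsilon> h by (intro expands_le_cmult expands_le_monomial) auto
    show "?b \<alpha> \<le> B * C" if "\<alpha> \<in> vecs d" for \<alpha>
      using B[OF that] nonneg by (simp add: mult.assoc[symmetric] mult_right_mono)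
    show "((\<lambda>\<alpha>. a \<alpha> * ((\<Prod>i<d. \<iota> (y i - x i) ^ \<alpha> i) * h y)) has_sum g y * h y) (vecs d)"
      if "y \<in> polydisc d x \<epsilon>" for y
      using a that has_sum_cmult_nonarch[of "\<lambda>\<alpha>. a \<alpha> * (\<Prod>i<d. \<iota> (y i - x i) ^ \<alpha> i)" "vecs d" "g y" "h y"]
      unfolding expands_on_def by (simp add: mult_ac)
  qed (use nonneg in auto)
qed

lemma expands_le_power:
  assumes "expands_le \<iota> d x \<epsilon> g B" "0 < \<epsilon>"
  shows "expands_le \<iota> d x \<epsilon> (\<lambda>y. g y ^ n) (B ^ n)"
proof (induction n)
  case 0
  show ?case using expands_le_const[of \<epsilon> d x 1] assms(2) by simp
next
  case (Suc n)
  from expands_le_mult[OF assms(1) Suc assms(2)] show ?case by simp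
qed

lemma expands_le_prod:
  assumes "finite S" "\<And>j. j \<in> S \<Longrightarrow> expands_le \<iota> d x \<epsilon> (g j) (B j)" "0 < \<epsilon>"
  shows "expands_le \<iota> d x \<epsilon> (\<lambda>y. \<Prod>j\<in>S. g j y) (\<Prod>j\<in>S. B j)"
  using assms(1,2)
proof (induction S)
  case empty
  show ?case using expands_le_const[of \<epsilon> d x 1] assms(3) by simp
next
  case (insert j S)
  then have "expands_le \<iota> d x \<epsilon> (\<lambda>y. g j y * (\<Prod>j\<in>S. g j y)) (B j * (\<Prod>j\<in>S. B j))"
    by (intro expands_le_mult assms(3)) auto
  with insert show ?case by simp
qed

text \<open>
  The composite is the infinite sum of the powers of \<open>F\<close> prescribed by the series of \<open>f\<close>. The norm of
  the \<open>\<gamma>\<close>-th power is at most \<open>\<rho>\<^bsup>\<bar>\<gamma>\<bar>\<^esup>\<close>, so the terms tend to zero because those of \<open>f\<close> do.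
\<close>

lemma expands_on_compose:
  assumes f: "expands_on \<iota> e z \<rho> a f" and \<rho>: "0 < \<rho>" and \<epsilon>: "0 < \<epsilon>"
    and F: "\<And>j. j < e \<Longrightarrow> expands_le \<iota> d x \<epsilon> (\<lambda>y. \<iota> (F y j - z j)) \<rho>"
    and vecs: "\<And>y. y \<in> polydisc d x \<epsilon> \<Longrightarrow> F y \<in> vecs e"
  shows "\<exists>c. expands_on \<iota> d x \<epsilon> c (\<lambda>y. f (F y))"
proof -
  have FP: "F y \<in> polydisc e z \<rho>" if "y \<in> polydisc d x \<epsilon>" for y
    using expands_le_absv[OF F _ that] \<epsilon> vecs[OF that] by (auto simp: polydisc_def absv_\<iota>)
  obtain C where C: "0 \<le> C" "\<And>\<gamma>. \<gamma> \<in> vecs e \<Longrightarrow> absv (a \<gamma>) * \<rho> ^ (\<Sum>j<e. \<gamma> j) \<le> C"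
    using expands_on_bounded[OF f] by blast
  have "expands_le \<iota> d x \<epsilon> (\<lambda>y. f (F y)) C"
  proof (rule expands_le_sum[OF \<epsilon> C(1), of "vecs e" "\<lambda>\<gamma>. absv (a \<gamma>) * \<rho> ^ (\<Sum>j<e. \<gamma> j)"])
    show "finite {\<gamma> \<in> vecs e. r \<le> absv (a \<gamma>) * \<rho> ^ (\<Sum>j<e. \<gamma> j)}" if "r > 0" for r
      using f that unfolding expands_on_def by blast
    show "expands_le \<iota> d x \<epsilon> (\<lambda>y. a \<gamma> * (\<Prod>j<e. \<iota> (F y j - z j) ^ \<gamma> j)) (absv (a \<gamma>) * \<rho> ^ (\<Sum>j<e. \<gamma> j))" for \<gamma>
      unfolding power_sum using \<epsilon> F by (intro expands_le_cmult expands_le_prod expands_le_power) auto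
    show "((\<lambda>\<gamma>. a \<gamma> * (\<Prod>j<e. \<iota> (F y j - z j) ^ \<gamma> j)) has_sum f (F y)) (vecs e)"
      if "y \<in> polydisc d x \<epsilon>" for y
      using f FP[OF that] unfolding expands_on_def by blast
  qed (use C in auto)
  then show ?thesis unfolding expands_le_def by blast
qed

lemma expands_on_center:
  assumes "expands_on \<iota> d x \<epsilon> a f" "x \<in> vecs d" "0 \<le> \<epsilon>"
  shows "f x = a (\<lambda>_. 0)"
proof -
  have s: "((\<lambda>\<alpha>. a \<alpha> * (\<Prod>i<d. \<iota> (x i - x i) ^ \<alpha> i)) has_sum f x) (vecs d)"
    using assms polydisc_center unfolding expands_on_def by blast
  have zero: "(\<Prod>i<d. (0::'k) ^ \<alpha> i) = 0" if \<alpha>: "\<alpha> \<in> vecs d" "\<alpha> \<noteq> (\<lambda>_. 0)" for \<alpha>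
  proof -
    obtain i where "\<alpha> i \<noteq> 0" using \<alpha>(2) by (auto simp: fun_eq_iff)
    then have "i < d" using \<alpha>(1) by (auto simp: vecs_def intro: leI)
    then show ?thesis using \<open>\<alpha> i \<noteq> 0\<close> by (auto intro!: prod_zero)
  qed
  have "((\<lambda>\<alpha>. a \<alpha> * (\<Prod>i<d. \<iota> (x i - x i) ^ \<alpha> i)) has_sum f x) {\<lambda>_. 0}"
    using s by (rule has_sum_cong_neutral[THEN iffD1, rotated -1]) (auto simp: zero)
  moreover have "((\<lambda>\<alpha>. a \<alpha> * (\<Prod>i<d. \<iota> (x i - x i) ^ \<alpha> i)) has_sum a (\<lambda>_. 0)) {\<lambda>_. 0}"
    using has_sum_finite[of "{\<lambda>_. 0}" "\<lambda>\<alpha>. a \<alpha> * (\<Prod>i<d. \<iota> (x i - x i) ^ \<alpha> i)"] by simp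
  ultimately show ?thesis by (rule has_sum_unique_nonarch)
qed

lemma expands_on_\<iota>:
  assumes "expands_on (\<lambda>z. z) d x \<epsilon> b g"
  shows "expands_on \<iota> d x \<epsilon> (\<lambda>\<alpha>. \<iota> (b \<alpha>)) (\<lambda>y. \<iota> (g y))"
  unfolding expands_on_def
proof (intro conjI ballI)
  show "\<forall>e>0. finite {\<alpha> \<in> vecs d. e \<le> absv (\<iota> (b \<alpha>)) * \<epsilon> ^ (\<Sum>i<d. \<alpha> i)}"
    using assms by (simp add: expands_on_def absv_\<iota>)
  fix y assume "y \<in> polydisc d x \<epsilon>"
  then have "((\<lambda>\<alpha>. b \<alpha> * (\<Prod>i<d. (y i - x i) ^ \<alpha> i)) has_sum g y) (vecs d)"
    using assms by (simp add: expands_on_def)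
  from has_sum_\<iota>[OF this] show "((\<lambda>\<alpha>. \<iota> (b \<alpha>) * (\<Prod>i<d. \<iota> (y i - x i) ^ \<alpha> i)) has_sum \<iota> (g y)) (vecs d)"
    by (simp add: \<iota>_mult \<iota>_prod \<iota>_power)
qed

text \<open>
  Passing to a radius \<open>\<epsilon> t\<close> with \<open>t \<le> 1\<close> multiplies every term except the constant one by at most \<open>t\<close>.
\<close>

lemma expands_le_shrink:
  assumes f: "expands_on \<iota> d x \<epsilon> a f" and \<epsilon>: "0 < \<epsilon>" and x: "x \<in> vecs d"
    and \<rho>: "0 < \<rho>" "absv (f x) \<le> \<rho>"
  obtains \<epsilon>1 where "0 < \<epsilon>1" "\<And>\<epsilon>'. 0 < \<epsilon>' \<Longrightarrow> \<epsilon>' \<le> \<epsilon>1 \<Longrightarrow> expands_le \<iota> d x \<epsilon>' f \<rho>"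
proof -
  obtain B where B: "0 \<le> B" "\<And>\<alpha>. \<alpha> \<in> vecs d \<Longrightarrow> absv (a \<alpha>) * \<epsilon> ^ (\<Sum>i<d. \<alpha> i) \<le> B"
    using expands_on_bounded[OF f] by blast
  (* Adding 1 keeps the quotient meaningful if B = 0. *)
  define t where "t = min 1 (\<rho> / (B + 1))"
  have t: "0 < t" "t \<le> 1" using B(1) \<rho>(1) by (auto simp: t_def)
  have tB: "t * B \<le> \<rho>"
  proof -
    have "t * B \<le> \<rho> / (B + 1) * (B + 1)"
      using B(1) \<rho>(1) by (intro mult_mono) (auto simp: t_def)
    then show ?thesis using B(1) by simp
  qed
  have a0: "f x = a (\<lambda>_. 0)" using expands_on_center[OF f x] \<epsilon> by simp
  show thesis
  proof (rule that[of "\<epsilon> * t"])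
    show "0 < \<epsilon> * t" using \<epsilon> t by simp
    fix \<epsilon>' assume \<epsilon>': "0 < \<epsilon>'" "\<epsilon>' \<le> \<epsilon> * t"
    have "\<epsilon> * t \<le> \<epsilon>" using \<epsilon> t by simp
    then have "expands_on \<iota> d x \<epsilon>' a f" using \<epsilon>' by (intro expands_on_mono[OF f]) auto
    moreover have "absv (a \<alpha>) * \<epsilon>' ^ (\<Sum>i<d. \<alpha> i) \<le> \<rho>" if \<alpha>: "\<alpha> \<in> vecs d" for \<alpha>
    proof (cases "(\<Sum>i<d. \<alpha> i) = 0")
      case True
      have "\<alpha> i = 0" for i
        using True \<alpha> by (cases "i < d") (auto simp: vecs_def)
      then have "\<alpha> = (\<lambda>_. 0)" by (rule ext)
      then show ?thesis using a0 \<rho>(2) by simp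
    next
      case False
      then have deg: "1 \<le> (\<Sum>i<d. \<alpha> i)" by linarith
      have "absv (a \<alpha>) * \<epsilon>' ^ (\<Sum>i<d. \<alpha> i) \<le> absv (a \<alpha>) * (\<epsilon> * t) ^ (\<Sum>i<d. \<alpha> i)"
        using \<epsilon>' by (intro mult_left_mono power_mono) auto
      also have "\<dots> = t ^ (\<Sum>i<d. \<alpha> i) * (absv (a \<alpha>) * \<epsilon> ^ (\<Sum>i<d. \<alpha> i))"
        by (simp add: power_mult_distrib mult_ac)
      also have "\<dots> \<le> t ^ 1 * B"
        using t B(1) B(2)[OF \<alpha>] \<epsilon> by (intro mult_mono power_decreasing deg) auto
      finally show ?thesis using tB by simp
    qed
    ultimately show "expands_le \<iota> d x \<epsilon>' f \<rho>" unfolding expands_le_def by blast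
  qed
qed

text \<open>
  The inner map need not send the centre \<open>x\<close> to the centre \<open>z\<close>. With \<open>F\<close> the identity this recentres a
  power series, with \<open>F\<close> a transition map it changes charts, and with \<open>F\<close> the multiplication of the group
  it gives the joint expansion of \<open>f (x y)\<close>.
\<close>

lemma expands_on_compose_map:
  assumes f: "expands_on \<iota> e z \<rho> a f" and \<rho>: "0 < \<rho>" and \<epsilon>: "0 < \<epsilon>"
    and x: "x \<in> vecs d" and Fx: "F x \<in> polydisc e z \<rho>"
    and F: "\<And>j. j < e \<Longrightarrow> \<exists>b \<epsilon>. 0 < \<epsilon> \<and> expands_on (\<lambda>z. z) d x \<epsilon> b (\<lambda>y. F y j)"
    and vecs: "\<And>y. y \<in> polydisc d x \<epsilon> \<Longrightarrow> F y \<in> vecs e"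
  obtains \<epsilon>' where "0 < \<epsilon>'" "\<epsilon>' \<le> \<epsilon>"
    "\<And>\<epsilon>''. 0 < \<epsilon>'' \<Longrightarrow> \<epsilon>'' \<le> \<epsilon>' \<Longrightarrow> \<exists>c. expands_on \<iota> d x \<epsilon>'' c (\<lambda>y. f (F y))"
proof -
  have "\<exists>\<epsilon>1>0. \<forall>\<epsilon>'. 0 < \<epsilon>' \<longrightarrow> \<epsilon>' \<le> \<epsilon>1 \<longrightarrow> expands_le \<iota> d x \<epsilon>' (\<lambda>y. \<iota> (F y j - z j)) \<rho>"
    if j: "j < e" for j
  proof -
    obtain b \<epsilon>0 where \<epsilon>0: "0 < \<epsilon>0" and b: "expands_on (\<lambda>z. z) d x \<epsilon>0 b (\<lambda>y. F y j)"
      using F[OF j] by blast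
    from expands_on_\<iota>[OF b] obtain B where B: "expands_le \<iota> d x \<epsilon>0 (\<lambda>y. \<iota> (F y j)) B"
      using expands_on_bounded unfolding expands_le_def by metis
    have "expands_le \<iota> d x \<epsilon>0 (\<lambda>y. \<iota> (F y j) + - \<iota> (z j)) (max B (absv (- \<iota> (z j))))"
      by (intro expands_le_add \<epsilon>0; rule expands_leI_le[OF B] expands_leI_le[OF expands_le_const])
        (use \<epsilon>0 in auto)
    then obtain c where c: "expands_on \<iota> d x \<epsilon>0 c (\<lambda>y. \<iota> (F y j - z j))"
      unfolding expands_le_def by (auto simp: \<iota>_diff)
    have "absv (\<iota> (F x j - z j)) \<le> \<rho>"
      using Fx j by (simp add: polydisc_def absv_\<iota>)
    from expands_le_shrink[OF c \<epsilon>0 x \<rho>(1) this]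
    obtain \<epsilon>1 where "0 < \<epsilon>1"
      "\<And>\<epsilon>'. 0 < \<epsilon>' \<Longrightarrow> \<epsilon>' \<le> \<epsilon>1 \<Longrightarrow> expands_le \<iota> d x \<epsilon>' (\<lambda>y. \<iota> (F y j - z j)) \<rho>" by blast
    then show ?thesis by blast
  qed
  then obtain r where r: "\<And>j. j < e \<Longrightarrow> 0 < r j"
    "\<And>j \<epsilon>'. j < e \<Longrightarrow> 0 < \<epsilon>' \<Longrightarrow> \<epsilon>' \<le> r j \<Longrightarrow> expands_le \<iota> d x \<epsilon>' (\<lambda>y. \<iota> (F y j - z j)) \<rho>"
    by metis
  define \<epsilon>' where "\<epsilon>' = Min (insert \<epsilon> (r ` {..<e}))"
  have \<epsilon>': "0 < \<epsilon>'" "\<epsilon>' \<le> \<epsilon>" "\<And>j. j < e \<Longrightarrow> \<epsilon>' \<le> r j"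
    unfolding \<epsilon>'_def using r(1) \<epsilon> by (auto intro: Min_le)
  show thesis
  proof (rule that[OF \<epsilon>'(1,2)])
    fix \<epsilon>'' assume \<epsilon>'': "0 < \<epsilon>''" "\<epsilon>'' \<le> \<epsilon>'"
    show "\<exists>c. expands_on \<iota> d x \<epsilon>'' c (\<lambda>y. f (F y))"
    proof (rule expands_on_compose[OF f \<rho> \<epsilon>''(1)])
      show "expands_le \<iota> d x \<epsilon>'' (\<lambda>y. \<iota> (F y j - z j)) \<rho>" if "j < e" for j
        using r(2)[OF that \<epsilon>''(1)] \<epsilon>'(3)[OF that] \<epsilon>''(2) by simp
      show "F y \<in> vecs e" if "y \<in> polydisc d x \<epsilon>''" for y
        using vecs polydisc_mono[of \<epsilon>'' \<epsilon> d x] \<epsilon>'' \<epsilon>' that by fastforce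
    qed
  qed
qed

end


section \<open>Polydiscs and the topology of coordinate space\<close>

lemma open_closed_ball_nonarch:
  assumes "0 < \<epsilon>"
  shows "open {z::'l::nonarch_field. absv (z - a) \<le> \<epsilon>}"
  unfolding open_dist
proof (intro ballI exI[of _ \<epsilon>] conjI allI impI assms)
  fix z y assume "z \<in> {z. absv (z - a) \<le> \<epsilon>}" "dist y z < \<epsilon>"
  then have "absv ((y - z) + (z - a)) \<le> \<epsilon>"
    by (intro absv_add_le) (auto simp: dist_absv)
  then show "y \<in> {z. absv (z - a) \<le> \<epsilon>}" by simp
qed

lemma openin_polydisc:
  fixes x :: "nat \<Rightarrow> 'l::nonarch_field"
  assumes "0 < \<epsilon>"
  shows "openin (top_of_set (vecs d)) (polydisc d x \<epsilon>)"
proof -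
  have "open ((\<lambda>y :: nat \<Rightarrow> 'l. y i) -` {z. absv (z - x i) \<le> \<epsilon>})" for i
    by (intro open_vimage open_closed_ball_nonarch assms continuous_on_product_coordinates)
  then have "open (\<Inter>i\<in>{..<d}. (\<lambda>y :: nat \<Rightarrow> 'l. y i) -` {z. absv (z - x i) \<le> \<epsilon>})"
    by (intro open_INT) auto
  moreover have "polydisc d x \<epsilon> = vecs d \<inter> (\<Inter>i\<in>{..<d}. (\<lambda>y :: nat \<Rightarrow> 'l. y i) -` {z. absv (z - x i) \<le> \<epsilon>})"
    by (auto simp: polydisc_def)
  ultimately show ?thesis by (simp add: openin_open_Int)
qed

text \<open>
  A basic open set of the product topology restricts finitely many coordinates. Those from \<open>d\<close> on are
  zero anyway.
\<close>

lemma polydisc_nbhd: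
  fixes x :: "nat \<Rightarrow> 'l::nonarch_field"
  assumes "openin (top_of_set (vecs d)) T" "x \<in> T"
  obtains \<epsilon> where "0 < \<epsilon>" "polydisc d x \<epsilon> \<subseteq> T"
proof -
  obtain S where S: "open S" "T = vecs d \<inter> S" using assms(1) by (auto simp: openin_open)
  then have "openin (product_topology (\<lambda>i. euclidean) UNIV) S" by (simp add: open_fun_def)
  then obtain X where X: "x \<in> (\<Pi>\<^sub>E i\<in>UNIV. X i)" "\<And>i. open (X i)" "(\<Pi>\<^sub>E i\<in>UNIV. X i) \<subseteq> S"
    using product_topology_open_contains_basis[of "\<lambda>i. euclidean" UNIV S x] assms(2) S(2) by auto
  have "\<exists>r>0. \<forall>z. absv (z - x i) < r \<longrightarrow> z \<in> X i" for i
    using X(1,2) unfolding open_dist dist_absv by (auto simp: PiE_iff)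
  then obtain r where r: "\<And>i. 0 < r i" "\<And>i z. absv (z - x i) < r i \<Longrightarrow> z \<in> X i" by metis
  (* The 1 covers d = 0; halving passes from open balls to the closed conditions of a polydisc. *)
  define \<epsilon> where "\<epsilon> = Min (insert 1 (r ` {..<d})) / 2"
  have "0 < Min (insert 1 (r ` {..<d}))" using r(1) by auto
  then have \<epsilon>0: "0 < \<epsilon>" by (simp add: \<epsilon>_def)
  have \<epsilon>r: "\<epsilon> < r i" if "i < d" for i
  proof -
    have "Min (insert 1 (r ` {..<d})) \<le> r i" using that by (intro Min_le) auto
    then show ?thesis using r(1)[of i] by (simp add: \<epsilon>_def)
  qed
  have "polydisc d x \<epsilon> \<subseteq> T"
  proof
    fix y assume y: "y \<in> polydisc d x \<epsilon>"
    have "y i \<in> X i" for i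
    proof (cases "i < d")
      case True
      then show ?thesis using y \<epsilon>r[OF True] by (intro r(2)) (force simp: polydisc_def)
    next
      case False
      then have "y i = x i" using y assms(2) S(2) by (simp add: polydisc_def vecs_def)
      then show ?thesis using X(1) by (auto simp: PiE_iff)
    qed
    then show "y \<in> T" using X(3) y S(2) by (auto simp: polydisc_def PiE_iff)
  qed
  with \<epsilon>0 show thesis by (rule that)
qed

lemma polydisc_recenter:
  assumes "y \<in> polydisc d x \<epsilon>"
  shows "polydisc d y \<epsilon> = polydisc d x \<epsilon>"
proof -
  have sub: "polydisc d y \<epsilon> \<subseteq> polydisc d x \<epsilon>" if "\<And>i. i < d \<Longrightarrow> absv (y i - x i) \<le> \<epsilon>" for x y
  proof
    fix z assume z: "z \<in> polydisc d y \<epsilon>"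
    have "absv ((z i - y i) + (y i - x i)) \<le> \<epsilon>" if "i < d" for i
      using z that \<open>\<And>i. i < d \<Longrightarrow> absv (y i - x i) \<le> \<epsilon>\<close> by (intro absv_add_le) (auto simp: polydisc_def)
    then show "z \<in> polydisc d x \<epsilon>" using z by (auto simp: polydisc_def)
  qed
  show ?thesis
    using sub[of y x] sub[of x y] assms by (auto simp: polydisc_def absv_diff_commute)
qed


section \<open>Open normal subgroups of a profinite group\<close>

text \<open>
  The assumption \<open>clopen_basis\<close> says that the topology is totally disconnected at the identity.
\<close>

locale profinite_group = group G for G :: "('h, 'b) monoid_scheme" (structure) +
  fixes X :: "'h topology"
  assumes topspace_X: "topspace X = carrier G"
    and cont_mult: "continuous_map (prod_topology X X) X (\<lambda>(x, y). x \<otimes> y)"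
    and cont_inv: "continuous_map X X (\<lambda>x. inv x)"
    and compact_X: "compact_space X"
    and clopen_basis: "openin X U \<Longrightarrow> \<one> \<in> U \<Longrightarrow> \<exists>W. openin X W \<and> closedin X W \<and> \<one> \<in> W \<and> W \<subseteq> U"
begin

abbreviation ONS :: "'h set set" where "ONS \<equiv> open_normal_subgroups G X"

lemma mult_inv_cancel: "g \<in> carrier G \<Longrightarrow> x \<in> carrier G \<Longrightarrow> g \<otimes> (inv g \<otimes> x) = x"
  by (simp add: m_assoc[symmetric])

lemma openin_subset_carrier: "openin X U \<Longrightarrow> U \<subseteq> carrier G"
  using openin_subset topspace_X by blast

lemma continuous_right_mult:
  assumes "g \<in> carrier G" shows "continuous_map X X (\<lambda>x. x \<otimes> g)"
proof -
  have "continuous_map X (prod_topology X X) (\<lambda>x. (x, g))"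
    using assms by (intro continuous_map_pairedI) (auto simp: topspace_X)
  from continuous_map_compose[OF this cont_mult] show ?thesis by (simp add: o_def)
qed

lemma openin_r_coset:
  assumes U: "openin X U" and g: "g \<in> carrier G"
  shows "openin X (U #> g)"
proof -
  have "U #> g = {x \<in> topspace X. x \<otimes> inv g \<in> U}"
  proof (intro equalityI subsetI)
    fix x assume "x \<in> U #> g"
    then obtain u where "u \<in> U" "x = u \<otimes> g" by (auto simp: r_coset_def)
    then show "x \<in> {x \<in> topspace X. x \<otimes> inv g \<in> U}"
      using g openin_subset_carrier[OF U] by (auto simp: topspace_X m_assoc subset_iff)
  next
    fix x assume "x \<in> {x \<in> topspace X. x \<otimes> inv g \<in> U}"
    then have "x \<in> carrier G" "x \<otimes> inv g \<in> U" by (auto simp: topspace_X)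
    then show "x \<in> U #> g" using g
      by (auto simp: r_coset_def m_assoc intro!: bexI[of _ "x \<otimes> inv g"])
  qed
  then show ?thesis
    using openin_continuous_map_preimage[OF continuous_right_mult[OF inv_closed[OF g]] U] by simp
qed

lemma openin_subgroupI:
  assumes H: "subgroup H G" and V: "openin X V" "\<one> \<in> V" "V \<subseteq> H"
  shows "openin X H"
proof (subst openin_subopen, intro ballI)
  fix h assume h: "h \<in> H"
  then have hc: "h \<in> carrier G" using H subgroup.mem_carrier by metis
  show "\<exists>T. openin X T \<and> h \<in> T \<and> T \<subseteq> H"
  proof (intro exI[of _ "V #> h"] conjI)
    show "openin X (V #> h)" using V(1) hc by (rule openin_r_coset)
    show "h \<in> V #> h" using V(2) hc by (auto simp: r_coset_def intro!: bexI[of _ \<one>])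
    show "V #> h \<subseteq> H" using V(3) h subgroup.m_closed[OF H] by (auto simp: r_coset_def)
  qed
qed

text \<open>
  The tube lemma around \<open>{\<one>} \<times> K\<close>. It turns conditions imposed for all points of a compact set into
  conditions on a neighbourhood of the identity.
\<close>

lemma tube:
  assumes K: "compactin X K" and S: "openin (prod_topology X X) S" and sub: "{\<one>} \<times> K \<subseteq> S"
  obtains V where "openin X V" "\<one> \<in> V" "V \<times> K \<subseteq> S"
proof -
  have "compactin X {\<one>}" by (simp add: topspace_X)
  from Wallace_theorem_prod_topology[OF this K S sub] obtain U V
    where "openin X U" "openin X V" "{\<one>} \<subseteq> U" "K \<subseteq> V" "U \<times> V \<subseteq> S" by blast
  then show thesis by (intro that[of U]) auto
qed

text \<open>
  For a clopen neighbourhood \<open>W\<close> of the identity, the elements that map \<open>W\<close> into itself and whose inverses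
  also do so form a subgroup. It lies in \<open>W\<close> because \<open>\<one> \<in> W\<close>, and is open because \<open>W\<close> is compact.
\<close>

lemma open_subgroup_basis:
  assumes U: "openin X U" "\<one> \<in> U"
  obtains H where "subgroup H G" "openin X H" "H \<subseteq> U"
proof -
  obtain W where W: "openin X W" "closedin X W" "\<one> \<in> W" "W \<subseteq> U" using clopen_basis[OF U] by blast
  have Wc: "W \<subseteq> carrier G" using W(1) by (rule openin_subset_carrier)
  have K: "compactin X W" using W(2) compact_X closedin_compact_space by blast
  let ?S = "{p \<in> topspace (prod_topology X X). (\<lambda>(x, y). x \<otimes> y) p \<in> W}"
  have S: "openin (prod_topology X X) ?S"
    using openin_continuous_map_preimage[OF cont_mult W(1)] .
  have sub: "{\<one>} \<times> W \<subseteq> ?S" using Wc by (auto simp: topspace_X)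
  obtain V where V: "openin X V" "\<one> \<in> V" "V \<times> W \<subseteq> ?S" by (rule tube[OF K S sub])
  (* Membership in the subgroup is a condition on both g and its inverse. *)
  define V' where "V' = V \<inter> {x \<in> topspace X. inv x \<in> V}"
  have V': "openin X V'" "\<one> \<in> V'"
    unfolding V'_def using V(1,2) openin_continuous_map_preimage[OF cont_inv V(1)]
    by (simp_all add: topspace_X openin_Int)
  define H where "H = {g \<in> carrier G. \<forall>w\<in>W. g \<otimes> w \<in> W \<and> inv g \<otimes> w \<in> W}"
  have H: "subgroup H G"
  proof (rule subgroupI)
    show "H \<subseteq> carrier G" by (auto simp: H_def)
    show "H \<noteq> {}" using Wc by (auto simp: H_def intro!: exI[of _ \<one>])
    show "inv a \<in> H" if "a \<in> H" for a using that by (simp add: H_def)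
    show "a \<otimes> b \<in> H" if "a \<in> H" "b \<in> H" for a b
      using that Wc by (auto simp: H_def inv_mult_group m_assoc subset_iff)
  qed
  have "V' \<subseteq> H"
    using V(3) openin_subset_carrier[OF V(1)] by (auto simp: V'_def H_def)
  from openin_subgroupI[OF H V' this] have "openin X H" .
  moreover have "H \<subseteq> W" using W(3) by (force simp: H_def)
  ultimately show thesis using H W(4) by (intro that[of H]) auto
qed

lemma ONS_iff: "N \<in> ONS \<longleftrightarrow> N \<lhd> G \<and> openin X N"
  by (simp add: open_normal_subgroups_def)

lemma ONS_subgroup: "N \<in> ONS \<Longrightarrow> subgroup N G"
  by (simp add: ONS_iff normal_imp_subgroup)

lemma ONS_one: "N \<in> ONS \<Longrightarrow> \<one> \<in> N"
  using ONS_subgroup subgroup.one_closed by blast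

text \<open>
  The normal core of an open subgroup \<open>H\<close> is open: the tube lemma, applied to conjugation and the compact
  group, gives a neighbourhood of the identity all of whose conjugates lie in \<open>H\<close>.
\<close>

lemma ONS_basis:
  assumes U: "openin X U" "\<one> \<in> U"
  obtains N where "N \<in> ONS" "N \<subseteq> U"
proof -
  obtain H where H: "subgroup H G" "openin X H" "H \<subseteq> U" using open_subgroup_basis[OF U] .
  interpret H: subgroup H G by (rule H(1))
  let ?c = "\<lambda>(n, g). inv g \<otimes> n \<otimes> g"
  have "continuous_map (prod_topology X X) X (\<lambda>p. (\<lambda>(x, y). x \<otimes> y) ((\<lambda>(x, y). x \<otimes> y) (inv (snd p), fst p), snd p))"
    by (intro continuous_map_compose[OF _ cont_mult, unfolded o_def] continuous_map_pairedI
        continuous_map_compose[OF _ cont_inv, unfolded o_def] continuous_map_fst continuous_map_snd)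
  then have c: "continuous_map (prod_topology X X) X ?c" by (simp add: case_prod_unfold)
  let ?S = "{p \<in> topspace (prod_topology X X). ?c p \<in> H}"
  have S: "openin (prod_topology X X) ?S"
    using openin_continuous_map_preimage[OF c H(2)] .
  have sub: "{\<one>} \<times> carrier G \<subseteq> ?S" by (auto simp: topspace_X)
  have K: "compactin X (carrier G)" using compact_X by (simp add: compact_space_def topspace_X)
  obtain V where V: "openin X V" "\<one> \<in> V" "V \<times> carrier G \<subseteq> ?S" by (rule tube[OF K S sub])
  define N where "N = {n \<in> carrier G. \<forall>g\<in>carrier G. inv g \<otimes> n \<otimes> g \<in> H}"
  have conj: "inv g \<otimes> (a \<otimes> b) \<otimes> g = (inv g \<otimes> a \<otimes> g) \<otimes> (inv g \<otimes> b \<otimes> g)"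
    if "g \<in> carrier G" "a \<in> carrier G" "b \<in> carrier G" for a b g
    using that by (simp add: m_assoc mult_inv_cancel)
  have conj_inv: "inv g \<otimes> inv a \<otimes> g = inv (inv g \<otimes> a \<otimes> g)"
    if "g \<in> carrier G" "a \<in> carrier G" for a g
    using that by (simp add: inv_mult_group m_assoc)
  have N: "subgroup N G"
  proof (rule subgroupI)
    show "N \<subseteq> carrier G" by (auto simp: N_def)
    show "N \<noteq> {}" by (auto simp: N_def intro!: exI[of _ \<one>])
    show "inv a \<in> N" if "a \<in> N" for a using that by (simp add: N_def conj_inv)
    show "a \<otimes> b \<in> N" if "a \<in> N" "b \<in> N" for a b using that by (simp add: N_def conj)
  qed
  have "V \<subseteq> N" using V(3) openin_subset_carrier[OF V(1)] by (auto simp: N_def)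
  then have "openin X N" using openin_subgroupI[OF N V(1,2)] by blast
  moreover have "N \<lhd> G"
    unfolding normal_inv_iff
  proof (intro conjI ballI N)
    fix x h assume x: "x \<in> carrier G" and h: "h \<in> N"
    then have hc: "h \<in> carrier G" by (simp add: N_def)
    have "inv g \<otimes> (x \<otimes> h \<otimes> inv x) \<otimes> g = inv (inv x \<otimes> g) \<otimes> h \<otimes> (inv x \<otimes> g)" if "g \<in> carrier G" for g
      using that x hc by (simp add: inv_mult_group m_assoc)
    then show "x \<otimes> h \<otimes> inv x \<in> N" using x h hc by (simp add: N_def)
  qed
  moreover have "N \<subseteq> H"
  proof
    fix n assume "n \<in> N"
    then have "n \<in> carrier G" "inv \<one> \<otimes> n \<otimes> \<one> \<in> H" unfolding N_def by blast+
    then show "n \<in> H" by simp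
  qed
  ultimately show thesis using H(3) by (intro that[of N]) (auto simp: ONS_iff)
qed

lemma carrier_ONS: "carrier G \<in> ONS"
proof -
  have "openin X (carrier G)" using openin_topspace[of X] by (simp add: topspace_X)
  then show ?thesis by (auto simp: ONS_iff normal_inv_iff subgroup_self)
qed

lemma ONS_Int: "A \<in> ONS \<Longrightarrow> B \<in> ONS \<Longrightarrow> A \<inter> B \<in> ONS"
  unfolding ONS_iff normal_inv_iff by (auto intro: subgroups_Inter_pair)

lemma ONS_Inter:
  assumes "finite \<N>" "\<N> \<subseteq> ONS"
  shows "\<exists>N\<in>ONS. \<forall>N'\<in>\<N>. N \<subseteq> N'"
  using assms
proof (induction \<N>)
  case empty
  then show ?case using carrier_ONS by blast
next
  case (insert A \<N>)
  then obtain N where "N \<in> ONS" "\<forall>N'\<in>\<N>. N \<subseteq> N'" by blast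
  then show ?case using insert.prems by (intro bexI[of _ "A \<inter> N"] ONS_Int) auto
qed

lemma mem_r_coset_self: "N \<in> ONS \<Longrightarrow> g \<in> carrier G \<Longrightarrow> g \<in> N #> g"
  using ONS_subgroup rcos_self by blast

lemma r_coset_subset_carrier: "N \<in> ONS \<Longrightarrow> g \<in> carrier G \<Longrightarrow> N #> g \<subseteq> carrier G"
  by (meson ONS_subgroup r_coset_subset_G subgroup.subset)

lemma r_coset_eq: "N \<in> ONS \<Longrightarrow> g \<in> carrier G \<Longrightarrow> h \<in> N #> g \<Longrightarrow> N #> h = N #> g"
  using repr_independence[of h N g] ONS_subgroup by simp

lemma openin_ONS_r_coset: "N \<in> ONS \<Longrightarrow> g \<in> carrier G \<Longrightarrow> openin X (N #> g)"
  by (simp add: ONS_iff openin_r_coset)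

text \<open>
  The Lebesgue number lemma: any assignment of neighbourhoods to points is refined by the cosets of a
  single open normal subgroup.
\<close>

lemma uniform_cosets:
  assumes U: "\<And>g. g \<in> carrier G \<Longrightarrow> openin X (U g)" "\<And>g. g \<in> carrier G \<Longrightarrow> g \<in> U g"
  obtains N where "N \<in> ONS" "\<And>h. h \<in> carrier G \<Longrightarrow> \<exists>g\<in>carrier G. N #> h \<subseteq> U g"
proof -
  have "\<exists>N. N \<in> ONS \<and> N #> g \<subseteq> U g" if g: "g \<in> carrier G" for g
  proof -
    have "openin X (U g #> inv g)" using U g by (intro openin_r_coset) auto
    moreover have "\<one> \<in> U g #> inv g"
      using U(2)[OF g] g by (auto simp: r_coset_def intro!: bexI[of _ g])
    ultimately obtain N where N: "N \<in> ONS" "N \<subseteq> U g #> inv g" using ONS_basis by blast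
    have "N #> g \<subseteq> U g"
    proof
      fix x assume "x \<in> N #> g"
      then obtain n where "n \<in> N" "x = n \<otimes> g" by (auto simp: r_coset_def)
      moreover then obtain u where "u \<in> U g" "n = u \<otimes> inv g" using N(2) by (auto simp: r_coset_def)
      ultimately show "x \<in> U g"
        using g openin_subset_carrier[OF U(1)[OF g]] by (auto simp: m_assoc subset_iff)
    qed
    with N(1) show ?thesis by blast
  qed
  then obtain N where N: "\<And>g. g \<in> carrier G \<Longrightarrow> N g \<in> ONS" "\<And>g. g \<in> carrier G \<Longrightarrow> N g #> g \<subseteq> U g"
    by metis
  have "\<exists>\<F>. finite \<F> \<and> \<F> \<subseteq> (\<lambda>g. N g #> g) ` carrier G \<and> topspace X \<subseteq> \<Union>\<F>"
  proof (rule compact_space_alt[THEN iffD1, OF compact_X, rule_format], intro conjI ballI)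
    show "openin X C" if "C \<in> (\<lambda>g. N g #> g) ` carrier G" for C
      using that N(1) openin_ONS_r_coset by auto
    show "topspace X \<subseteq> \<Union> ((\<lambda>g. N g #> g) ` carrier G)"
      using N(1) mem_r_coset_self by (auto simp: topspace_X)
  qed
  then obtain \<F> where \<F>: "finite \<F>" "\<F> \<subseteq> (\<lambda>g. N g #> g) ` carrier G" "carrier G \<subseteq> \<Union>\<F>"
    unfolding topspace_X by blast
  from finite_subset_image[OF \<F>(1,2)] obtain T
    where T: "finite T" "T \<subseteq> carrier G" and "\<F> = (\<lambda>g. N g #> g) ` T" by blast
  with \<F>(3) have T3: "carrier G \<subseteq> (\<Union>g\<in>T. N g #> g)" by simp
  have "finite (N ` T)" "N ` T \<subseteq> ONS" using T N(1) by auto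
  from ONS_Inter[OF this] obtain N0 where N0: "N0 \<in> ONS" "\<And>g. g \<in> T \<Longrightarrow> N0 \<subseteq> N g" by blast
  show thesis
  proof (rule that[OF N0(1)])
    fix h assume h: "h \<in> carrier G"
    then obtain g where g: "g \<in> T" "h \<in> N g #> g" using T3 by blast
    then have gc: "g \<in> carrier G" using T(2) by blast
    have "N0 #> h \<subseteq> N g #> h" using N0(2)[OF g(1)] by (auto simp: r_coset_def)
    also have "\<dots> = N g #> g" by (rule r_coset_eq[OF N(1)[OF gc] gc g(2)])
    also have "\<dots> \<subseteq> U g" by (rule N(2)[OF gc])
    finally show "\<exists>g\<in>carrier G. N0 #> h \<subseteq> U g" using gc by blast
  qed
qed

lemma carrier_Mod: "carrier (G Mod N) = (\<lambda>g. N #> g) ` carrier G"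
  by (auto simp: FactGroup_def RCOSETS_def)

lemma finite_Mod:
  assumes N: "N \<in> ONS"
  shows "finite (carrier (G Mod N))"
proof -
  have "\<exists>\<F>. finite \<F> \<and> \<F> \<subseteq> carrier (G Mod N) \<and> topspace X \<subseteq> \<Union>\<F>"
  proof (rule compact_space_alt[THEN iffD1, OF compact_X, rule_format], intro conjI ballI)
    show "openin X C" if "C \<in> carrier (G Mod N)" for C
      using that N openin_ONS_r_coset by (auto simp: carrier_Mod)
    show "topspace X \<subseteq> \<Union> (carrier (G Mod N))"
      using N mem_r_coset_self by (auto simp: topspace_X carrier_Mod)
  qed
  then obtain \<F> where \<F>: "finite \<F>" "\<F> \<subseteq> carrier (G Mod N)" "carrier G \<subseteq> \<Union>\<F>"
    by (auto simp: topspace_X)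
  have "carrier (G Mod N) \<subseteq> \<F>"
  proof
    fix C assume "C \<in> carrier (G Mod N)"
    then obtain g where g: "g \<in> carrier G" "C = N #> g" by (auto simp: carrier_Mod)
    then obtain D where D: "D \<in> \<F>" "g \<in> D" using \<F>(3) by blast
    then obtain h where h: "h \<in> carrier G" "D = N #> h" using \<F>(2) by (auto simp: carrier_Mod)
    then have "C = D" using r_coset_eq[OF N h(1)] D(2) g(2) by simp
    then show "C \<in> \<F>" using D by simp
  qed
  then show ?thesis using \<F>(1) finite_subset by blast
qed

end


section \<open>Power series in two groups of variables\<close>

text \<open>
  Vectors of length \<open>d + d\<close> are pairs of vectors of length \<open>d\<close>, as in the charts of a product manifold.
\<close>

definition join :: "nat \<Rightarrow> (nat \<Rightarrow> 'a) \<Rightarrow> (nat \<Rightarrow> 'a) \<Rightarrow> nat \<Rightarrow> 'a" where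
  "join d u v = (\<lambda>i. if i < d then u i else v (i - d))"

lemma bij_join: "bij_betw (\<lambda>(u, v). join d u v) (vecs d \<times> vecs d) (vecs (d + d))"
proof (rule bij_betwI[of _ _ _ "\<lambda>w. ((\<lambda>i. if i < d then w i else 0), (\<lambda>i. w (i + d)))"])
  show "(\<lambda>(u, v). join d u v) \<in> vecs d \<times> vecs d \<rightarrow> vecs (d + d)"
    by (auto simp: join_def vecs_def)
  show "(\<lambda>w. ((\<lambda>i. if i < d then w i else 0), (\<lambda>i. w (i + d)))) \<in> vecs (d + d) \<rightarrow> vecs d \<times> vecs d"
    by (auto simp: vecs_def)
qed (auto simp: join_def vecs_def fun_eq_iff)

lemma vecs_eq_zeroI:
  assumes "\<alpha> \<in> vecs d" "\<forall>i\<in>{..<d}. \<alpha> i = 0"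
  shows "\<alpha> = (\<lambda>_. 0)"
proof
  show "\<alpha> i = 0" for i using assms by (cases "i < d") (auto simp: vecs_def)
qed

lemma sum_lessThan_add: "(\<Sum>i<m + n::nat. f i) = (\<Sum>i<m. f i) + (\<Sum>i<n. f (m + i) :: 'a::comm_monoid_add)"
  by (induction n) (simp_all add: add.assoc)

lemma prod_lessThan_add: "(\<Prod>i<m + n::nat. f i) = (\<Prod>i<m. f i) * (\<Prod>i<n. f (m + i) :: 'a::comm_monoid_mult)"
  by (induction n) (simp_all add: mult.assoc)

lemma sum_join: "(\<Sum>i<d + d. join d \<alpha> \<beta> i) = (\<Sum>i<d. \<alpha> i) + (\<Sum>i<d. \<beta> i :: nat)"
  by (simp add: sum_lessThan_add join_def)

lemma join_in_polydisc:
  assumes "u \<in> polydisc d x \<epsilon>" "v \<in> polydisc d y \<epsilon>"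
  shows "join d u v \<in> polydisc (d + d) (join d x y) \<epsilon>"
  using assms by (auto simp: polydisc_def vecs_def join_def)

lemma polydisc_joinE:
  fixes w :: "nat \<Rightarrow> 'l::nonarch_field"
  assumes w: "w \<in> polydisc (d + d) (join d x y) \<epsilon>"
  obtains u v where "w = join d u v" "u \<in> polydisc d x \<epsilon>" "v \<in> polydisc d y \<epsilon>"
proof -
  have "w \<in> (\<lambda>(u, v). join d u v) ` (vecs d \<times> vecs d)"
    using w bij_join[of d, where 'a='l] by (simp add: bij_betw_def polydisc_def)
  then obtain u v where uv: "w = join d u v" "u \<in> vecs d" "v \<in> vecs d" by auto
  have "absv (u i - x i) \<le> \<epsilon>" if "i < d" for i
    using w that by (auto simp: polydisc_def uv(1) join_def dest!: spec[of _ i])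
  moreover have "absv (v i - y i) \<le> \<epsilon>" if "i < d" for i
    using w that by (auto simp: polydisc_def uv(1) join_def dest!: spec[of _ "i + d"])
  ultimately show thesis using uv by (intro that) (auto simp: polydisc_def)
qed

lemma has_sum_Diff_finite:
  fixes u :: "'i \<Rightarrow> 'a::nonarch_field"
  assumes s: "(u has_sum s) A" and F: "finite F" "F \<subseteq> A"
  shows "(u has_sum (s - sum u F)) (A - F)"
  unfolding has_sum_absv_iff
proof (intro allI impI)
  fix e :: real assume "e > 0"
  from s[unfolded has_sum_absv_iff, rule_format, OF this] obtain X where X: "finite X" "X \<subseteq> A"
    "\<And>F'. finite F' \<Longrightarrow> X \<subseteq> F' \<Longrightarrow> F' \<subseteq> A \<Longrightarrow> absv (sum u F' - s) < e"
    by metis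
  show "\<exists>X. finite X \<and> X \<subseteq> A - F \<and> (\<forall>Y. finite Y \<and> X \<subseteq> Y \<and> Y \<subseteq> A - F \<longrightarrow> absv (sum u Y - (s - sum u F)) < e)"
  proof (intro exI[of _ "X - F"] conjI allI impI)
    fix Y assume Y: "finite Y \<and> X - F \<subseteq> Y \<and> Y \<subseteq> A - F"
    have "sum u (Y \<union> F) = sum u Y + sum u F"
      using Y F by (intro sum.union_disjoint) auto
    then have eq: "sum u Y - (s - sum u F) = sum u (Y \<union> F) - s" by (simp add: algebra_simps)
    show "absv (sum u Y - (s - sum u F)) < e" unfolding eq using X Y F by (intro X(3)) auto
  qed (use X in auto)
qed

context isometric_embedding
begin

lemma monomial_join:
  "(\<Prod>i<d + d. \<iota> (join d u v i - join d x y i) ^ join d \<alpha> \<beta> i)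
    = (\<Prod>i<d. \<iota> (u i - x i) ^ \<alpha> i) * (\<Prod>i<d. \<iota> (v i - y i) ^ \<beta> i)"
  by (simp add: prod_lessThan_add join_def)

lemma joint_expansion:
  assumes "expands_on \<iota> (d + d) (join d x y) \<epsilon> c f"
  shows "\<And>e. e > 0 \<Longrightarrow> finite {(\<alpha>, \<beta>). \<alpha> \<in> vecs d \<and> \<beta> \<in> vecs d \<and>
      e \<le> absv (c (join d \<alpha> \<beta>)) * \<epsilon> ^ ((\<Sum>i<d. \<alpha> i) + (\<Sum>i<d. \<beta> i))}"
    and "\<And>u v. u \<in> polydisc d x \<epsilon> \<Longrightarrow> v \<in> polydisc d y \<epsilon> \<Longrightarrow>
      ((\<lambda>(\<alpha>, \<beta>). c (join d \<alpha> \<beta>) * ((\<Prod>i<d. \<iota> (u i - x i) ^ \<alpha> i) * (\<Prod>i<d. \<iota> (v i - y i) ^ \<beta> i)))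
        has_sum f (join d u v)) (vecs d \<times> vecs d)"
proof -
  fix e :: real assume "e > 0"
  then have "finite {\<gamma> \<in> vecs (d + d). e \<le> absv (c \<gamma>) * \<epsilon> ^ (\<Sum>i<d + d. \<gamma> i)}"
    using assms unfolding expands_on_def by blast
  moreover have "inj_on (\<lambda>(\<alpha>, \<beta>). join d \<alpha> \<beta>) (vecs d \<times> (vecs d :: (nat \<Rightarrow> nat) set))"
    using bij_join unfolding bij_betw_def by blast
  ultimately have "finite ((\<lambda>(\<alpha>, \<beta>). join d \<alpha> \<beta>) -` {\<gamma> \<in> vecs (d + d). e \<le> absv (c \<gamma>) * \<epsilon> ^ (\<Sum>i<d + d. \<gamma> i)}
      \<inter> (vecs d \<times> vecs d))"
    by (rule finite_vimage_IntI)
  then show "finite {(\<alpha>, \<beta>). \<alpha> \<in> vecs d \<and> \<beta> \<in> vecs d \<and>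
      e \<le> absv (c (join d \<alpha> \<beta>)) * \<epsilon> ^ ((\<Sum>i<d. \<alpha> i) + (\<Sum>i<d. \<beta> i))}"
    by (rule finite_subset[rotated]) (auto simp: sum_join, auto simp: vecs_def join_def)
next
  fix u v assume "u \<in> polydisc d x \<epsilon>" "v \<in> polydisc d y \<epsilon>"
  then have "((\<lambda>\<gamma>. c \<gamma> * (\<Prod>i<d + d. \<iota> (join d u v i - join d x y i) ^ \<gamma> i)) has_sum f (join d u v)) (vecs (d + d))"
    using assms join_in_polydisc unfolding expands_on_def by blast
  then show "((\<lambda>(\<alpha>, \<beta>). c (join d \<alpha> \<beta>) * ((\<Prod>i<d. \<iota> (u i - x i) ^ \<alpha> i) * (\<Prod>i<d. \<iota> (v i - y i) ^ \<beta> i)))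
      has_sum f (join d u v)) (vecs d \<times> vecs d)"
    using has_sum_reindex_bij_betw[OF bij_join[of d],
        of "\<lambda>\<gamma>. c \<gamma> * (\<Prod>i<d + d. \<iota> (join d u v i - join d x y i) ^ \<gamma> i)" "f (join d u v)"]
    by (simp only: case_prod_unfold monomial_join)
qed

text \<open>
  At the centre of the first group of variables only the terms of degree zero in them survive.
\<close>

lemma expands_on_slice:
  assumes c: "expands_on \<iota> (d + d) (join d x y) \<epsilon> c f" and x: "x \<in> vecs d" and \<epsilon>: "0 \<le> \<epsilon>"
  shows "expands_on \<iota> d y \<epsilon> (\<lambda>\<beta>. c (join d (\<lambda>_. 0) \<beta>)) (\<lambda>v. f (join d x v))"
  unfolding expands_on_def
proof (intro conjI allI impI ballI)
  fix e :: real assume "e > 0"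
  from joint_expansion(1)[OF c this]
  have "finite (snd ` {(\<alpha>, \<beta>). \<alpha> \<in> vecs d \<and> \<beta> \<in> vecs d \<and>
      e \<le> absv (c (join d \<alpha> \<beta>)) * \<epsilon> ^ ((\<Sum>i<d. \<alpha> i) + (\<Sum>i<d. \<beta> i))})" by (rule finite_imageI)
  then show "finite {\<beta> \<in> vecs d. e \<le> absv (c (join d (\<lambda>_. 0) \<beta>)) * \<epsilon> ^ (\<Sum>i<d. \<beta> i)}"
  proof (rule finite_subset[rotated], intro subsetI)
    fix \<beta> assume "\<beta> \<in> {\<beta> \<in> vecs d. e \<le> absv (c (join d (\<lambda>_. 0) \<beta>)) * \<epsilon> ^ (\<Sum>i<d. \<beta> i)}"
    then show "\<beta> \<in> snd ` {(\<alpha>, \<beta>). \<alpha> \<in> vecs d \<and> \<beta> \<in> vecs d \<and>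
      e \<le> absv (c (join d \<alpha> \<beta>)) * \<epsilon> ^ ((\<Sum>i<d. \<alpha> i) + (\<Sum>i<d. \<beta> i))}"
      by (intro image_eqI[of _ _ "(\<lambda>_. 0, \<beta>)"]) auto
  qed
next
  fix v assume v: "v \<in> polydisc d y \<epsilon>"
  let ?t = "\<lambda>(\<alpha>, \<beta>). c (join d \<alpha> \<beta>) * ((\<Prod>i<d. \<iota> (x i - x i) ^ \<alpha> i) * (\<Prod>i<d. \<iota> (v i - y i) ^ \<beta> i))"
  have "(?t has_sum f (join d x v)) (vecs d \<times> vecs d)"
    using joint_expansion(2)[OF c polydisc_center[OF x \<epsilon>] v] .
  then have "(?t has_sum f (join d x v)) ({\<lambda>_. 0} \<times> vecs d)"
    by (elim has_sum_cong_neutral[THEN iffD1, rotated -1]) (auto intro: vecs_eq_zeroI)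
  moreover have bij: "bij_betw (\<lambda>\<beta>. (\<lambda>_. 0, \<beta>)) (vecs d) ({\<lambda>_. 0 :: nat} \<times> (vecs d :: (nat \<Rightarrow> nat) set))"
    by (auto simp: bij_betw_def inj_on_def)
  ultimately have "((\<lambda>\<beta>. ?t (\<lambda>_. 0, \<beta>)) has_sum f (join d x v)) (vecs d)"
    using has_sum_reindex_bij_betw[OF bij, of ?t "f (join d x v)"] by simp
  then show "((\<lambda>\<beta>. c (join d (\<lambda>_. 0) \<beta>) * (\<Prod>i<d. \<iota> (v i - y i) ^ \<beta> i)) has_sum f (join d x v)) (vecs d)"
    by simp
qed

text \<open>
  If \<open>f (u, v) = \<Sum>\<^sub>\<alpha> u\<^sup>\<alpha> H\<^sub>\<alpha> (v)\<close>, then \<open>\<Lambda> (f (u, _)) = \<Sum>\<^sub>\<alpha> u\<^sup>\<alpha> \<Lambda> (H\<^sub>\<alpha>)\<close>: finite sums are handled by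
  linearity, and the remainders tend to zero in norm, so \<open>\<Lambda>\<close> of them tends to zero by its bound.
\<close>

lemma expands_on_functional:
  fixes \<Lambda> :: "((nat \<Rightarrow> 'l) \<Rightarrow> 'k) \<Rightarrow> 'k"
  assumes c: "expands_on \<iota> (d + d) (join d x y) \<epsilon> c f" and \<epsilon>: "0 < \<epsilon>" and C: "0 \<le> C"
    and add: "\<And>g h B B'. expands_le \<iota> d y \<epsilon> g B \<Longrightarrow> expands_le \<iota> d y \<epsilon> h B' \<Longrightarrow> \<Lambda> (\<lambda>v. g v + h v) = \<Lambda> g + \<Lambda> h"
    and cmult: "\<And>r g B. expands_le \<iota> d y \<epsilon> g B \<Longrightarrow> \<Lambda> (\<lambda>v. r * g v) = r * \<Lambda> g"
    and bound: "\<And>g B. expands_le \<iota> d y \<epsilon> g B \<Longrightarrow> absv (\<Lambda> g) \<le> C * B"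
  shows "\<exists>a. expands_on \<iota> d x \<epsilon> a (\<lambda>u. \<Lambda> (\<lambda>v. f (join d u v)))"
proof -
  let ?n = "\<lambda>\<alpha>. \<epsilon> ^ (\<Sum>i<d. \<alpha> i)"
  let ?m = "\<lambda>\<alpha> u. \<Prod>i<d. \<iota> (u i - x i) ^ \<alpha> i"
  let ?m' = "\<lambda>\<beta> v. \<Prod>i<d. \<iota> (v i - y i) ^ \<beta> i"
  define a where "a \<alpha> \<beta> = c (join d \<alpha> \<beta>)" for \<alpha> \<beta>
  have n: "0 < ?n \<alpha>" for \<alpha> using \<epsilon> by simp
  have fin: "finite {(\<alpha>, \<beta>). \<alpha> \<in> vecs d \<and> \<beta> \<in> vecs d \<and> e \<le> absv (a \<alpha> \<beta>) * ?n \<beta> * ?n \<alpha>}" if "e > 0" for e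
    using joint_expansion(1)[OF c that] by (simp add: a_def power_add mult_ac)
  have fin1: "finite {\<beta> \<in> vecs d. e \<le> absv (a \<alpha> \<beta>) * ?n \<beta>}" if \<alpha>: "\<alpha> \<in> vecs d" and e: "e > 0" for \<alpha> e
  proof -
    have "finite (snd ` {(\<alpha>', \<beta>). \<alpha>' \<in> vecs d \<and> \<beta> \<in> vecs d \<and> e * ?n \<alpha> \<le> absv (a \<alpha>' \<beta>) * ?n \<beta> * ?n \<alpha>'})"
      using fin[of "e * ?n \<alpha>"] n[of \<alpha>] e by simp
    then show ?thesis
    proof (rule finite_subset[rotated], intro subsetI)
      fix \<beta> assume "\<beta> \<in> {\<beta> \<in> vecs d. e \<le> absv (a \<alpha> \<beta>) * ?n \<beta>}"
      then show "\<beta> \<in> snd ` {(\<alpha>', \<beta>). \<alpha>' \<in> vecs d \<and> \<beta> \<in> vecs d \<and> e * ?n \<alpha> \<le> absv (a \<alpha>' \<beta>) * ?n \<beta> * ?n \<alpha>'}"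
        using \<alpha> n[of \<alpha>] by (intro image_eqI[of _ _ "(\<alpha>, \<beta>)"]) auto
    qed
  qed
  obtain B0 where B0: "\<And>\<gamma>. \<gamma> \<in> vecs (d + d) \<Longrightarrow> absv (c \<gamma>) * \<epsilon> ^ (\<Sum>i<d + d. \<gamma> i) \<le> B0"
    using expands_on_bounded[OF c] by blast
  have bdd: "absv (a \<alpha> \<beta>) * ?n \<beta> * ?n \<alpha> \<le> B0" if "\<alpha> \<in> vecs d" "\<beta> \<in> vecs d" for \<alpha> \<beta>
  proof -
    have "join d \<alpha> \<beta> \<in> vecs (d + d)" using that by (auto simp: vecs_def join_def)
    from B0[OF this] show ?thesis by (simp add: sum_join a_def power_add mult_ac)
  qed
  (* The weighted norm of the \<alpha>-th slice. It tends to zero because the joint terms do. *)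
  define B where "B \<alpha> = (SUP \<beta>\<in>vecs d. absv (a \<alpha> \<beta>) * ?n \<beta> * ?n \<alpha>)" for \<alpha>
  have B_ge: "absv (a \<alpha> \<beta>) * ?n \<beta> * ?n \<alpha> \<le> B \<alpha>" if "\<alpha> \<in> vecs d" "\<beta> \<in> vecs d" for \<alpha> \<beta>
    unfolding B_def by (rule cSUP_upper[OF that(2)]) (use bdd[OF that(1)] in \<open>auto intro!: bdd_aboveI2\<close>)
  have B_le: "B \<alpha> \<le> D" if "\<And>\<beta>. \<beta> \<in> vecs d \<Longrightarrow> absv (a \<alpha> \<beta>) * ?n \<beta> * ?n \<alpha> \<le> D" for \<alpha> D
    unfolding B_def
  proof (rule cSUP_least)
    show "vecs d \<noteq> ({} :: (nat \<Rightarrow> nat) set)" using zero_in_vecs by blast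
  qed (rule that)
  have B0': "finite {\<alpha> \<in> vecs d. e \<le> B \<alpha>}" if e: "e > 0" for e
  proof (rule finite_subset)
    show "{\<alpha> \<in> vecs d. e \<le> B \<alpha>} \<subseteq>
      fst ` {(\<alpha>, \<beta>). \<alpha> \<in> vecs d \<and> \<beta> \<in> vecs d \<and> e / 2 \<le> absv (a \<alpha> \<beta>) * ?n \<beta> * ?n \<alpha>}" (is "_ \<subseteq> ?R")
    proof
      fix \<alpha> assume \<alpha>: "\<alpha> \<in> {\<alpha> \<in> vecs d. e \<le> B \<alpha>}"
      show "\<alpha> \<in> ?R"
      proof (rule ccontr)
        assume "\<alpha> \<notin> ?R"
        then have "B \<alpha> \<le> e / 2" using \<alpha> by (intro B_le) force
        then show False using \<alpha> e by simp
      qed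
    qed
    show "finite ?R" using fin[of "e / 2"] e by simp
  qed
  have "\<exists>s. ((\<lambda>\<beta>. a \<alpha> \<beta> * ?m' \<beta> v) has_sum s) (vecs d)"
    if \<alpha>: "\<alpha> \<in> vecs d" and v: "v \<in> polydisc d y \<epsilon>" for \<alpha> v
  proof -
    have "c0_on (vecs d) (\<lambda>\<beta>. a \<alpha> \<beta> * ?m' \<beta> v)"
    proof (rule c0_on_dominated[of _ "\<lambda>\<beta>. absv (a \<alpha> \<beta>) * ?n \<beta>"])
      show "finite {\<beta> \<in> vecs d. e \<le> absv (a \<alpha> \<beta>) * ?n \<beta>}" if "e > 0" for e
        by (rule fin1[OF \<alpha> that])
    qed (use absv_term_le[OF v] \<epsilon> in auto)
    then show ?thesis using c0_summable by blast
  qed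
  note H_ex = this
  (* The \<alpha>-th slice itself, as a function of the second group of variables. *)
  define H where "H \<alpha> v = (SOME s. ((\<lambda>\<beta>. a \<alpha> \<beta> * ?m' \<beta> v) has_sum s) (vecs d))" for \<alpha> v
  have H: "((\<lambda>\<beta>. a \<alpha> \<beta> * ?m' \<beta> v) has_sum H \<alpha> v) (vecs d)"
    if "\<alpha> \<in> vecs d" "v \<in> polydisc d y \<epsilon>" for \<alpha> v
    unfolding H_def by (rule someI_ex[OF H_ex[OF that]])
  have H_le: "expands_le \<iota> d y \<epsilon> (H \<alpha>) (B \<alpha> / ?n \<alpha>)" if \<alpha>: "\<alpha> \<in> vecs d" for \<alpha>
    unfolding expands_le_def
  proof (intro exI[of _ "a \<alpha>"] conjI ballI)
    show "expands_on \<iota> d y \<epsilon> (a \<alpha>) (H \<alpha>)"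
      unfolding expands_on_def
    proof (intro conjI allI impI ballI H[OF \<alpha>])
      show "finite {\<beta> \<in> vecs d. e \<le> absv (a \<alpha> \<beta>) * ?n \<beta>}" if "e > 0" for e
        by (rule fin1[OF \<alpha> that])
    qed
    show "absv (a \<alpha> \<beta>) * ?n \<beta> \<le> B \<alpha> / ?n \<alpha>" if "\<beta> \<in> vecs d" for \<beta>
      using B_ge[OF \<alpha> that] n[of \<alpha>] by (simp add: pos_le_divide_eq)
  qed
  have f: "((\<lambda>\<alpha>. ?m \<alpha> u * H \<alpha> v) has_sum f (join d u v)) (vecs d)"
    if u: "u \<in> polydisc d x \<epsilon>" and v: "v \<in> polydisc d y \<epsilon>" for u v
  proof (rule has_sum_iterated[OF _ _ joint_expansion(2)[OF c u v]])
    show "c0_on (vecs d \<times> vecs d) (\<lambda>(\<alpha>, \<beta>). c (join d \<alpha> \<beta>) * (?m \<alpha> u * ?m' \<beta> v))"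
    proof (rule c0_on_dominated[of _ "\<lambda>(\<alpha>, \<beta>). absv (a \<alpha> \<beta>) * ?n \<beta> * ?n \<alpha>"])
      show "finite {p \<in> vecs d \<times> vecs d. e \<le> (case p of (\<alpha>, \<beta>) \<Rightarrow> absv (a \<alpha> \<beta>) * ?n \<beta> * ?n \<alpha>)}" if "e > 0" for e
        using fin[OF that] by (rule finite_subset[rotated]) auto
      show "absv (case p of (\<alpha>, \<beta>) \<Rightarrow> c (join d \<alpha> \<beta>) * (?m \<alpha> u * ?m' \<beta> v))
          \<le> (case p of (\<alpha>, \<beta>) \<Rightarrow> absv (a \<alpha> \<beta>) * ?n \<beta> * ?n \<alpha>)" for p
      proof (cases p)
        case (Pair \<alpha> \<beta>)
        have "absv (a \<alpha> \<beta>) * absv (?m' \<beta> v) * absv (?m \<alpha> u) \<le> absv (a \<alpha> \<beta>) * ?n \<beta> * ?n \<alpha>"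
          using absv_monomial_le[OF u, of \<alpha>] absv_monomial_le[OF v, of \<beta>] \<epsilon> by (intro mult_mono) auto
        then show ?thesis by (simp add: Pair a_def absv_mult mult_ac)
      qed
    qed
    show "((\<lambda>\<beta>. case (\<alpha>, \<beta>) of (\<alpha>, \<beta>) \<Rightarrow> c (join d \<alpha> \<beta>) * (?m \<alpha> u * ?m' \<beta> v)) has_sum ?m \<alpha> u * H \<alpha> v) (vecs d)"
      if "\<alpha> \<in> vecs d" for \<alpha>
      using has_sum_cmult_nonarch[OF H[OF that v], of "?m \<alpha> u"] by (simp add: a_def mult_ac)
  qed
  (* The remainder after finitely many slices, in norm and not only pointwise. *)
  have rem: "expands_le \<iota> d y \<epsilon> (\<lambda>v. f (join d u v) - (\<Sum>\<alpha>\<in>F. ?m \<alpha> u * H \<alpha> v)) D"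
    if u: "u \<in> polydisc d x \<epsilon>" and F: "finite F" "F \<subseteq> vecs d" and D: "0 \<le> D" "\<And>\<alpha>. \<alpha> \<in> vecs d - F \<Longrightarrow> B \<alpha> \<le> D"
    for u F D
  proof (rule expands_le_sum[OF \<epsilon> D(1), of "vecs d - F" B])
    show "finite {\<alpha> \<in> vecs d - F. e \<le> B \<alpha>}" if "e > 0" for e
      using B0'[OF that] by (rule finite_subset[rotated]) auto
    show "expands_le \<iota> d y \<epsilon> (\<lambda>v. ?m \<alpha> u * H \<alpha> v) (B \<alpha>)" if \<alpha>: "\<alpha> \<in> vecs d - F" for \<alpha>
    proof (rule expands_leI_le)
      show "expands_le \<iota> d y \<epsilon> (\<lambda>v. ?m \<alpha> u * H \<alpha> v) (absv (?m \<alpha> u) * (B \<alpha> / ?n \<alpha>))"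
        using \<alpha> \<epsilon> by (intro expands_le_cmult H_le) auto
      have "0 \<le> B \<alpha> / ?n \<alpha>" using expands_le_nonneg[OF H_le] \<alpha> \<epsilon> by simp
      then have "absv (?m \<alpha> u) * (B \<alpha> / ?n \<alpha>) \<le> ?n \<alpha> * (B \<alpha> / ?n \<alpha>)"
        using absv_monomial_le[OF u, of \<alpha>] \<epsilon> by (intro mult_right_mono) auto
      also have "\<dots> = B \<alpha>" using n[of \<alpha>] \<epsilon> by simp
      finally show "absv (?m \<alpha> u) * (B \<alpha> / ?n \<alpha>) \<le> B \<alpha>" .
    qed
    show "((\<lambda>\<alpha>. ?m \<alpha> u * H \<alpha> v) has_sum f (join d u v) - (\<Sum>\<alpha>\<in>F. ?m \<alpha> u * H \<alpha> v)) (vecs d - F)"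
      if "v \<in> polydisc d y \<epsilon>" for v
      using has_sum_Diff_finite[OF f[OF u that] F] .
  qed (use D in auto)
  have \<Lambda>_sum: "\<Lambda> (\<lambda>v. (\<Sum>\<alpha>\<in>F. ?m \<alpha> u * H \<alpha> v)) = (\<Sum>\<alpha>\<in>F. ?m \<alpha> u * \<Lambda> (H \<alpha>))
      \<and> (\<exists>D. expands_le \<iota> d y \<epsilon> (\<lambda>v. (\<Sum>\<alpha>\<in>F. ?m \<alpha> u * H \<alpha> v)) D)"
    if "finite F" "F \<subseteq> vecs d" for F u
    using that
  proof (induction F)
    case empty
    have z: "expands_le \<iota> d y \<epsilon> (\<lambda>_. 0) 0" using expands_le_const[of \<epsilon> d y 0] \<epsilon> by simp
    then show ?case using cmult[OF z, of 0] by auto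
  next
    case (insert \<alpha> F)
    then obtain D where IH: "\<Lambda> (\<lambda>v. (\<Sum>\<alpha>\<in>F. ?m \<alpha> u * H \<alpha> v)) = (\<Sum>\<alpha>\<in>F. ?m \<alpha> u * \<Lambda> (H \<alpha>))"
      "expands_le \<iota> d y \<epsilon> (\<lambda>v. (\<Sum>\<alpha>\<in>F. ?m \<alpha> u * H \<alpha> v)) D" by auto
    have h: "expands_le \<iota> d y \<epsilon> (\<lambda>v. ?m \<alpha> u * H \<alpha> v) (absv (?m \<alpha> u) * (B \<alpha> / ?n \<alpha>))"
      using insert.prems \<epsilon> by (intro expands_le_cmult H_le) auto
    have "expands_le \<iota> d y \<epsilon> (\<lambda>v. ?m \<alpha> u * H \<alpha> v + (\<Sum>\<alpha>\<in>F. ?m \<alpha> u * H \<alpha> v)) (max (absv (?m \<alpha> u) * (B \<alpha> / ?n \<alpha>)) D)"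
      using expands_leI_le[OF h] expands_leI_le[OF IH(2)] by (intro expands_le_add \<epsilon>) auto
    then show ?case
      using insert.hyps add[OF h IH(2)] IH(1) cmult[OF H_le] insert.prems by auto
  qed
  have \<Lambda>_tail: "absv ((\<Sum>\<alpha>\<in>F. \<Lambda> (H \<alpha>) * ?m \<alpha> u) - \<Lambda> (\<lambda>v. f (join d u v))) \<le> C * D"
    if u: "u \<in> polydisc d x \<epsilon>" and F: "finite F" "F \<subseteq> vecs d" and D: "0 \<le> D" "\<And>\<alpha>. \<alpha> \<in> vecs d - F \<Longrightarrow> B \<alpha> \<le> D"
    for u F D
  proof -
    let ?s = "\<lambda>v. \<Sum>\<alpha>\<in>F. ?m \<alpha> u * H \<alpha> v"
    note r = rem[OF u F D]
    obtain D' where D': "expands_le \<iota> d y \<epsilon> ?s D'" using \<Lambda>_sum[OF F, of u] by blast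
    have "\<Lambda> (\<lambda>v. (f (join d u v) - ?s v) + ?s v) = \<Lambda> (\<lambda>v. f (join d u v) - ?s v) + \<Lambda> ?s"
      using r D' by (rule add)
    then have "(\<Sum>\<alpha>\<in>F. \<Lambda> (H \<alpha>) * ?m \<alpha> u) - \<Lambda> (\<lambda>v. f (join d u v)) = - \<Lambda> (\<lambda>v. f (join d u v) - ?s v)"
      using \<Lambda>_sum[OF F, of u] by (simp add: mult.commute)
    then show ?thesis using bound[OF r] by simp
  qed
  show ?thesis
  proof (intro exI[of _ "\<lambda>\<alpha>. \<Lambda> (H \<alpha>)"], unfold expands_on_def, intro conjI allI impI ballI)
    fix e :: real assume e: "e > 0"
    have "{\<alpha> \<in> vecs d. e \<le> absv (\<Lambda> (H \<alpha>)) * ?n \<alpha>} \<subseteq> {\<alpha> \<in> vecs d. e / (C + 1) \<le> B \<alpha>}"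
    proof
      fix \<alpha> assume \<alpha>: "\<alpha> \<in> {\<alpha> \<in> vecs d. e \<le> absv (\<Lambda> (H \<alpha>)) * ?n \<alpha>}"
      then have h: "expands_le \<iota> d y \<epsilon> (H \<alpha>) (B \<alpha> / ?n \<alpha>)" by (simp add: H_le)
      then have "0 \<le> B \<alpha> / ?n \<alpha>" using expands_le_nonneg \<epsilon> by fastforce
      then have "0 \<le> B \<alpha>" using n[of \<alpha>] by (simp add: zero_le_divide_iff)
      have "e \<le> absv (\<Lambda> (H \<alpha>)) * ?n \<alpha>" using \<alpha> by simp
      also have "\<dots> \<le> C * (B \<alpha> / ?n \<alpha>) * ?n \<alpha>" using bound[OF h] n[of \<alpha>] by (intro mult_right_mono) auto
      also have "\<dots> = C * B \<alpha>" using n[of \<alpha>] \<epsilon> by simp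
      also have "\<dots> \<le> (C + 1) * B \<alpha>" using \<open>0 \<le> B \<alpha>\<close> by (intro mult_right_mono) auto
      finally show "\<alpha> \<in> {\<alpha> \<in> vecs d. e / (C + 1) \<le> B \<alpha>}"
        using \<alpha> C by (simp add: pos_divide_le_eq mult.commute)
    qed
    moreover have "finite {\<alpha> \<in> vecs d. e / (C + 1) \<le> B \<alpha>}" using e C by (intro B0') simp
    ultimately show "finite {\<alpha> \<in> vecs d. e \<le> absv (\<Lambda> (H \<alpha>)) * ?n \<alpha>}" by (rule finite_subset)
  next
    fix u assume u: "u \<in> polydisc d x \<epsilon>"
    show "((\<lambda>\<alpha>. \<Lambda> (H \<alpha>) * ?m \<alpha> u) has_sum \<Lambda> (\<lambda>v. f (join d u v))) (vecs d)"
      unfolding has_sum_absv_iff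
    proof (intro allI impI)
      fix e :: real assume e: "e > 0"
      (* Adding 1 covers the case C = 0 and makes the final inequality strict. *)
      define D where "D = e / (C + 1)"
      have D: "D > 0" using e C by (simp add: D_def)
      have "C * D < (C + 1) * D" using D by simp
      also have "\<dots> = e" using C by (simp add: D_def)
      finally have CD: "C * D < e" .
      show "\<exists>F. finite F \<and> F \<subseteq> vecs d \<and> (\<forall>F'. finite F' \<and> F \<subseteq> F' \<and> F' \<subseteq> vecs d \<longrightarrow>
          absv ((\<Sum>\<alpha>\<in>F'. \<Lambda> (H \<alpha>) * ?m \<alpha> u) - \<Lambda> (\<lambda>v. f (join d u v))) < e)"
      proof (intro exI[of _ "{\<alpha> \<in> vecs d. D \<le> B \<alpha>}"] conjI allI impI)
        fix F' assume F': "finite F' \<and> {\<alpha> \<in> vecs d. D \<le> B \<alpha>} \<subseteq> F' \<and> F' \<subseteq> vecs d"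
        then have "absv ((\<Sum>\<alpha>\<in>F'. \<Lambda> (H \<alpha>) * ?m \<alpha> u) - \<Lambda> (\<lambda>v. f (join d u v))) \<le> C * D"
          using D by (intro \<Lambda>_tail[OF u]) force+
        then show "absv ((\<Sum>\<alpha>\<in>F'. \<Lambda> (H \<alpha>) * ?m \<alpha> u) - \<Lambda> (\<lambda>v. f (join d u v))) < e"
          using CD by simp
      qed (use B0'[OF D] in auto)
    qed
  qed
qed

end


section \<open>Analytic functions on a compact analytic group\<close>

lemma locally_analytic_on_restrict:
  assumes f: "locally_analytic_on \<kappa> d T f" and T': "openin (top_of_set (vecs d)) T'" "T' \<subseteq> T"
    and g: "\<And>y. y \<in> T' \<Longrightarrow> f y = g y"
  shows "locally_analytic_on \<kappa> d T' g"
  unfolding locally_analytic_on_def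
proof
  fix x assume x: "x \<in> T'"
  then obtain \<epsilon> a where \<epsilon>: "0 < \<epsilon>" "expands_on \<kappa> d x \<epsilon> a f"
    using f T'(2) unfolding locally_analytic_on_def by blast
  obtain \<epsilon>' where \<epsilon>': "0 < \<epsilon>'" "polydisc d x \<epsilon>' \<subseteq> T'" using polydisc_nbhd[OF T'(1) x] .
  have sub: "polydisc d x (min \<epsilon> \<epsilon>') \<subseteq> T'"
    using \<epsilon>'(2) polydisc_mono[of "min \<epsilon> \<epsilon>'" \<epsilon>' d x] by auto
  have "expands_on \<kappa> d x (min \<epsilon> \<epsilon>') a f"
    using \<epsilon> \<epsilon>' by (intro expands_on_mono[OF \<epsilon>(2)]) auto
  then have "expands_on \<kappa> d x (min \<epsilon> \<epsilon>') a g"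
    by (rule expands_on_cong) (use sub g in blast)
  then show "\<exists>\<epsilon>>0. polydisc d x \<epsilon> \<subseteq> T' \<and> (\<exists>a. expands_on \<kappa> d x \<epsilon> a g)"
    using sub \<epsilon> \<epsilon>' by (intro exI[of _ "min \<epsilon> \<epsilon>'"]) auto
qed

lemma expands_on_imp_expands_le:
  assumes "expands_on \<iota> d x \<epsilon> a f"
  obtains B where "expands_le \<iota> d x \<epsilon> f B"
proof -
  obtain B where "\<And>\<alpha>. \<alpha> \<in> vecs d \<Longrightarrow> absv (a \<alpha>) * \<epsilon> ^ (\<Sum>i<d. \<alpha> i) \<le> B"
    using expands_on_bounded[OF assms] by blast
  then have "expands_le \<iota> d x \<epsilon> f B" using assms unfolding expands_le_def by blast
  then show thesis by (rule that)
qed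

lemma openin_polydisc_complement:
  fixes x :: "nat \<Rightarrow> 'l::nonarch_field"
  assumes "0 < \<epsilon>"
  shows "openin (top_of_set (vecs d)) (vecs d - polydisc d x \<epsilon>)"
proof (subst openin_subopen, intro ballI)
  fix y assume y: "y \<in> vecs d - polydisc d x \<epsilon>"
  have "polydisc d y \<epsilon> \<inter> polydisc d x \<epsilon> = {}"
  proof (rule ccontr)
    assume "\<not> ?thesis"
    then obtain z where "z \<in> polydisc d y \<epsilon>" "z \<in> polydisc d x \<epsilon>" by blast
    then have "polydisc d y \<epsilon> = polydisc d x \<epsilon>" using polydisc_recenter by metis
    then show False using y polydisc_center[of y d \<epsilon>] assms by auto
  qed
  moreover have "polydisc d y \<epsilon> \<subseteq> vecs d" by (auto simp: polydisc_def)
  ultimately show "\<exists>T. openin (top_of_set (vecs d)) T \<and> y \<in> T \<and> T \<subseteq> vecs d - polydisc d x \<epsilon>"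
    using openin_polydisc[OF assms] polydisc_center[of y d \<epsilon>] y assms
    by (intro exI[of _ "polydisc d y \<epsilon>"]) auto
qed

locale compact_analytic_group = isometric_embedding \<iota>
  for \<iota> :: "'l::nonarch_field \<Rightarrow> 'k::{nonarch_field, complete_space}" +
  fixes G :: "('h, 'b) monoid_scheme" (structure) and M :: "('h, 'l) manifold"
  assumes analytic: "analytic_group G M" and compact: "compact_space (mtop M)"
    and nontrivial: "\<exists>\<pi>::'k. \<pi> \<noteq> 0 \<and> absv \<pi> < 1"
begin

abbreviation X :: "'h topology" where "X \<equiv> mtop M"
abbreviation d :: nat where "d \<equiv> mdim M"

lemma M: "locally_analytic_manifold M" and topspace: "topspace X = carrier G" and group: "group G"
  using analytic by (auto simp: analytic_group_def)

lemma chart: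
  assumes "(U, \<phi>) \<in> atlas M"
  shows "openin X U" "U \<subseteq> carrier G" "openin (top_of_set (vecs d)) (\<phi> ` U)"
    "homeomorphic_map (subtopology X U) (top_of_set (\<phi> ` U)) \<phi>" "inj_on \<phi> U" "\<phi> ` U \<subseteq> vecs d"
proof -
  have c: "is_chart X d U \<phi>" using M assms unfolding locally_analytic_manifold_def by blast
  then show 1: "openin X U" and 2: "openin (top_of_set (vecs d)) (\<phi> ` U)"
    and 3: "homeomorphic_map (subtopology X U) (top_of_set (\<phi> ` U)) \<phi>"
    by (auto simp: is_chart_def)
  show 4: "U \<subseteq> carrier G" using openin_subset[OF 1] topspace by simp
  have "topspace (subtopology X U) = U" using 4 topspace by auto
  then show "inj_on \<phi> U" using homeomorphic_imp_injective_map[OF 3] by simp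
  show "\<phi> ` U \<subseteq> vecs d" using openin_subset[OF 2] by simp
qed

lemma chart_at:
  assumes "g \<in> carrier G"
  obtains U \<phi> where "(U, \<phi>) \<in> atlas M" "g \<in> U"
proof -
  have "(\<Union>(U, \<phi>) \<in> atlas M. U) = carrier G"
    using M unfolding locally_analytic_manifold_def topspace by blast
  then have "g \<in> (\<Union>(U, \<phi>) \<in> atlas M. U)" using assms by simp
  then show thesis using that by auto
qed

lemma inv_chart [simp]: "(U, \<phi>) \<in> atlas M \<Longrightarrow> x \<in> U \<Longrightarrow> inv_into U \<phi> (\<phi> x) = x"
  by (simp add: chart(5) inv_into_f_f)

lemma chart_preimage_open:
  assumes c: "(U, \<phi>) \<in> atlas M" and T: "openin (top_of_set (vecs d)) T"
  shows "openin X {x \<in> U. \<phi> x \<in> T}"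
proof -
  have "continuous_map (subtopology X U) (top_of_set (\<phi> ` U)) \<phi>"
    using chart(4)[OF c] homeomorphic_imp_continuous_map by blast
  moreover obtain S where "open S" "T = vecs d \<inter> S" using T by (auto simp: openin_open)
  then have "openin (top_of_set (\<phi> ` U)) (\<phi> ` U \<inter> T)"
    using chart(6)[OF c] by (auto simp: openin_open)
  ultimately have "openin (subtopology X U) {x \<in> topspace (subtopology X U). \<phi> x \<in> \<phi> ` U \<inter> T}"
    by (rule openin_continuous_map_preimage)
  moreover have "{x \<in> topspace (subtopology X U). \<phi> x \<in> \<phi> ` U \<inter> T} = {x \<in> U. \<phi> x \<in> T}"
    using chart(2)[OF c] topspace by auto
  ultimately show ?thesis using openin_open_subtopology[OF chart(1)[OF c]] by simp
qed

lemma chart_image_open: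
  assumes c: "(U, \<phi>) \<in> atlas M" and V: "openin X V" "V \<subseteq> U"
  shows "openin (top_of_set (vecs d)) (\<phi> ` V)"
proof -
  have "open_map (subtopology X U) (top_of_set (\<phi> ` U)) \<phi>"
    using chart(4)[OF c] homeomorphic_imp_open_map by blast
  moreover have "openin (subtopology X U) V"
    using V chart(1)[OF c] openin_open_subtopology by blast
  ultimately have "openin (top_of_set (\<phi> ` U)) (\<phi> ` V)" by (simp add: open_map_def)
  then show ?thesis using chart(3)[OF c] openin_trans by blast
qed

lemma chart_polydisc:
  assumes c: "(U, \<phi>) \<in> atlas M" and V: "openin X V" and x: "x \<in> U" "x \<in> V"
  obtains \<epsilon> where "0 < \<epsilon>" "polydisc d (\<phi> x) \<epsilon> \<subseteq> \<phi> ` (U \<inter> V)"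
proof -
  have "openin (top_of_set (vecs d)) (\<phi> ` (U \<inter> V))"
    using chart_image_open[OF c] chart(1)[OF c] V by (simp add: openin_Int)
  then show thesis using polydisc_nbhd[of d "\<phi> ` (U \<inter> V)" "\<phi> x"] x that by auto
qed

text \<open>
  Small polydiscs around the identity are clopen in the chart domain. They are closed in the whole
  group once they lie in a closed set inside the chart domain, which exists because a compact Hausdorff
  space is regular.
\<close>

lemma clopen_basis_one:
  assumes O: "openin X O'" "\<one> \<in> O'"
  shows "\<exists>W. openin X W \<and> closedin X W \<and> \<one> \<in> W \<and> W \<subseteq> O'"
proof -
  have one: "\<one> \<in> carrier G" using group by (simp add: group.is_monoid)
  obtain U \<phi> where c: "(U, \<phi>) \<in> atlas M" "\<one> \<in> U" using chart_at[OF one] .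
  have "Hausdorff_space X" using M by (simp add: locally_analytic_manifold_def)
  then have "regular_space X" by (intro compact_Hausdorff_imp_regular_space compact disjI1) simp_all
  moreover have "openin X (U \<inter> O')" "\<one> \<in> U \<inter> O'" using O c chart(1)[OF c(1)] by (auto simp: openin_Int)
  ultimately obtain N C where N: "openin X N" "closedin X C" "\<one> \<in> N" "N \<subseteq> C" "C \<subseteq> U \<inter> O'"
    unfolding neighbourhood_base_of_closedin[symmetric] neighbourhood_base_of by metis
  obtain \<epsilon> where \<epsilon>: "0 < \<epsilon>" "polydisc d (\<phi> \<one>) \<epsilon> \<subseteq> \<phi> ` (U \<inter> N)"
    using chart_polydisc[OF c(1) N(1) c(2) N(3)] .
  define W where "W = {x \<in> U. \<phi> x \<in> polydisc d (\<phi> \<one>) \<epsilon>}"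
  have WN: "W \<subseteq> N"
  proof
    fix x assume "x \<in> W"
    then have x: "x \<in> U" "\<phi> x \<in> \<phi> ` (U \<inter> N)" using \<epsilon>(2) by (auto simp: W_def)
    then obtain y where "y \<in> U \<inter> N" "\<phi> x = \<phi> y" by blast
    then show "x \<in> N" using x(1) chart(5)[OF c(1)] by (auto dest: inj_onD)
  qed
  have open_W: "openin X W" unfolding W_def by (rule chart_preimage_open[OF c(1) openin_polydisc[OF \<epsilon>(1)]])
  (* Outside the chart domain only the closed set C can certify that a point is away from W. *)
  have "topspace X - W = (topspace X - C) \<union> {x \<in> U. \<phi> x \<in> vecs d - polydisc d (\<phi> \<one>) \<epsilon>}"
  proof (intro equalityI subsetI)
    fix x assume "x \<in> topspace X - W"
    then show "x \<in> (topspace X - C) \<union> {x \<in> U. \<phi> x \<in> vecs d - polydisc d (\<phi> \<one>) \<epsilon>}"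
      using N(5) chart(6)[OF c(1)] by (auto simp: W_def)
  next
    fix x assume "x \<in> (topspace X - C) \<union> {x \<in> U. \<phi> x \<in> vecs d - polydisc d (\<phi> \<one>) \<epsilon>}"
    then show "x \<in> topspace X - W"
      using WN N(4) chart(2)[OF c(1)] topspace by (auto simp: W_def)
  qed
  moreover have "openin X (topspace X - C)" using N(2) by blast
  moreover have "openin X {x \<in> U. \<phi> x \<in> vecs d - polydisc d (\<phi> \<one>) \<epsilon>}"
    by (rule chart_preimage_open[OF c(1) openin_polydisc_complement[OF \<epsilon>(1)]])
  ultimately have "openin X (topspace X - W)" by auto
  then have "closedin X W" using openin_subset[OF open_W] by (simp add: closedin_def)
  moreover have "\<phi> \<one> \<in> vecs d" using chart(6)[OF c(1)] c(2) by blast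
  then have "\<one> \<in> W" using c(2) \<epsilon>(1) by (simp add: W_def polydisc_center)
  ultimately show ?thesis using open_W WN N(4,5) by blast
qed

sublocale profinite_group G X
proof -
  interpret group G by (rule group)
  show "profinite_group G X"
  proof
    show "topspace X = carrier G" by (rule topspace)
    have "locally_analytic_map (prod_manifold M M) M (\<lambda>(x, y). x \<otimes> y)"
      using analytic by (simp add: analytic_group_def)
    then show "continuous_map (prod_topology X X) X (\<lambda>(x, y). x \<otimes> y)"
      by (simp add: locally_analytic_map_def prod_manifold_def)
    have "locally_analytic_map M M (\<lambda>x. inv x)" using analytic by (simp add: analytic_group_def)
    then show "continuous_map X X (\<lambda>x. inv x)" by (simp add: locally_analytic_map_def)
  qed (use compact clopen_basis_one in auto)
qed

text \<open>
  This is where the maximality of the atlas enters.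
\<close>

lemma atlas_restrict:
  assumes c: "(U, \<phi>) \<in> atlas M" and V: "openin X V" "V \<subseteq> U"
  shows "(V, \<phi>) \<in> atlas M"
proof -
  have "is_chart X d V \<phi>"
    unfolding is_chart_def
  proof (intro conjI)
    have "\<phi> ` (topspace (subtopology X U) \<inter> V) = topspace (top_of_set (\<phi> ` U)) \<inter> \<phi> ` V"
      using V chart(2)[OF c] topspace by auto
    from homeomorphic_map_subtopologies[OF chart(4)[OF c] this]
    show "homeomorphic_map (subtopology X V) (top_of_set (\<phi> ` V)) \<phi>"
      using V(2) by (simp add: subtopology_subtopology Int_absorb1 image_mono)
  qed (use V chart_image_open[OF c] in auto)
  moreover have "compatible_charts d V \<phi> V' \<psi>" if c': "(V', \<psi>) \<in> atlas M" for V' \<psi>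
  proof -
    have comp: "compatible_charts d U \<phi> V' \<psi>"
      using M c c' unfolding locally_analytic_manifold_def by blast
    have VV': "openin X (V \<inter> V')" using V(1) chart(1)[OF c'] by (rule openin_Int)
    have "locally_analytic_on (\<lambda>z. z) d (\<phi> ` (V \<inter> V')) (\<lambda>y. (\<psi> \<circ> inv_into V \<phi>) y j)" if j: "j < d" for j
    proof (rule locally_analytic_on_restrict)
      show "locally_analytic_on (\<lambda>z. z) d (\<phi> ` (U \<inter> V')) (\<lambda>y. (\<psi> \<circ> inv_into U \<phi>) y j)"
        using comp j unfolding compatible_charts_def locally_analytic_map_on_def by blast
      show "openin (top_of_set (vecs d)) (\<phi> ` (V \<inter> V'))"
        using V by (intro chart_image_open[OF c VV']) auto
      show "(\<psi> \<circ> inv_into U \<phi>) y j = (\<psi> \<circ> inv_into V \<phi>) y j" if "y \<in> \<phi> ` (V \<inter> V')" for y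
      proof -
        obtain x where x: "x \<in> V" "y = \<phi> x" using \<open>y \<in> \<phi> ` (V \<inter> V')\<close> by blast
        moreover have "inj_on \<phi> V" using chart(5)[OF c] V(2) inj_on_subset by blast
        ultimately show ?thesis using V(2) c by (simp add: subset_iff)
      qed
    qed (use V in auto)
    moreover have "locally_analytic_on (\<lambda>z. z) d (\<psi> ` (V \<inter> V')) (\<lambda>y. (\<phi> \<circ> inv_into V' \<psi>) y j)" if j: "j < d" for j
    proof (rule locally_analytic_on_restrict)
      show "locally_analytic_on (\<lambda>z. z) d (\<psi> ` (U \<inter> V')) (\<lambda>y. (\<phi> \<circ> inv_into V' \<psi>) y j)"
        using comp j unfolding compatible_charts_def locally_analytic_map_on_def by blast
      show "openin (top_of_set (vecs d)) (\<psi> ` (V \<inter> V'))"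
        by (intro chart_image_open[OF c' VV']) auto
    qed (use V in auto)
    ultimately show ?thesis unfolding compatible_charts_def locally_analytic_map_on_def by blast
  qed
  ultimately show ?thesis using M unfolding locally_analytic_manifold_def by blast
qed

text \<open>
  Analyticity at a point does not depend on the chart, nor on whether the point is the centre of the
  given expansion.
\<close>

lemma expands_change_chart:
  assumes c: "(U, \<phi>) \<in> atlas M" and c': "(V, \<psi>) \<in> atlas M" and p: "p \<in> U" "p \<in> V" and \<epsilon>: "0 < \<epsilon>"
    and g: "expands_on \<iota> d z \<epsilon> a (\<lambda>y. g (inv_into U \<phi> y))"
    and z: "\<phi> p \<in> polydisc d z \<epsilon>"
  obtains \<epsilon>' where "0 < \<epsilon>'" "polydisc d (\<psi> p) \<epsilon>' \<subseteq> \<psi> ` V"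
    "\<exists>b. expands_on \<iota> d (\<psi> p) \<epsilon>' b (\<lambda>y. g (inv_into V \<psi> y))"
proof -
  have UV: "openin X (U \<inter> V)" using chart(1)[OF c] chart(1)[OF c'] by (rule openin_Int)
  obtain \<epsilon>0 where \<epsilon>0: "0 < \<epsilon>0" "polydisc d (\<psi> p) \<epsilon>0 \<subseteq> \<psi> ` (V \<inter> (U \<inter> V))"
    using chart_polydisc[OF c' UV p(2)] p by blast
  have comp: "compatible_charts d U \<phi> V \<psi>"
    using M c c' unfolding locally_analytic_manifold_def by blast
  let ?F = "\<lambda>y. \<phi> (inv_into V \<psi> y)"
  have px: "\<psi> p \<in> vecs d" using chart(6)[OF c'] p by blast
  have Fp: "?F (\<psi> p) \<in> polydisc d z \<epsilon>" using z p c' by simp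
  have F: "\<exists>b r. 0 < r \<and> expands_on (\<lambda>z. z) d (\<psi> p) r b (\<lambda>y. ?F y j)" if "j < d" for j
  proof -
    have "locally_analytic_on (\<lambda>z. z) d (\<psi> ` (U \<inter> V)) (\<lambda>y. (\<phi> \<circ> inv_into V \<psi>) y j)"
      using comp that unfolding compatible_charts_def locally_analytic_map_on_def by blast
    moreover have "\<psi> p \<in> \<psi> ` (U \<inter> V)" using p by blast
    ultimately show ?thesis unfolding locally_analytic_on_def o_def by blast
  qed
  have vecs: "?F y \<in> vecs d" if y: "y \<in> polydisc d (\<psi> p) \<epsilon>0" for y
  proof -
    obtain q where "q \<in> U \<inter> V" "y = \<psi> q" using \<epsilon>0(2) y by blast
    then show ?thesis using c' chart(6)[OF c] by auto
  qed
  obtain \<epsilon>' where \<epsilon>': "0 < \<epsilon>'" "\<epsilon>' \<le> \<epsilon>0"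
    "\<And>\<epsilon>''. 0 < \<epsilon>'' \<Longrightarrow> \<epsilon>'' \<le> \<epsilon>' \<Longrightarrow> \<exists>b. expands_on \<iota> d (\<psi> p) \<epsilon>'' b (\<lambda>y. g (inv_into U \<phi> (?F y)))"
    by (rule expands_on_compose_map[where F = ?F, OF g \<epsilon> \<epsilon>0(1) px Fp F vecs]) (assumption | rule that)+
  have sub: "polydisc d (\<psi> p) \<epsilon>' \<subseteq> \<psi> ` (V \<inter> (U \<inter> V))"
    using \<epsilon>0(2) polydisc_mono[OF \<epsilon>'(2)] by blast
  obtain b where b: "expands_on \<iota> d (\<psi> p) \<epsilon>' b (\<lambda>y. g (inv_into U \<phi> (?F y)))"
    using \<epsilon>'(3)[OF \<epsilon>'(1) order_refl] by blast
  have "expands_on \<iota> d (\<psi> p) \<epsilon>' b (\<lambda>y. g (inv_into V \<psi> y))"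
  proof (rule expands_on_cong[OF b])
    fix y assume "y \<in> polydisc d (\<psi> p) \<epsilon>'"
    then obtain q where "q \<in> U \<inter> V" "y = \<psi> q" using sub by blast
    then show "g (inv_into U \<phi> (?F y)) = g (inv_into V \<psi> y)" using c c' by simp
  qed
  then show thesis using sub by (intro that[OF \<epsilon>'(1)]) blast+
qed

text \<open>
  It suffices to expand \<open>f\<close> around each point in one chart, on a polydisc that contains the point.
\<close>

lemma CanI:
  assumes out: "\<And>x. x \<notin> carrier G \<Longrightarrow> f x = 0"
    and loc: "\<And>p. p \<in> carrier G \<Longrightarrow> \<exists>U \<phi> z \<epsilon> a. (U, \<phi>) \<in> atlas M \<and> p \<in> U \<and> 0 < \<epsilon> \<and>
      \<phi> p \<in> polydisc d z \<epsilon> \<and> expands_on \<iota> d z \<epsilon> a (\<lambda>y. f (inv_into U \<phi> y))"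
  shows "f \<in> Can \<iota> M"
proof -
  have "locally_analytic_on \<iota> d (\<psi> ` V) (f \<circ> inv_into V \<psi>)" if c': "(V, \<psi>) \<in> atlas M" for V \<psi>
    unfolding locally_analytic_on_def o_def
  proof
    fix x assume "x \<in> \<psi> ` V"
    then obtain p where p: "p \<in> V" "x = \<psi> p" by blast
    then have "p \<in> carrier G" using chart(2)[OF c'] by blast
    from loc[OF this] obtain U \<phi> z \<epsilon> a where U: "(U, \<phi>) \<in> atlas M" "p \<in> U" "0 < \<epsilon>"
      "\<phi> p \<in> polydisc d z \<epsilon>" "expands_on \<iota> d z \<epsilon> a (\<lambda>y. f (inv_into U \<phi> y))" by blast
    show "\<exists>\<epsilon>>0. polydisc d x \<epsilon> \<subseteq> \<psi> ` V \<and> (\<exists>b. expands_on \<iota> d x \<epsilon> b (\<lambda>y. f (inv_into V \<psi> y)))"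
      unfolding p(2)
      by (rule expands_change_chart[OF U(1) c' U(2) p(1) U(3,5,4)]) blast
  qed
  then show ?thesis using out by (auto simp: Can_def topspace)
qed

lemma Can_zero_outside: "f \<in> Can \<iota> M \<Longrightarrow> x \<notin> carrier G \<Longrightarrow> f x = 0"
  by (simp add: Can_def topspace)

lemma CanD:
  assumes f: "f \<in> Can \<iota> M" and c: "(U, \<phi>) \<in> atlas M" and V: "openin X V" and p: "p \<in> U" "p \<in> V"
  obtains \<epsilon> a where "0 < \<epsilon>" "polydisc d (\<phi> p) \<epsilon> \<subseteq> \<phi> ` (U \<inter> V)"
    "expands_on \<iota> d (\<phi> p) \<epsilon> a (\<lambda>y. f (inv_into U \<phi> y))"
proof -
  have "locally_analytic_on \<iota> d (\<phi> ` U) (f \<circ> inv_into U \<phi>)" using f c by (auto simp: Can_def)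
  then obtain \<epsilon> a where \<epsilon>: "0 < \<epsilon>" "expands_on \<iota> d (\<phi> p) \<epsilon> a (\<lambda>y. f (inv_into U \<phi> y))"
    using p unfolding locally_analytic_on_def o_def by blast
  obtain \<epsilon>' where \<epsilon>': "0 < \<epsilon>'" "polydisc d (\<phi> p) \<epsilon>' \<subseteq> \<phi> ` (U \<inter> V)"
    using chart_polydisc[OF c V p] .
  show thesis
  proof (rule that[of "min \<epsilon> \<epsilon>'"])
    show "expands_on \<iota> d (\<phi> p) (min \<epsilon> \<epsilon>') a (\<lambda>y. f (inv_into U \<phi> y))"
      using \<epsilon> \<epsilon>' by (intro expands_on_mono[OF \<epsilon>(2)]) auto
    show "polydisc d (\<phi> p) (min \<epsilon> \<epsilon>') \<subseteq> \<phi> ` (U \<inter> V)"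
      using \<epsilon>'(2) polydisc_mono[of "min \<epsilon> \<epsilon>'" \<epsilon>' d "\<phi> p"] by auto
  qed (use \<epsilon> \<epsilon>' in auto)
qed

lemma chart_point_vecs: "(U, \<phi>) \<in> atlas M \<Longrightarrow> p \<in> U \<Longrightarrow> \<phi> p \<in> vecs d"
  using chart(6) by blast

lemma Can_add:
  assumes f: "f \<in> Can \<iota> M" and g: "g \<in> Can \<iota> M"
  shows "(\<lambda>x. f x + g x) \<in> Can \<iota> M"
proof (rule CanI)
  fix p assume p: "p \<in> carrier G"
  obtain U \<phi> where c: "(U, \<phi>) \<in> atlas M" "p \<in> U" using chart_at[OF p] .
  obtain \<epsilon> a where \<epsilon>: "0 < \<epsilon>" "expands_on \<iota> d (\<phi> p) \<epsilon> a (\<lambda>y. f (inv_into U \<phi> y))"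
    using CanD[OF f c(1) chart(1)[OF c(1)] c(2) c(2)] .
  obtain \<epsilon>' b where \<epsilon>': "0 < \<epsilon>'" "expands_on \<iota> d (\<phi> p) \<epsilon>' b (\<lambda>y. g (inv_into U \<phi> y))"
    using CanD[OF g c(1) chart(1)[OF c(1)] c(2) c(2)] .
  define r where "r = min \<epsilon> \<epsilon>'"
  have r: "0 < r" "r \<le> \<epsilon>" "r \<le> \<epsilon>'" using \<epsilon>(1) \<epsilon>'(1) by (auto simp: r_def)
  have f': "expands_on \<iota> d (\<phi> p) r a (\<lambda>y. f (inv_into U \<phi> y))"
    and g': "expands_on \<iota> d (\<phi> p) r b (\<lambda>y. g (inv_into U \<phi> y))"
    using r by (auto intro: expands_on_mono[OF \<epsilon>(2)] expands_on_mono[OF \<epsilon>'(2)])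
  obtain B where B: "expands_le \<iota> d (\<phi> p) r (\<lambda>y. f (inv_into U \<phi> y)) B"
    using expands_on_imp_expands_le[OF f'] .
  obtain B' where B': "expands_le \<iota> d (\<phi> p) r (\<lambda>y. g (inv_into U \<phi> y)) B'"
    using expands_on_imp_expands_le[OF g'] .
  have "expands_le \<iota> d (\<phi> p) r (\<lambda>y. f (inv_into U \<phi> y) + g (inv_into U \<phi> y)) (max B B')"
    by (intro expands_le_add r(1) expands_leI_le[OF B] expands_leI_le[OF B']) auto
  then obtain e where "expands_on \<iota> d (\<phi> p) r e (\<lambda>y. f (inv_into U \<phi> y) + g (inv_into U \<phi> y))"
    unfolding expands_le_def by blast
  moreover have "\<phi> p \<in> polydisc d (\<phi> p) r"
    using r chart_point_vecs[OF c] by (simp add: polydisc_center)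
  ultimately show "\<exists>U \<phi> z \<epsilon> a. (U, \<phi>) \<in> atlas M \<and> p \<in> U \<and> 0 < \<epsilon> \<and>
      \<phi> p \<in> polydisc d z \<epsilon> \<and> expands_on \<iota> d z \<epsilon> a (\<lambda>y. f (inv_into U \<phi> y) + g (inv_into U \<phi> y))"
    using c r(1) by blast
qed (simp add: Can_zero_outside[OF f] Can_zero_outside[OF g])

lemma Can_cmult:
  assumes f: "f \<in> Can \<iota> M"
  shows "(\<lambda>x. r * f x) \<in> Can \<iota> M"
proof (rule CanI)
  fix p assume p: "p \<in> carrier G"
  obtain U \<phi> where c: "(U, \<phi>) \<in> atlas M" "p \<in> U" using chart_at[OF p] .
  obtain \<epsilon> a where \<epsilon>: "0 < \<epsilon>" "expands_on \<iota> d (\<phi> p) \<epsilon> a (\<lambda>y. f (inv_into U \<phi> y))"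
    using CanD[OF f c(1) chart(1)[OF c(1)] c(2) c(2)] .
  obtain B where B: "expands_le \<iota> d (\<phi> p) \<epsilon> (\<lambda>y. f (inv_into U \<phi> y)) B"
    using expands_on_imp_expands_le[OF \<epsilon>(2)] .
  have "expands_le \<iota> d (\<phi> p) \<epsilon> (\<lambda>y. r * f (inv_into U \<phi> y)) (absv r * B)"
    using \<epsilon>(1) by (intro expands_le_cmult B) auto
  then obtain e where "expands_on \<iota> d (\<phi> p) \<epsilon> e (\<lambda>y. r * f (inv_into U \<phi> y))"
    unfolding expands_le_def by blast
  moreover have "\<phi> p \<in> polydisc d (\<phi> p) \<epsilon>"
    using \<epsilon> chart_point_vecs[OF c] by (simp add: polydisc_center)
  ultimately show "\<exists>U \<phi> z \<epsilon> a. (U, \<phi>) \<in> atlas M \<and> p \<in> U \<and> 0 < \<epsilon> \<and>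
      \<phi> p \<in> polydisc d z \<epsilon> \<and> expands_on \<iota> d z \<epsilon> a (\<lambda>y. r * f (inv_into U \<phi> y))"
    using c \<epsilon>(1) by blast
qed (simp add: Can_zero_outside[OF f])

lemma Can_const: "(\<lambda>x. if x \<in> carrier G then r else 0) \<in> Can \<iota> M"
proof (rule CanI)
  fix p assume p: "p \<in> carrier G"
  obtain U \<phi> where c: "(U, \<phi>) \<in> atlas M" "p \<in> U" using chart_at[OF p] .
  obtain \<epsilon> where \<epsilon>: "0 < \<epsilon>" "polydisc d (\<phi> p) \<epsilon> \<subseteq> \<phi> ` (U \<inter> U)"
    using chart_polydisc[OF c(1) chart(1)[OF c(1)] c(2) c(2)] .
  have "expands_le \<iota> d (\<phi> p) \<epsilon> (\<lambda>_. r) (absv r)" using \<epsilon>(1) by (intro expands_le_const) simp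
  then obtain a where "expands_on \<iota> d (\<phi> p) \<epsilon> a (\<lambda>_. r)" unfolding expands_le_def by blast
  then have "expands_on \<iota> d (\<phi> p) \<epsilon> a (\<lambda>y. if inv_into U \<phi> y \<in> carrier G then r else 0)"
  proof (rule expands_on_cong)
    fix y assume "y \<in> polydisc d (\<phi> p) \<epsilon>"
    then obtain q where "q \<in> U" "y = \<phi> q" using \<epsilon>(2) by blast
    then show "r = (if inv_into U \<phi> y \<in> carrier G then r else 0)" using c chart(2)[OF c(1)] by auto
  qed
  moreover have "\<phi> p \<in> polydisc d (\<phi> p) \<epsilon>"
    using \<epsilon> chart_point_vecs[OF c] by (simp add: polydisc_center)
  ultimately show "\<exists>U \<phi> z \<epsilon> a. (U, \<phi>) \<in> atlas M \<and> p \<in> U \<and> 0 < \<epsilon> \<and> \<phi> p \<in> polydisc d z \<epsilon> \<and>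
      expands_on \<iota> d z \<epsilon> a (\<lambda>y. if inv_into U \<phi> y \<in> carrier G then r else 0)"
    using c \<epsilon>(1) by blast
qed simp

lemma Can_zero: "(\<lambda>x. 0) \<in> Can \<iota> M"
  using Can_const[of 0] by simp

text \<open>
  An indicator function of a clopen set is locally constant.
\<close>

lemma Can_restrict:
  assumes f: "f \<in> Can \<iota> M" and W: "openin X W" "openin X (carrier G - W)"
  shows "(\<lambda>x. if x \<in> W then f x else 0) \<in> Can \<iota> M"
proof (rule CanI)
  fix p assume p: "p \<in> carrier G"
  obtain U \<phi> where c: "(U, \<phi>) \<in> atlas M" "p \<in> U" using chart_at[OF p] .
  define g where "g = (if p \<in> W then f else (\<lambda>x. 0))"
  define V where "V = (if p \<in> W then W else carrier G - W)"
  have V: "openin X V" "p \<in> V" using W p by (auto simp: V_def)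
  have "g \<in> Can \<iota> M" using f Can_zero by (simp add: g_def)
  then obtain \<epsilon> a where \<epsilon>: "0 < \<epsilon>" "polydisc d (\<phi> p) \<epsilon> \<subseteq> \<phi> ` (U \<inter> V)"
    "expands_on \<iota> d (\<phi> p) \<epsilon> a (\<lambda>y. g (inv_into U \<phi> y))"
    using CanD[OF _ c(1) V(1) c(2) V(2)] by blast
  have "expands_on \<iota> d (\<phi> p) \<epsilon> a (\<lambda>y. if inv_into U \<phi> y \<in> W then f (inv_into U \<phi> y) else 0)"
  proof (rule expands_on_cong[OF \<epsilon>(3)])
    fix y assume "y \<in> polydisc d (\<phi> p) \<epsilon>"
    then obtain q where "q \<in> U \<inter> V" "y = \<phi> q" using \<epsilon>(2) by blast
    then show "g (inv_into U \<phi> y) = (if inv_into U \<phi> y \<in> W then f (inv_into U \<phi> y) else 0)"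
      using c(1) by (auto simp: g_def V_def split: if_splits)
  qed
  moreover have "\<phi> p \<in> polydisc d (\<phi> p) \<epsilon>"
    using \<epsilon> chart_point_vecs[OF c] by (simp add: polydisc_center)
  ultimately show "\<exists>U \<phi> z \<epsilon> a. (U, \<phi>) \<in> atlas M \<and> p \<in> U \<and> 0 < \<epsilon> \<and> \<phi> p \<in> polydisc d z \<epsilon> \<and>
      expands_on \<iota> d z \<epsilon> a (\<lambda>y. if inv_into U \<phi> y \<in> W then f (inv_into U \<phi> y) else 0)"
    using c \<epsilon>(1) by blast
qed (simp add: Can_zero_outside[OF f])

lemma polydisc_covering_piece:
  assumes "polydisc_covering M I" "(U, \<phi>, x, \<epsilon>) \<in> I"
  shows "(U, \<phi>) \<in> atlas M" "x \<in> vecs d" "0 < \<epsilon>" "\<phi> ` U = polydisc d x \<epsilon>"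
proof -
  have "\<forall>(U, \<phi>, x, \<epsilon>) \<in> I. (U, \<phi>) \<in> atlas M \<and> x \<in> vecs d \<and> 0 < \<epsilon> \<and> \<phi> ` U = polydisc d x \<epsilon>"
    using assms(1) by (simp add: polydisc_covering_def)
  from bspec[OF this assms(2)] show "(U, \<phi>) \<in> atlas M" "x \<in> vecs d" "0 < \<epsilon>" "\<phi> ` U = polydisc d x \<epsilon>"
    by auto
qed

lemma Can_on_subset_Can:
  assumes I: "polydisc_covering M I" and f: "f \<in> Can_on \<iota> M I"
  shows "f \<in> Can \<iota> M"
proof (rule CanI)
  show "f x = 0" if "x \<notin> carrier G" for x using f that by (simp add: Can_on_def topspace)
  fix p assume p: "p \<in> carrier G"
  have "(\<Union>(U, \<phi>, x, \<epsilon>) \<in> I. U) = carrier G" using I by (simp add: polydisc_covering_def topspace)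
  with p have "p \<in> (\<Union>(U, \<phi>, x, \<epsilon>) \<in> I. U)" by simp
  then obtain U \<phi> x \<epsilon> where U: "(U, \<phi>, x, \<epsilon>) \<in> I" "p \<in> U" by auto
  then have piece: "(U, \<phi>) \<in> atlas M" "0 < \<epsilon>" "\<phi> ` U = polydisc d x \<epsilon>"
    using polydisc_covering_piece[OF I] by blast+
  then have "\<phi> p \<in> polydisc d x \<epsilon>" using U(2) by blast
  moreover obtain a where "expands_on \<iota> d x \<epsilon> a (\<lambda>y. f (inv_into U \<phi> y))"
    using f U unfolding Can_on_def o_def by blast
  ultimately show "\<exists>U \<phi> z \<epsilon> a. (U, \<phi>) \<in> atlas M \<and> p \<in> U \<and> 0 < \<epsilon> \<and> \<phi> p \<in> polydisc d z \<epsilon> \<and>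
      expands_on \<iota> d z \<epsilon> a (\<lambda>y. f (inv_into U \<phi> y))" using U(2) piece(1,2) by blast
qed

end


section \<open>Translates of analytic functions and coverings by polydiscs\<close>

context compact_analytic_group
begin

text \<open>
  Multiplication is analytic in the product chart, and composing it with the expansion of \<open>f\<close> at
  \<open>x0 \<otimes> y0\<close> gives one power series in both variables. The radius may be shrunk at will: it must
  later be the radius of a member of a covering of the group.
\<close>

lemma translate_joint_expansion:
  assumes f: "f \<in> Can \<iota> M" and c: "(U, \<phi>) \<in> atlas M" "x0 \<in> U" and c': "(V, \<psi>) \<in> atlas M" "y0 \<in> V"
  obtains \<epsilon>0 where "0 < \<epsilon>0" "polydisc d (\<phi> x0) \<epsilon>0 \<subseteq> \<phi> ` U" "polydisc d (\<psi> y0) \<epsilon>0 \<subseteq> \<psi> ` V"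
    "\<And>\<epsilon>. 0 < \<epsilon> \<Longrightarrow> \<epsilon> \<le> \<epsilon>0 \<Longrightarrow> \<exists>c h. expands_on \<iota> (d + d) (join d (\<phi> x0) (\<psi> y0)) \<epsilon> c h \<and>
      (\<forall>x\<in>U. \<forall>y\<in>V. \<phi> x \<in> polydisc d (\<phi> x0) \<epsilon> \<longrightarrow> \<psi> y \<in> polydisc d (\<psi> y0) \<epsilon> \<longrightarrow>
        h (join d (\<phi> x) (\<psi> y)) = f (x \<otimes> y))"
proof -
  have xy: "x0 \<in> carrier G" "y0 \<in> carrier G" using c c' chart(2) by blast+
  obtain W \<theta> where w: "(W, \<theta>) \<in> atlas M" "x0 \<otimes> y0 \<in> W" using chart_at[OF m_closed[OF xy]] .
  let ?P = "{p \<in> topspace (prod_topology X X). (\<lambda>(x, y). x \<otimes> y) p \<in> W}"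
  have P_open: "openin (prod_topology X X) ?P"
    using openin_continuous_map_preimage[OF cont_mult chart(1)[OF w(1)]] .
  have "(x0, y0) \<in> ?P" using xy w(2) by (simp add: topspace_X)
  from P_open[unfolded openin_prod_topology_alt, rule_format, OF this]
  obtain A B where AB: "openin X A" "openin X B" "x0 \<in> A" "y0 \<in> B" "A \<times> B \<subseteq> ?P"
    by (elim exE conjE) (rule that)
  obtain \<epsilon>1 where \<epsilon>1: "0 < \<epsilon>1" "polydisc d (\<phi> x0) \<epsilon>1 \<subseteq> \<phi> ` (U \<inter> A)"
    using chart_polydisc[OF c(1) AB(1) c(2) AB(3)] .
  obtain \<epsilon>2 where \<epsilon>2: "0 < \<epsilon>2" "polydisc d (\<psi> y0) \<epsilon>2 \<subseteq> \<psi> ` (V \<inter> B)"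
    using chart_polydisc[OF c'(1) AB(2) c'(2) AB(4)] .
  define \<epsilon>3 where "\<epsilon>3 = min \<epsilon>1 \<epsilon>2"
  have \<epsilon>3: "0 < \<epsilon>3" "polydisc d (\<phi> x0) \<epsilon>3 \<subseteq> \<phi> ` (U \<inter> A)" "polydisc d (\<psi> y0) \<epsilon>3 \<subseteq> \<psi> ` (V \<inter> B)"
    using \<epsilon>1 \<epsilon>2 polydisc_mono[of \<epsilon>3 \<epsilon>1 d "\<phi> x0"] polydisc_mono[of \<epsilon>3 \<epsilon>2 d "\<psi> y0"]
    by (auto simp: \<epsilon>3_def)
  define \<Phi> where "\<Phi> = (\<lambda>(x, y). join d (\<phi> x) (\<psi> y))"
  define F where "F w = \<theta> ((\<lambda>(x, y). x \<otimes> y) (inv_into (U \<times> V) \<Phi> w))" for w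
  have \<Phi>_atlas: "(U \<times> V, \<Phi>) \<in> atlas (prod_manifold M M)"
    using c(1) c'(1) unfolding prod_manifold_def \<Phi>_def join_def by auto
  have inj: "inj_on \<Phi> (U \<times> V)"
  proof (rule inj_onI, clarify)
    fix x y x' y' assume xy: "x \<in> U" "y \<in> V" "x' \<in> U" "y' \<in> V" and eq: "\<Phi> (x, y) = \<Phi> (x', y')"
    have v: "\<phi> x \<in> vecs d" "\<phi> x' \<in> vecs d" "\<psi> y \<in> vecs d" "\<psi> y' \<in> vecs d"
      using xy chart_point_vecs c c' by auto
    have "(\<phi> x, \<psi> y) = (\<phi> x', \<psi> y')"
      by (rule inj_onD[OF bij_betw_imp_inj_on[OF bij_join[of d]]]) (use eq v in \<open>auto simp: \<Phi>_def\<close>)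
    then show "x = x' \<and> y = y'" using xy inj_onD[OF chart(5)[OF c(1)]] inj_onD[OF chart(5)[OF c'(1)]] by auto
  qed
  have F_eq: "F (join d (\<phi> x) (\<psi> y)) = \<theta> (x \<otimes> y)" if "x \<in> U" "y \<in> V" for x y
  proof -
    have "inv_into (U \<times> V) \<Phi> (\<Phi> (x, y)) = (x, y)" using inj that by (intro inv_into_f_f) auto
    then show ?thesis by (simp add: F_def \<Phi>_def)
  qed
  obtain \<rho> a where \<rho>: "0 < \<rho>" "expands_on \<iota> d (\<theta> (x0 \<otimes> y0)) \<rho> a (\<lambda>z. f (inv_into W \<theta> z))"
    using CanD[OF f w(1) chart(1)[OF w(1)] w(2) w(2)] .
  have x: "join d (\<phi> x0) (\<psi> y0) \<in> vecs (d + d)"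
    using chart_point_vecs[OF c] chart_point_vecs[OF c'] by (auto simp: vecs_def join_def)
  have Fx: "F (join d (\<phi> x0) (\<psi> y0)) \<in> polydisc d (\<theta> (x0 \<otimes> y0)) \<rho>"
    using F_eq[OF c(2) c'(2)] chart_point_vecs[OF w] \<rho>(1) by (simp add: polydisc_center)
  have Fan: "\<exists>b r. 0 < r \<and> expands_on (\<lambda>z. z) (d + d) (join d (\<phi> x0) (\<psi> y0)) r b (\<lambda>w. F w j)" if j: "j < d" for j
  proof -
    have "locally_analytic_map (prod_manifold M M) M (\<lambda>(x, y). x \<otimes> y)"
      using analytic by (simp add: analytic_group_def)
    then have "\<forall>(U, \<phi>) \<in> atlas (prod_manifold M M). \<forall>(V, \<psi>) \<in> atlas M.
      locally_analytic_map_on (mdim (prod_manifold M M)) d (\<phi> ` (U \<inter> (\<lambda>(x, y). x \<otimes> y) -` V))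
        (\<psi> \<circ> (\<lambda>(x, y). x \<otimes> y) \<circ> inv_into U \<phi>)"
      by (simp add: locally_analytic_map_def)
    from bspec[OF this \<Phi>_atlas, simplified, THEN bspec, OF w(1), simplified]
    have "locally_analytic_map_on (d + d) d (\<Phi> ` (U \<times> V \<inter> (\<lambda>(x, y). x \<otimes> y) -` W))
        (\<theta> \<circ> (\<lambda>(x, y). x \<otimes> y) \<circ> inv_into (U \<times> V) \<Phi>)"
      by (simp add: prod_manifold_def)
    then have "locally_analytic_on (\<lambda>z. z) (d + d) (\<Phi> ` (U \<times> V \<inter> (\<lambda>(x, y). x \<otimes> y) -` W)) (\<lambda>w. F w j)"
      using j unfolding locally_analytic_map_on_def F_def o_def by blast
    moreover have "join d (\<phi> x0) (\<psi> y0) \<in> \<Phi> ` (U \<times> V \<inter> (\<lambda>(x, y). x \<otimes> y) -` W)"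
      using c(2) c'(2) w(2) by (intro image_eqI[of _ _ "(x0, y0)"]) (auto simp: \<Phi>_def)
    ultimately show ?thesis unfolding locally_analytic_on_def by blast
  qed
  have F_vecs: "F w' \<in> vecs d" if w': "w' \<in> polydisc (d + d) (join d (\<phi> x0) (\<psi> y0)) \<epsilon>3" for w'
  proof -
    obtain u v where uv: "w' = join d u v" "u \<in> polydisc d (\<phi> x0) \<epsilon>3" "v \<in> polydisc d (\<psi> y0) \<epsilon>3"
      using polydisc_joinE[OF w'] .
    obtain x where x: "x \<in> U \<inter> A" "u = \<phi> x" using uv(2) \<epsilon>3(2) by blast
    obtain y where y: "y \<in> V \<inter> B" "v = \<psi> y" using uv(3) \<epsilon>3(3) by blast
    have "(x, y) \<in> ?P" using AB(5) x y by blast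
    then have "x \<otimes> y \<in> W" by simp
    then show ?thesis using x y F_eq[of x y] chart_point_vecs[OF w(1)] by (simp add: uv(1))
  qed
  obtain \<epsilon>4 where \<epsilon>4: "0 < \<epsilon>4" "\<epsilon>4 \<le> \<epsilon>3"
    "\<And>\<epsilon>. 0 < \<epsilon> \<Longrightarrow> \<epsilon> \<le> \<epsilon>4 \<Longrightarrow> \<exists>b. expands_on \<iota> (d + d) (join d (\<phi> x0) (\<psi> y0)) \<epsilon> b (\<lambda>w. f (inv_into W \<theta> (F w)))"
    by (rule expands_on_compose_map[where F = F, OF \<rho>(2,1) \<epsilon>3(1) x Fx Fan F_vecs]) (assumption | rule that)+
  have val: "f (inv_into W \<theta> (F (join d (\<phi> x) (\<psi> y)))) = f (x \<otimes> y)"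
    if x: "x \<in> U" "\<phi> x \<in> polydisc d (\<phi> x0) \<epsilon>4" and y: "y \<in> V" "\<psi> y \<in> polydisc d (\<psi> y0) \<epsilon>4" for x y
  proof -
    have "\<phi> x \<in> \<phi> ` (U \<inter> A)" "\<psi> y \<in> \<psi> ` (V \<inter> B)"
      using x y \<epsilon>3(2,3) polydisc_mono[OF \<epsilon>4(2)] by blast+
    then obtain x' y' where "x' \<in> U \<inter> A" "\<phi> x = \<phi> x'" "y' \<in> V \<inter> B" "\<psi> y = \<psi> y'" by auto
    then have "x \<in> A" "y \<in> B"
      using x(1) y(1) inj_onD[OF chart(5)[OF c(1)], of x x'] inj_onD[OF chart(5)[OF c'(1)], of y y'] by auto
    then have "(x, y) \<in> ?P" using AB(5) by blast
    then have "x \<otimes> y \<in> W" by simp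
    then show ?thesis using F_eq[OF x(1) y(1)] w(1) by simp
  qed
  show thesis
  proof (rule that[OF \<epsilon>4(1)])
    show "polydisc d (\<phi> x0) \<epsilon>4 \<subseteq> \<phi> ` U" "polydisc d (\<psi> y0) \<epsilon>4 \<subseteq> \<psi> ` V"
      using \<epsilon>3(2,3) polydisc_mono[OF \<epsilon>4(2)] by blast+
    fix \<epsilon> assume \<epsilon>: "0 < \<epsilon>" "\<epsilon> \<le> \<epsilon>4"
    obtain b where b: "expands_on \<iota> (d + d) (join d (\<phi> x0) (\<psi> y0)) \<epsilon> b (\<lambda>w. f (inv_into W \<theta> (F w)))"
      using \<epsilon>4(3)[OF \<epsilon>] by blast
    have "\<forall>x\<in>U. \<forall>y\<in>V. \<phi> x \<in> polydisc d (\<phi> x0) \<epsilon> \<longrightarrow> \<psi> y \<in> polydisc d (\<psi> y0) \<epsilon> \<longrightarrow>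
        f (inv_into W \<theta> (F (join d (\<phi> x) (\<psi> y)))) = f (x \<otimes> y)"
      using val polydisc_mono[OF \<epsilon>(2)] by blast
    with b show "\<exists>c h. expands_on \<iota> (d + d) (join d (\<phi> x0) (\<psi> y0)) \<epsilon> c h \<and>
      (\<forall>x\<in>U. \<forall>y\<in>V. \<phi> x \<in> polydisc d (\<phi> x0) \<epsilon> \<longrightarrow> \<psi> y \<in> polydisc d (\<psi> y0) \<epsilon> \<longrightarrow>
        h (join d (\<phi> x) (\<psi> y)) = f (x \<otimes> y))" by blast
  qed
qed

definition translate :: "('h \<Rightarrow> 'k) \<Rightarrow> 'h \<Rightarrow> 'h \<Rightarrow> 'k" where
  "translate f x = (\<lambda>y. if y \<in> carrier G then f (x \<otimes> y) else 0)"

lemma translate_Can: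
  assumes f: "f \<in> Can \<iota> M" and g: "g \<in> carrier G"
  shows "translate f g \<in> Can \<iota> M"
proof (rule CanI)
  show "translate f g x = 0" if "x \<notin> carrier G" for x using that by (simp add: translate_def)
  fix p assume p: "p \<in> carrier G"
  obtain U \<phi> where c: "(U, \<phi>) \<in> atlas M" "g \<in> U" using chart_at[OF g] .
  obtain V \<psi> where c': "(V, \<psi>) \<in> atlas M" "p \<in> V" using chart_at[OF p] .
  obtain \<epsilon> where \<epsilon>: "0 < \<epsilon>" "polydisc d (\<psi> p) \<epsilon> \<subseteq> \<psi> ` V"
    and "\<exists>b h. expands_on \<iota> (d + d) (join d (\<phi> g) (\<psi> p)) \<epsilon> b h \<and>
      (\<forall>x\<in>U. \<forall>y\<in>V. \<phi> x \<in> polydisc d (\<phi> g) \<epsilon> \<longrightarrow> \<psi> y \<in> polydisc d (\<psi> p) \<epsilon> \<longrightarrow>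
        h (join d (\<phi> x) (\<psi> y)) = f (x \<otimes> y))"
    using translate_joint_expansion[OF f c c'] by (metis order_refl)
  then obtain b h where b: "expands_on \<iota> (d + d) (join d (\<phi> g) (\<psi> p)) \<epsilon> b h"
    and h: "\<And>x y. x \<in> U \<Longrightarrow> y \<in> V \<Longrightarrow> \<phi> x \<in> polydisc d (\<phi> g) \<epsilon> \<Longrightarrow> \<psi> y \<in> polydisc d (\<psi> p) \<epsilon> \<Longrightarrow>
        h (join d (\<phi> x) (\<psi> y)) = f (x \<otimes> y)" by blast
  have gc: "\<phi> g \<in> polydisc d (\<phi> g) \<epsilon>" "\<psi> p \<in> polydisc d (\<psi> p) \<epsilon>"
    using \<epsilon>(1) chart_point_vecs[OF c] chart_point_vecs[OF c'] by (simp_all add: polydisc_center)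
  have "expands_on \<iota> d (\<psi> p) \<epsilon> (\<lambda>\<beta>. b (join d (\<lambda>_. 0) \<beta>)) (\<lambda>v. h (join d (\<phi> g) v))"
    using expands_on_slice[OF b chart_point_vecs[OF c]] \<epsilon>(1) by simp
  then have "expands_on \<iota> d (\<psi> p) \<epsilon> (\<lambda>\<beta>. b (join d (\<lambda>_. 0) \<beta>)) (\<lambda>y. translate f g (inv_into V \<psi> y))"
  proof (rule expands_on_cong)
    fix y assume y: "y \<in> polydisc d (\<psi> p) \<epsilon>"
    then obtain q where q: "q \<in> V" "y = \<psi> q" using \<epsilon>(2) by blast
    then show "h (join d (\<phi> g) y) = translate f g (inv_into V \<psi> y)"
      using h[OF c(2) q(1) gc(1)] y c'(1) chart(2)[OF c'(1)] by (auto simp: translate_def)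
  qed
  then show "\<exists>U \<phi> z \<epsilon> a. (U, \<phi>) \<in> atlas M \<and> p \<in> U \<and> 0 < \<epsilon> \<and> \<phi> p \<in> polydisc d z \<epsilon> \<and>
      expands_on \<iota> d z \<epsilon> a (\<lambda>y. translate f g (inv_into U \<phi> y))"
    using c' \<epsilon>(1) gc(2) by blast
qed

text \<open>
  A polydisc of radius \<open>r\<close> is a polydisc around each of its points, so finitely many radii coming from
  a finite subcover have a common lower bound that works everywhere.
\<close>

lemma uniform_polydisc_radius:
  assumes c: "(U, \<phi>) \<in> atlas M" and C: "compactin X C" "openin X C" "C \<subseteq> U"
  obtains r where "0 < r" "\<And>y r'. y \<in> C \<Longrightarrow> r' \<le> r \<Longrightarrow> polydisc d (\<phi> y) r' \<subseteq> \<phi> ` C"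
proof -
  have "\<exists>r>0. polydisc d (\<phi> y) r \<subseteq> \<phi> ` C" if y: "y \<in> C" for y
  proof -
    obtain r where "0 < r" "polydisc d (\<phi> y) r \<subseteq> \<phi> ` (U \<inter> C)"
      using chart_polydisc[OF c C(2), of y] y C(3) by blast
    then show ?thesis by blast
  qed
  then obtain r where r: "\<And>y. y \<in> C \<Longrightarrow> 0 < r y" "\<And>y. y \<in> C \<Longrightarrow> polydisc d (\<phi> y) (r y) \<subseteq> \<phi> ` C" by metis
  let ?B = "\<lambda>y. {x \<in> U. \<phi> x \<in> polydisc d (\<phi> y) (r y)}"
  have "\<exists>\<F>. finite \<F> \<and> \<F> \<subseteq> ?B ` C \<and> C \<subseteq> \<Union>\<F>"
  proof (rule C(1)[unfolded compactin_def, THEN conjunct2, rule_format], intro conjI ballI)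
    show "openin X B" if "B \<in> ?B ` C" for B
      using that r(1) chart_preimage_open[OF c openin_polydisc] by auto
    show "C \<subseteq> \<Union> (?B ` C)"
    proof
      fix y assume y: "y \<in> C"
      then have "\<phi> y \<in> polydisc d (\<phi> y) (r y)"
        using C(3) r(1)[OF y] chart_point_vecs[OF c] by (intro polydisc_center) auto
      then show "y \<in> \<Union> (?B ` C)" using y C(3) by blast
    qed
  qed
  then obtain \<F> where \<F>: "finite \<F>" "\<F> \<subseteq> ?B ` C" "C \<subseteq> \<Union>\<F>" by blast
  from finite_subset_image[OF \<F>(1,2)] obtain T where T: "T \<subseteq> C" "finite T" "\<F> = ?B ` T" by blast
  define r0 where "r0 = Min (insert 1 (r ` T))"
  show thesis
  proof (rule that[of r0])
    show "0 < r0" using T r(1) by (auto simp: r0_def)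
    fix y r' assume y: "y \<in> C" and r': "r' \<le> r0"
    then obtain t where t: "t \<in> T" "\<phi> y \<in> polydisc d (\<phi> t) (r t)" using \<F>(3) T(3) by blast
    then have "r0 \<le> r t" using T(2) by (auto simp: r0_def)
    then have "polydisc d (\<phi> y) r' \<subseteq> polydisc d (\<phi> y) (r t)" using r' by (intro polydisc_mono) simp
    also have "\<dots> = polydisc d (\<phi> t) (r t)" by (rule polydisc_recenter[OF t(2)])
    also have "\<dots> \<subseteq> \<phi> ` C" using t T r(2) by blast
    finally show "polydisc d (\<phi> y) r' \<subseteq> \<phi> ` C" .
  qed
qed

lemma compactin_r_coset:
  assumes N: "N \<in> ONS" and g: "g \<in> carrier G"
  shows "compactin X (N #> g)" and "openin X (carrier G - (N #> g))"
proof -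
  have "carrier G - (N #> g) = \<Union> {N #> h | h. h \<in> carrier G - (N #> g)}"
  proof (intro equalityI subsetI)
    fix x assume "x \<in> carrier G - (N #> g)"
    then show "x \<in> \<Union> {N #> h | h. h \<in> carrier G - (N #> g)}" using mem_r_coset_self[OF N] by blast
  next
    fix x assume "x \<in> \<Union> {N #> h | h. h \<in> carrier G - (N #> g)}"
    then obtain h where h: "h \<in> carrier G" "h \<notin> N #> g" "x \<in> N #> h" by blast
    then have xc: "x \<in> carrier G" using r_coset_subset_carrier[OF N] by blast
    have "x \<notin> N #> g"
    proof
      assume "x \<in> N #> g"
      then have "N #> h = N #> g" using r_coset_eq[OF N g] r_coset_eq[OF N h(1) h(3)] by simp
      then show False using h mem_r_coset_self[OF N h(1)] by simp
    qed
    with xc show "x \<in> carrier G - (N #> g)" by blast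
  qed
  moreover have "openin X (\<Union> {N #> h | h. h \<in> carrier G - (N #> g)})"
    using openin_ONS_r_coset[OF N] by (intro openin_Union) auto
  ultimately show op: "openin X (carrier G - (N #> g))" by (simp only:)
  have "closedin X (N #> g)"
    using op r_coset_subset_carrier[OF N g] by (simp add: closedin_def topspace_X)
  then show "compactin X (N #> g)" using compact_X closedin_compact_space by blast
qed

text \<open>
  The topology on analytic functions tests continuity on coverings by disjoint chart polydiscs, so a
  covering is needed that contains an arbitrarily small polydisc around the identity in a given chart.
  The cosets of a small open normal subgroup lie in charts, and in its chart each coset is partitioned
  into polydiscs of one common radius.
\<close>

lemma polydisc_covering_exists:
  assumes c: "(V, \<psi>) \<in> atlas M" "\<one> \<in> V" and \<epsilon>: "0 < \<epsilon>"
  obtains I D r where "polydisc_covering M I" "(D, \<psi>, \<psi> \<one>, r) \<in> I" "\<one> \<in> D" "D \<subseteq> V" "0 < r" "r \<le> \<epsilon>"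
proof -
  have "\<exists>U \<phi>. (U, \<phi>) \<in> atlas M \<and> g \<in> U" if "g \<in> carrier G" for g
    by (rule chart_at[OF that]) blast
  then obtain U0 \<phi>0 where U0: "\<And>g. g \<in> carrier G \<Longrightarrow> (U0 g, \<phi>0 g) \<in> atlas M" "\<And>g. g \<in> carrier G \<Longrightarrow> g \<in> U0 g"
    by metis
  obtain N1 where N1: "N1 \<in> ONS" "\<And>h. h \<in> carrier G \<Longrightarrow> \<exists>g\<in>carrier G. N1 #> h \<subseteq> U0 g"
    by (rule uniform_cosets[of U0, OF chart(1)[OF U0(1)] U0(2)]) (assumption | rule that)+
  obtain N2 where N2: "N2 \<in> ONS" "N2 \<subseteq> V" using ONS_basis[OF chart(1)[OF c(1)] c(2)] .
  define N where "N = N1 \<inter> N2"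
  have N: "N \<in> ONS" unfolding N_def by (rule ONS_Int[OF N1(1) N2(1)])
  have one_coset: "N #> \<one> = N" using ONS_subgroup[OF N] subgroup.subset by (metis coset_mult_one)
  have "\<exists>U \<phi> r. (U, \<phi>) \<in> atlas M \<and> N #> g \<subseteq> U \<and> 0 < r \<and>
      (\<forall>y\<in>N #> g. polydisc d (\<phi> y) r \<subseteq> \<phi> ` (N #> g)) \<and> (\<one> \<in> N #> g \<longrightarrow> U = V \<and> \<phi> = \<psi> \<and> r \<le> \<epsilon>)"
    if g: "g \<in> carrier G" for g
  proof -
    have "\<exists>U \<phi>. (U, \<phi>) \<in> atlas M \<and> N #> g \<subseteq> U \<and> (\<one> \<in> N #> g \<longrightarrow> U = V \<and> \<phi> = \<psi>)"
    proof (cases "\<one> \<in> N #> g")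
      case True
      then have "N #> g = N" using r_coset_eq[OF N g True] one_coset by simp
      then show ?thesis using c N2(2) by (auto simp: N_def)
    next
      case False
      obtain g' where "g' \<in> carrier G" "N1 #> g \<subseteq> U0 g'" using N1(2)[OF g] by blast
      moreover have "N #> g \<subseteq> N1 #> g" by (auto simp: N_def r_coset_def)
      ultimately show ?thesis using U0(1) False by blast
    qed
    then obtain U \<phi> where U: "(U, \<phi>) \<in> atlas M" "N #> g \<subseteq> U" "\<one> \<in> N #> g \<longrightarrow> U = V \<and> \<phi> = \<psi>" by blast
    obtain r where r: "0 < r" "\<And>y r'. y \<in> N #> g \<Longrightarrow> r' \<le> r \<Longrightarrow> polydisc d (\<phi> y) r' \<subseteq> \<phi> ` (N #> g)"
      using uniform_polydisc_radius[OF U(1) compactin_r_coset(1)[OF N g] openin_ONS_r_coset[OF N g] U(2)] by blast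
    show ?thesis
      using U r \<epsilon> by (intro exI[of _ U] exI[of _ \<phi>] exI[of _ "min r \<epsilon>"]) auto
  qed
  note ex = this
  (* A chart and a radius for each coset, the same for all its points, so that two of the polydiscs
     below are equal or disjoint. The coset of the identity gets the given chart. *)
  define good where "good C t \<longleftrightarrow> (case t of (U, \<phi>, r) \<Rightarrow> (U, \<phi>) \<in> atlas M \<and> C \<subseteq> U \<and> 0 < r \<and>
      (\<forall>y\<in>C. polydisc d (\<phi> y) r \<subseteq> \<phi> ` C) \<and> (\<one> \<in> C \<longrightarrow> U = V \<and> \<phi> = \<psi> \<and> r \<le> \<epsilon>))" for C t
  define t where "t C = (SOME t. good C t)" for C
  define U where "U C = fst (t C)" for C
  define \<phi> where "\<phi> C = fst (snd (t C))" for C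
  define r where "r C = snd (snd (t C))" for C
  have t: "(U C, \<phi> C) \<in> atlas M" "C \<subseteq> U C" "0 < r C" "\<And>y. y \<in> C \<Longrightarrow> polydisc d (\<phi> C y) (r C) \<subseteq> \<phi> C ` C"
    "\<one> \<in> C \<Longrightarrow> U C = V \<and> \<phi> C = \<psi> \<and> r C \<le> \<epsilon>" if "g \<in> carrier G" "C = N #> g" for C g
  proof -
    have "\<exists>t. good C t" using ex[OF that(1)] unfolding good_def that(2) by blast
    then have "good C (t C)" unfolding t_def by (rule someI_ex)
    then show "(U C, \<phi> C) \<in> atlas M" "C \<subseteq> U C" "0 < r C" "\<And>y. y \<in> C \<Longrightarrow> polydisc d (\<phi> C y) (r C) \<subseteq> \<phi> C ` C"
      "\<one> \<in> C \<Longrightarrow> U C = V \<and> \<phi> C = \<psi> \<and> r C \<le> \<epsilon>"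
      unfolding good_def U_def \<phi>_def r_def by (auto simp: case_prod_unfold)
  qed
  define P where "P g = {x \<in> N #> g. \<phi> (N #> g) x \<in> polydisc d (\<phi> (N #> g) g) (r (N #> g))}" for g
  have P_self: "g \<in> P g" if g: "g \<in> carrier G" for g
  proof -
    have "g \<in> U (N #> g)" using t(2)[OF g refl] mem_r_coset_self[OF N g] by blast
    then have "\<phi> (N #> g) g \<in> vecs d" using chart_point_vecs[OF t(1)[OF g refl]] by blast
    then show ?thesis
      using t(3)[OF g refl] mem_r_coset_self[OF N g] by (simp add: P_def polydisc_center)
  qed
  have P_eq: "P h = P g" if g: "g \<in> carrier G" and h: "h \<in> P g" for g h
  proof -
    have "N #> h = N #> g" using h r_coset_eq[OF N g] by (simp add: P_def)
    moreover have "polydisc d (\<phi> (N #> g) h) (r (N #> g)) = polydisc d (\<phi> (N #> g) g) (r (N #> g))"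
      using h by (intro polydisc_recenter) (simp add: P_def)
    ultimately show ?thesis by (simp add: P_def)
  qed
  have P_carrier: "P g \<subseteq> carrier G" if g: "g \<in> carrier G" for g
    using r_coset_subset_carrier[OF N g] by (auto simp: P_def)
  have P_open: "openin X (P g)" if g: "g \<in> carrier G" for g
  proof -
    have "P g = (N #> g) \<inter> {x \<in> U (N #> g). \<phi> (N #> g) x \<in> polydisc d (\<phi> (N #> g) g) (r (N #> g))}"
      using t(2)[OF g refl] by (auto simp: P_def)
    then show ?thesis
      using openin_ONS_r_coset[OF N g]
        chart_preimage_open[OF t(1)[OF g refl] openin_polydisc[OF t(3)[OF g refl]]] by (simp add: openin_Int)
  qed
  have P_image: "\<phi> (N #> g) ` P g = polydisc d (\<phi> (N #> g) g) (r (N #> g))" if g: "g \<in> carrier G" for g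
    using t(4)[OF g refl mem_r_coset_self[OF N g]] by (auto simp: P_def)
  (* A covering records one centre for each piece; the piece of the identity is centred at the identity. *)
  define rep where "rep Q = (if \<one> \<in> Q then \<one> else (SOME g. g \<in> Q))" for Q
  have rep: "rep (P g) \<in> P g" if "g \<in> carrier G" for g
    using P_self[OF that] unfolding rep_def by (metis someI)
  have rep': "rep (P g) \<in> carrier G" "P (rep (P g)) = P g" if "g \<in> carrier G" for g
    using rep[OF that] P_carrier[OF that] P_eq[OF that] by auto
  define piece where "piece Q = (Q, \<phi> (N #> rep Q), \<phi> (N #> rep Q) (rep Q), r (N #> rep Q))" for Q
  define I where "I = piece ` (P ` carrier G)"
  have cov: "polydisc_covering M I"
    unfolding polydisc_covering_def
  proof (intro conjI)
    have "(P g, \<phi> (N #> rep (P g))) \<in> atlas M \<and> \<phi> (N #> rep (P g)) (rep (P g)) \<in> vecs d \<and>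
        0 < r (N #> rep (P g)) \<and>
        \<phi> (N #> rep (P g)) ` P g = polydisc d (\<phi> (N #> rep (P g)) (rep (P g))) (r (N #> rep (P g)))"
      if g: "g \<in> carrier G" for g
    proof -
      define h where "h = rep (P g)"
      have h: "h \<in> carrier G" "P h = P g" using rep'[OF g] by (simp_all add: h_def)
      have hU: "h \<in> U (N #> h)" using t(2)[OF h(1) refl] mem_r_coset_self[OF N h(1)] by blast
      have "P h \<subseteq> U (N #> h)" using t(2)[OF h(1) refl] by (auto simp: P_def)
      then have "(P h, \<phi> (N #> h)) \<in> atlas M"
        using atlas_restrict[OF t(1)[OF h(1) refl] P_open[OF h(1)]] by blast
      then show ?thesis
        using t(3)[OF h(1) refl] P_image[OF h(1)] chart_point_vecs[OF t(1)[OF h(1) refl] hU]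
        by (simp add: h(2) flip: h_def)
    qed
    then show "\<forall>(U, \<phi>, x, \<epsilon>) \<in> I. (U, \<phi>) \<in> atlas M \<and> x \<in> vecs d \<and> 0 < \<epsilon> \<and> \<phi> ` U = polydisc d x \<epsilon>"
      unfolding I_def piece_def by auto
    have "(\<Union>(U, \<phi>, x, \<epsilon>) \<in> I. U) = (\<Union>g\<in>carrier G. P g)" by (auto simp: I_def piece_def)
    also have "\<dots> = topspace X" using P_self P_carrier by (auto simp: topspace_X)
    finally show "(\<Union>(U, \<phi>, x, \<epsilon>) \<in> I. U) = topspace X" .
    show "pairwise (\<lambda>c c'. disjnt (fst c) (fst c')) I"
      unfolding pairwise_def
    proof (intro ballI impI)
      fix c c' assume "c \<in> I" "c' \<in> I" and ne: "c \<noteq> c'"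
      then obtain g h where g: "g \<in> carrier G" "c = piece (P g)" and h: "h \<in> carrier G" "c' = piece (P h)"
        by (auto simp: I_def)
      then have "P g \<noteq> P h" using ne by auto
      then have "P g \<inter> P h = {}" using P_eq[OF g(1)] P_eq[OF h(1)] by blast
      then show "disjnt (fst c) (fst c')" by (simp add: g h piece_def disjnt_def)
    qed
  qed
  have one: "\<one> \<in> N #> \<one>" using mem_r_coset_self[OF N one_closed] .
  have rep1: "rep (P \<one>) = \<one>" using P_self[OF one_closed] by (simp add: rep_def)
  note t1 = t(5)[OF one_closed refl one]
  have "(P \<one>, \<psi>, \<psi> \<one>, r (N #> \<one>)) \<in> I"
    unfolding I_def using t1 rep1 by (intro image_eqI[of _ _ "P \<one>"]) (auto simp: piece_def)
  moreover have "P \<one> \<subseteq> V" using t(2)[OF one_closed refl] t1 by (auto simp: P_def)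
  ultimately show thesis
    using cov P_self[OF one_closed] t1 t(3)[OF one_closed refl] by (intro that[of I "P \<one>" "r (N #> \<one>)"]) auto
qed

end


section \<open>Distributions supported at the identity\<close>

context compact_analytic_group
begin

lemma distributionD:
  assumes "\<nu> \<in> distributions \<iota> M"
  shows "f \<in> Can \<iota> M \<Longrightarrow> g \<in> Can \<iota> M \<Longrightarrow> \<nu> (\<lambda>x. f x + g x) = \<nu> f + \<nu> g"
    and "f \<in> Can \<iota> M \<Longrightarrow> \<nu> (\<lambda>x. c * f x) = c * \<nu> f"
    and "f \<notin> Can \<iota> M \<Longrightarrow> \<nu> f = 0"
    and "continuous_map (Can_topology \<iota> M) euclidean \<nu>"
  using assms by (auto simp: distributions_def)

lemma open_lattice_Can: "open_lattice \<iota> M (Can \<iota> M)"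
  unfolding open_lattice_def
proof (intro conjI ballI allI impI)
  show "\<exists>c. c \<noteq> 0 \<and> (\<lambda>x. c * f x) \<in> Can \<iota> M" if "f \<in> Can \<iota> M" for f
    using that by (intro exI[of _ 1]) auto
  show "\<exists>J \<delta>. finite J \<and> J \<subseteq> I \<and> 0 < \<delta> \<and> Can_on_nhd \<iota> M I J \<delta> \<subseteq> Can \<iota> M" if "polydisc_covering M I" for I
    using Can_on_subset_Can[OF that] by (intro exI[of _ "{}"] exI[of _ 1]) (auto simp: Can_on_nhd_def)
qed (auto simp: Can_zero Can_add Can_cmult)

lemma topspace_Can_topology: "topspace (Can_topology \<iota> M) = Can \<iota> M"
proof -
  have "openin (Can_topology \<iota> M) (Can \<iota> M)"
    unfolding openin_Can_topology using open_lattice_Can Can_add by blast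
  from openin_subset[OF this] have "Can \<iota> M \<subseteq> topspace (Can_topology \<iota> M)" .
  moreover have "topspace (Can_topology \<iota> M) \<subseteq> Can \<iota> M"
    using openin_topspace[of "Can_topology \<iota> M"] unfolding openin_Can_topology by (rule conjunct1)
  ultimately show ?thesis by (rule subset_antisym[rotated])
qed

text \<open>
  Continuity at zero, expressed by the open lattices that define the topology.
\<close>

lemma distribution_lattice:
  assumes \<nu>: "\<nu> \<in> distributions \<iota> M" and e: "0 < e"
  obtains V where "open_lattice \<iota> M V" "\<And>f. f \<in> V \<Longrightarrow> absv (\<nu> f) < e"
proof -
  have zero: "\<nu> (\<lambda>_. 0) = 0" using distributionD(2)[OF \<nu> Can_zero, of 0] by simp
  have "{w::'k. absv w < e} = ball 0 e"
    by (auto simp: ball_def dist_absv)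
  then have "openin euclidean {w::'k. absv w < e}" by simp
  from openin_continuous_map_preimage[OF distributionD(4)[OF \<nu>] this]
  have "openin (Can_topology \<iota> M) {f \<in> Can \<iota> M. absv (\<nu> f) < e}" by (simp add: topspace_Can_topology)
  then have nhd: "\<forall>f\<in>{f \<in> Can \<iota> M. absv (\<nu> f) < e}. \<exists>V. open_lattice \<iota> M V \<and>
      (\<lambda>v x. f x + v x) ` V \<subseteq> {f \<in> Can \<iota> M. absv (\<nu> f) < e}"
    unfolding openin_Can_topology by (rule conjunct2)
  have "(\<lambda>_. 0) \<in> {f \<in> Can \<iota> M. absv (\<nu> f) < e}" using Can_zero zero e by simp
  from bspec[OF nhd this] obtain V where V: "open_lattice \<iota> M V"
    "(\<lambda>v x. 0 + v x) ` V \<subseteq> {f \<in> Can \<iota> M. absv (\<nu> f) < e}" by (elim exE conjE) (rule that)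
  show thesis by (rule that[OF V(1)]) (use V(2) in auto)
qed

lemma absv_power_int: "absv (x powi n :: 'k) = absv x powi n"
  by (simp add: power_int_def absv_power absv_inverse)

text \<open>
  The valuation group contains arbitrarily small and large powers of one element, so every positive real
  is approximated by absolute values up to a constant factor \<open>\<kappa>\<close>.
\<close>

lemma scaling_element:
  obtains \<kappa> :: real where "0 < \<kappa>" "\<And>t. 0 < t \<Longrightarrow> \<exists>s::'k. absv s \<le> t \<and> \<kappa> * t \<le> absv s"
proof -
  obtain \<pi> :: 'k where \<pi>: "\<pi> \<noteq> 0" "absv \<pi> < 1" using nontrivial by blast
  define r where "r = absv \<pi>"
  have r: "0 < r" "r < 1" using \<pi> absv_pos by (auto simp: r_def)
  then have ln_r: "ln r < 0" by simp
  show thesis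
  proof (rule that[OF r(1)])
    fix t :: real assume t: "0 < t"
    (* Division by the negative number ln r reverses the inequality, so rounding up gives r^n \<le> t. *)
    define n where "n = \<lceil>ln t / ln r\<rceil>"
    have "r powi n = exp (real_of_int n * ln r)"
      using r by (simp add: powr_real_of_int'[symmetric] powr_def)
    moreover have "real_of_int n * ln r \<le> ln t"
    proof -
      have "ln t / ln r \<le> real_of_int n" by (simp add: n_def)
      then show ?thesis using ln_r by (simp add: divide_le_eq)
    qed
    moreover have "ln r + ln t \<le> real_of_int n * ln r"
    proof -
      have "real_of_int n \<le> ln t / ln r + 1" unfolding n_def by linarith
      then have "(ln t / ln r + 1) * ln r \<le> real_of_int n * ln r" using ln_r by (intro mult_right_mono_neg) auto
      then show ?thesis using ln_r by (simp add: distrib_right)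
    qed
    moreover have "exp (ln r + ln t) = r * t" "exp (ln t) = t" using r t by (simp_all add: exp_add)
    ultimately have "r powi n \<le> t" "r * t \<le> r powi n" by (metis exp_le_cancel_iff)+
    then show "\<exists>s::'k. absv s \<le> t \<and> r * t \<le> absv s"
      by (intro exI[of _ "\<pi> powi n"]) (simp add: absv_power_int r_def)
  qed
qed

text \<open>
  This turns functionals on the group into functionals on power series, as
  \<open>expands_on_functional\<close> needs them.
\<close>

definition extend :: "'h set \<Rightarrow> ('h \<Rightarrow> nat \<Rightarrow> 'l) \<Rightarrow> ((nat \<Rightarrow> 'l) \<Rightarrow> 'k) \<Rightarrow> 'h \<Rightarrow> 'k" where
  "extend D \<psi> h = (\<lambda>y. if y \<in> D then h (\<psi> y) else 0)"

lemma extend_Can_on_nhd: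
  assumes I: "polydisc_covering M I" and D: "(D, \<psi>, z, r) \<in> I" and h: "expands_le \<iota> d z r h B" and "B \<le> \<delta>" "0 \<le> \<delta>"
    and J: "J \<subseteq> I"
  shows "extend D \<psi> h \<in> Can_on_nhd \<iota> M I J \<delta>"
proof -
  note pD = polydisc_covering_piece[OF I D]
  have "expands_le \<iota> d x \<epsilon> (extend D \<psi> h \<circ> inv_into U \<phi>) \<delta>" if c: "(U, \<phi>, x, \<epsilon>) \<in> I" for U \<phi> x \<epsilon>
  proof (cases "(U, \<phi>, x, \<epsilon>) = (D, \<psi>, z, r)")
    case True
    then have eq: "U = D" "\<phi> = \<psi>" "x = z" "\<epsilon> = r" by auto
    have "expands_le \<iota> d z r (extend D \<psi> h \<circ> inv_into D \<psi>) B"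
    proof (rule expands_le_cong[OF h])
      fix y assume "y \<in> polydisc d z r"
      then obtain q where q: "q \<in> D" "y = \<psi> q" using pD(4) by blast
      then show "h y = (extend D \<psi> h \<circ> inv_into D \<psi>) y" using pD(1) by (simp add: extend_def)
    qed
    then show ?thesis unfolding eq using \<open>B \<le> \<delta>\<close> by (rule expands_leI_le)
  next
    case False
    note pU = polydisc_covering_piece[OF I c]
    have "pairwise (\<lambda>c c'. disjnt (fst c) (fst c')) I" using I by (simp add: polydisc_covering_def)
    from pairwiseD[OF this c D False] have dis: "U \<inter> D = {}" by (simp add: disjnt_def)
    have "expands_le \<iota> d x \<epsilon> (\<lambda>_. 0) (absv (0::'k))" using pU(3) by (intro expands_le_const) simp
    then have "expands_le \<iota> d x \<epsilon> (extend D \<psi> h \<circ> inv_into U \<phi>) (absv (0::'k))"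
    proof (rule expands_le_cong)
      fix y assume "y \<in> polydisc d x \<epsilon>"
      then obtain q where q: "q \<in> U" "y = \<phi> q" using pU(4) by blast
      then show "0 = (extend D \<psi> h \<circ> inv_into U \<phi>) y" using pU(1) dis by (auto simp: extend_def)
    qed
    from expands_leI_le[OF this, of \<delta>] show ?thesis using \<open>0 \<le> \<delta>\<close> by simp
  qed
  moreover have "extend D \<psi> h x = 0" if "x \<notin> topspace X" for x
    using that chart(2)[OF pD(1)] by (auto simp: extend_def topspace)
  ultimately show ?thesis
    unfolding Can_on_nhd_def Can_on_def expands_le_def using J by fast
qed

lemma extend_Can:
  assumes I: "polydisc_covering M I" and D: "(D, \<psi>, z, r) \<in> I" and h: "expands_le \<iota> d z r h B"
  shows "extend D \<psi> h \<in> Can \<iota> M"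
proof -
  have "extend D \<psi> h \<in> Can_on_nhd \<iota> M I {} (max B 0)"
    by (rule extend_Can_on_nhd[OF I D h]) auto
  then show ?thesis using Can_on_subset_Can[OF I] by (simp add: Can_on_nhd_def)
qed

text \<open>
  Continuity gives \<open>\<bar>\<nu>\<bar> < 1\<close> on series of norm at most some \<open>\<delta>\<close>, and scaling turns this into a linear bound on
  all series converging on \<open>D\<close>. The constant depends on the radius of \<open>D\<close>, which is fixed here.
\<close>

lemma distribution_bound:
  assumes \<nu>: "\<nu> \<in> distributions \<iota> M" and I: "polydisc_covering M I" and D: "(D, \<psi>, z, r) \<in> I"
  obtains C where "0 \<le> C" "\<And>h B. expands_le \<iota> d z r h B \<Longrightarrow> absv (\<nu> (extend D \<psi> h)) \<le> C * B"
proof -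
  obtain V where V: "open_lattice \<iota> M V" "\<And>f. f \<in> V \<Longrightarrow> absv (\<nu> f) < 1"
    using distribution_lattice[OF \<nu> zero_less_one] by blast
  have "\<exists>J \<delta>. finite J \<and> J \<subseteq> I \<and> 0 < \<delta> \<and> Can_on_nhd \<iota> M I J \<delta> \<subseteq> V"
    using V(1) I unfolding open_lattice_def by blast
  then obtain J \<delta> where J: "J \<subseteq> I" "0 < \<delta>" "Can_on_nhd \<iota> M I J \<delta> \<subseteq> V" by blast
  obtain \<kappa> where \<kappa>: "0 < \<kappa>" "\<And>t. 0 < t \<Longrightarrow> \<exists>s::'k. absv s \<le> t \<and> \<kappa> * t \<le> absv s" by (rule scaling_element) blast
  define C where "C = 1 / (\<kappa> * \<delta>)"
  have C: "0 < C" using \<kappa>(1) J(2) by (simp add: C_def)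
  show thesis
  proof (rule that[of C])
    fix h B assume h: "expands_le \<iota> d z r h B"
    have B: "0 \<le> B" using expands_le_nonneg[OF h] polydisc_covering_piece(3)[OF I D] by simp
    show "absv (\<nu> (extend D \<psi> h)) \<le> C * B"
    proof (rule ccontr)
      assume "\<not> ?thesis"
      then have gt: "C * B < absv (\<nu> (extend D \<psi> h))" by simp
      (* B may be zero, so the scaling element is chosen for the strictly larger value B' instead. *)
      define B' where "B' = absv (\<nu> (extend D \<psi> h)) / C"
      have B': "B < B'" using gt C by (simp add: B'_def pos_less_divide_eq mult.commute)
      then have "0 < \<delta> / B'" using B J(2) by simp
      then obtain s :: 'k where s: "absv s \<le> \<delta> / B'" "\<kappa> * (\<delta> / B') \<le> absv s" using \<kappa>(2) by blast
      have "absv s * B \<le> \<delta> / B' * B'" using s(1) B B' J(2) by (intro mult_mono) auto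
      then have sB: "absv s * B \<le> \<delta>" using B B' by simp
      have "expands_le \<iota> d z r (\<lambda>v. s * h v) (absv s * B)"
        using polydisc_covering_piece(3)[OF I D] by (intro expands_le_cmult h) simp
      from extend_Can_on_nhd[OF I D this sB _ J(1)] have "extend D \<psi> (\<lambda>v. s * h v) \<in> V" using J(2,3) by auto
      then have "absv (\<nu> (extend D \<psi> (\<lambda>v. s * h v))) < 1" by (rule V(2))
      moreover have "extend D \<psi> (\<lambda>v. s * h v) = (\<lambda>y. s * extend D \<psi> h y)" by (auto simp: extend_def)
      ultimately have lt: "absv s * absv (\<nu> (extend D \<psi> h)) < 1"
        using distributionD(2)[OF \<nu> extend_Can[OF I D h], of s] by (simp add: absv_mult)
      have "1 = \<kappa> * (\<delta> / B') * (C * B')" using \<kappa>(1) J(2) B B' by (simp add: C_def)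
      also have "C * B' = absv (\<nu> (extend D \<psi> h))" using C by (simp add: B'_def)
      also have "\<kappa> * (\<delta> / B') * absv (\<nu> (extend D \<psi> h)) \<le> absv s * absv (\<nu> (extend D \<psi> h))"
        using s(2) by (intro mult_right_mono) auto
      finally show False using lt by simp
    qed
  qed (use C in simp)
qed

lemma covering_piece_clopen:
  assumes I: "polydisc_covering M I" and D: "(D, \<psi>, z, r) \<in> I"
  shows "openin X D" "openin X (carrier G - D)"
proof -
  show "openin X D" using chart(1)[OF polydisc_covering_piece(1)[OF I D]] .
  have dis: "pairwise (\<lambda>c c'. disjnt (fst c) (fst c')) I" using I by (simp add: polydisc_covering_def)
  have "(\<Union>(U, \<phi>, x, \<epsilon>) \<in> I. U) = carrier G" using I by (simp add: polydisc_covering_def topspace)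
  then have un: "(\<Union>c\<in>I. fst c) = carrier G" by (auto simp: case_prod_unfold)
  have "carrier G - D = (\<Union>c\<in>I - {(D, \<psi>, z, r)}. fst c)"
  proof (intro equalityI subsetI)
    fix x assume "x \<in> carrier G - D"
    then obtain c where "c \<in> I" "x \<in> fst c" "x \<notin> D" unfolding un[symmetric] by blast
    then show "x \<in> (\<Union>c\<in>I - {(D, \<psi>, z, r)}. fst c)" by (intro UN_I[of c]) auto
  next
    fix x assume "x \<in> (\<Union>c\<in>I - {(D, \<psi>, z, r)}. fst c)"
    then obtain c where c: "c \<in> I" "c \<noteq> (D, \<psi>, z, r)" "x \<in> fst c" by blast
    then have "x \<in> carrier G" unfolding un[symmetric] by blast
    moreover have "x \<notin> D" using pairwiseD[OF dis c(1) D c(2)] c(3) by (auto simp: disjnt_def)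
    ultimately show "x \<in> carrier G - D" by blast
  qed
  moreover have "openin X (fst c)" if "c \<in> I" for c
    using that chart(1)[OF polydisc_covering_piece(1)[OF I]] by (cases c) auto
  ultimately show "openin X (carrier G - D)" by auto
qed

abbreviation D1 :: "(('h \<Rightarrow> 'k) \<Rightarrow> 'k) set" where
  "D1 \<equiv> carrier (dist_algebra_at_one \<iota> G M)"

lemma D1_iff: "\<nu> \<in> D1 \<longleftrightarrow> \<nu> \<in> distributions \<iota> M \<and>
    (\<forall>H f. subgroup H G \<longrightarrow> openin X H \<longrightarrow> f \<in> Can \<iota> M \<longrightarrow> (\<forall>x\<in>H. f x = 0) \<longrightarrow> \<nu> f = 0)"
proof -
  have "subgroup (carrier G) G" "openin X (carrier G)"
    using subgroup_self openin_topspace[of X] by (simp_all add: topspace_X)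
  then show ?thesis
    unfolding dist_algebra_at_one_def distributions_supported_on_def by auto
qed

lemma D1_distribution: "\<nu> \<in> D1 \<Longrightarrow> \<nu> \<in> distributions \<iota> M"
  by (simp add: D1_iff)

text \<open>
  The open subgroups form a basis of neighbourhoods of the identity, so \<open>\<nu>\<close> sees only germs at the
  identity.
\<close>

lemma at_one_local:
  assumes \<nu>: "\<nu> \<in> D1" and f: "f \<in> Can \<iota> M" and g: "g \<in> Can \<iota> M"
    and V: "openin X V" "\<one> \<in> V" "\<And>x. x \<in> V \<Longrightarrow> f x = g x"
  shows "\<nu> f = \<nu> g"
proof -
  note \<nu>' = distributionD[OF D1_distribution[OF \<nu>]]
  obtain H where H: "subgroup H G" "openin X H" "H \<subseteq> V" using open_subgroup_basis[OF V(1,2)] .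
  have h: "(\<lambda>x. f x + (-1) * g x) \<in> Can \<iota> M" by (intro Can_add Can_cmult f g)
  have "\<nu> (\<lambda>x. f x + (-1) * g x) = 0"
  proof -
    have "\<forall>x\<in>H. f x + (-1) * g x = 0" using H(3) V(3) by auto
    then show ?thesis using \<nu> H h unfolding D1_iff by blast
  qed
  then have "\<nu> f + (-1) * \<nu> g = 0" using \<nu>'(1)[OF f Can_cmult[OF g, of "-1"]] \<nu>'(2)[OF g, of "-1"] by simp
  then show ?thesis by simp
qed

definition act :: "(('h \<Rightarrow> 'k) \<Rightarrow> 'k) \<Rightarrow> ('h \<Rightarrow> 'k) \<Rightarrow> 'h \<Rightarrow> 'k" where
  "act \<nu> f = (\<lambda>x. if x \<in> carrier G then \<nu> (translate f x) else 0)"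

text \<open>
  Near \<open>p\<close> the function is \<open>x \<mapsto> \<nu> (y \<mapsto> f (x y))\<close> with \<open>y\<close> restricted to a small polydisc \<open>D\<close> around the identity,
  by locality. There \<open>f (x y)\<close> has a joint expansion, and \<open>\<nu>\<close> is applied to it term by term.
\<close>

lemma act_Can:
  assumes \<nu>: "\<nu> \<in> D1" and f: "f \<in> Can \<iota> M"
  shows "act \<nu> f \<in> Can \<iota> M"
proof (rule CanI)
  show "act \<nu> f x = 0" if "x \<notin> carrier G" for x using that by (simp add: act_def)
  fix p assume p: "p \<in> carrier G"
  note \<nu>d = D1_distribution[OF \<nu>]
  obtain U \<phi> where c: "(U, \<phi>) \<in> atlas M" "p \<in> U" using chart_at[OF p] .
  obtain V \<psi> where c': "(V, \<psi>) \<in> atlas M" "\<one> \<in> V" using chart_at[OF one_closed] .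
  obtain \<epsilon>0 where \<epsilon>0: "0 < \<epsilon>0" "polydisc d (\<phi> p) \<epsilon>0 \<subseteq> \<phi> ` U"
    and joint: "\<And>\<epsilon>. 0 < \<epsilon> \<Longrightarrow> \<epsilon> \<le> \<epsilon>0 \<Longrightarrow> \<exists>b h. expands_on \<iota> (d + d) (join d (\<phi> p) (\<psi> \<one>)) \<epsilon> b h \<and>
      (\<forall>x\<in>U. \<forall>y\<in>V. \<phi> x \<in> polydisc d (\<phi> p) \<epsilon> \<longrightarrow> \<psi> y \<in> polydisc d (\<psi> \<one>) \<epsilon> \<longrightarrow>
        h (join d (\<phi> x) (\<psi> y)) = f (x \<otimes> y))"
    by (rule translate_joint_expansion[OF f c c']) (assumption | rule that)+
  obtain I D r where I: "polydisc_covering M I" "(D, \<psi>, \<psi> \<one>, r) \<in> I" "\<one> \<in> D" "D \<subseteq> V" "0 < r" "r \<le> \<epsilon>0"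
    by (rule polydisc_covering_exists[OF c' \<epsilon>0(1)])
  note pD = polydisc_covering_piece[OF I(1,2)]
  obtain b h where b: "expands_on \<iota> (d + d) (join d (\<phi> p) (\<psi> \<one>)) r b h"
    and h: "\<And>x y. x \<in> U \<Longrightarrow> y \<in> V \<Longrightarrow> \<phi> x \<in> polydisc d (\<phi> p) r \<Longrightarrow> \<psi> y \<in> polydisc d (\<psi> \<one>) r \<Longrightarrow>
        h (join d (\<phi> x) (\<psi> y)) = f (x \<otimes> y)"
    using joint[OF I(5,6)] by blast
  obtain C where C: "0 \<le> C" "\<And>h B. expands_le \<iota> d (\<psi> \<one>) r h B \<Longrightarrow> absv (\<nu> (extend D \<psi> h)) \<le> C * B"
    by (rule distribution_bound[OF \<nu>d I(1,2)]) blast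
  have "\<exists>a. expands_on \<iota> d (\<phi> p) r a (\<lambda>u. \<nu> (extend D \<psi> (\<lambda>v. h (join d u v))))"
  proof (rule expands_on_functional[OF b I(5) C(1), of "\<lambda>h. \<nu> (extend D \<psi> h)"])
    show "\<nu> (extend D \<psi> (\<lambda>v. g v + g' v)) = \<nu> (extend D \<psi> g) + \<nu> (extend D \<psi> g')"
      if "expands_le \<iota> d (\<psi> \<one>) r g B" "expands_le \<iota> d (\<psi> \<one>) r g' B'" for g g' B B'
    proof -
      have "extend D \<psi> (\<lambda>v. g v + g' v) = (\<lambda>y. extend D \<psi> g y + extend D \<psi> g' y)" by (auto simp: extend_def)
      then show ?thesis using distributionD(1)[OF \<nu>d extend_Can[OF I(1,2) that(1)] extend_Can[OF I(1,2) that(2)]] by simp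
    qed
    show "\<nu> (extend D \<psi> (\<lambda>v. s * g v)) = s * \<nu> (extend D \<psi> g)"
      if "expands_le \<iota> d (\<psi> \<one>) r g B" for s g B
    proof -
      have "extend D \<psi> (\<lambda>v. s * g v) = (\<lambda>y. s * extend D \<psi> g y)" by (auto simp: extend_def)
      then show ?thesis using distributionD(2)[OF \<nu>d extend_Can[OF I(1,2) that]] by simp
    qed
  qed (rule C(2))
  then obtain a where a: "expands_on \<iota> d (\<phi> p) r a (\<lambda>u. \<nu> (extend D \<psi> (\<lambda>v. h (join d u v))))" by blast
  have "expands_on \<iota> d (\<phi> p) r a (\<lambda>u. act \<nu> f (inv_into U \<phi> u))"
  proof (rule expands_on_cong[OF a])
    fix u assume u: "u \<in> polydisc d (\<phi> p) r"
    then have "u \<in> \<phi> ` U" using \<epsilon>0(2) polydisc_mono[OF I(6)] by blast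
    then obtain x where x: "x \<in> U" "u = \<phi> x" by blast
    then have xc: "x \<in> carrier G" using chart(2)[OF c(1)] by blast
    have eq: "extend D \<psi> (\<lambda>v. h (join d u v)) = (\<lambda>y. if y \<in> D then translate f x y else 0)"
    proof
      fix y
      show "extend D \<psi> (\<lambda>v. h (join d u v)) y = (if y \<in> D then translate f x y else 0)"
      proof (cases "y \<in> D")
        case True
        then have "\<psi> y \<in> polydisc d (\<psi> \<one>) r" using pD(4) by blast
        then have "h (join d (\<phi> x) (\<psi> y)) = f (x \<otimes> y)" using h x u True I(4) by blast
        then show ?thesis using True x(2) chart(2)[OF pD(1)] by (auto simp: extend_def translate_def)
      qed (simp add: extend_def)
    qed
    have "\<nu> (\<lambda>y. if y \<in> D then translate f x y else 0) = \<nu> (translate f x)"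
      using covering_piece_clopen[OF I(1,2)] I(3)
      by (intro at_one_local[OF \<nu> _ translate_Can[OF f xc], of _ D] Can_restrict translate_Can f xc) auto
    then show "\<nu> (extend D \<psi> (\<lambda>v. h (join d u v))) = act \<nu> f (inv_into U \<phi> u)"
      unfolding eq using x xc c(1) by (simp add: act_def)
  qed
  moreover have "\<phi> p \<in> polydisc d (\<phi> p) r" using I(5) chart_point_vecs[OF c] by (simp add: polydisc_center)
  ultimately show "\<exists>U \<phi> z \<epsilon> a. (U, \<phi>) \<in> atlas M \<and> p \<in> U \<and> 0 < \<epsilon> \<and> \<phi> p \<in> polydisc d z \<epsilon> \<and>
      expands_on \<iota> d z \<epsilon> a (\<lambda>y. act \<nu> f (inv_into U \<phi> y))"
    using c I(5) by blast
qed

text \<open>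
  The sum of two continuous functionals is continuous by the ultrametric inequality on the intersection
  of two open lattices.
\<close>

lemma D1_add:
  assumes \<nu>: "\<nu> \<in> D1" and \<nu>': "\<nu>' \<in> D1"
  shows "(\<lambda>f. \<nu> f + \<nu>' f) \<in> D1"
proof -
  note d = distributionD[OF D1_distribution[OF \<nu>]] and d' = distributionD[OF D1_distribution[OF \<nu>']]
  have "continuous_map (Can_topology \<iota> M) euclidean (\<lambda>f. \<nu> f + \<nu>' f)"
    unfolding continuous_map_def
  proof (intro conjI allI impI)
    fix S :: "'k set" assume "openin euclidean S"
    then have S: "open S" by simp
    show "openin (Can_topology \<iota> M) {f \<in> topspace (Can_topology \<iota> M). \<nu> f + \<nu>' f \<in> S}"
      unfolding openin_Can_topology topspace_Can_topology
    proof (intro conjI ballI)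
      fix f assume "f \<in> {f \<in> Can \<iota> M. \<nu> f + \<nu>' f \<in> S}"
      then have f: "f \<in> Can \<iota> M" "\<nu> f + \<nu>' f \<in> S" by auto
      then obtain e where e: "e > 0" "\<And>z. dist z (\<nu> f + \<nu>' f) < e \<Longrightarrow> z \<in> S"
        using S unfolding open_dist by blast
      obtain V where V: "open_lattice \<iota> M V" "\<And>f. f \<in> V \<Longrightarrow> absv (\<nu> f) < e"
        using distribution_lattice[OF D1_distribution[OF \<nu>] e(1)] by blast
      obtain V' where V': "open_lattice \<iota> M V'" "\<And>f. f \<in> V' \<Longrightarrow> absv (\<nu>' f) < e"
        using distribution_lattice[OF D1_distribution[OF \<nu>'] e(1)] by blast
      have "(\<lambda>x. f x + v x) \<in> {f \<in> Can \<iota> M. \<nu> f + \<nu>' f \<in> S}" if v: "v \<in> V \<inter> V'" for v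
      proof -
        have vc: "v \<in> Can \<iota> M" using v V(1) by (auto simp: open_lattice_def)
        have "absv (\<nu> v + \<nu>' v) < e"
          using absv_add[of "\<nu> v" "\<nu>' v"] V(2)[of v] V'(2)[of v] v by force
        then have "\<nu> (\<lambda>x. f x + v x) + \<nu>' (\<lambda>x. f x + v x) \<in> S"
          using d(1)[OF f(1) vc] d'(1)[OF f(1) vc] by (intro e(2)) (simp add: dist_absv)
        then show ?thesis using Can_add[OF f(1) vc] by simp
      qed
      then show "\<exists>V. open_lattice \<iota> M V \<and> (\<lambda>v x. f x + v x) ` V \<subseteq> {f \<in> Can \<iota> M. \<nu> f + \<nu>' f \<in> S}"
        using open_lattice_Int[OF V(1) V'(1)] by (intro exI[of _ "V \<inter> V'"]) auto
    qed auto
  qed auto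
  then have "(\<lambda>f. \<nu> f + \<nu>' f) \<in> distributions \<iota> M"
    using d d' by (auto simp: distributions_def algebra_simps)
  then show ?thesis using \<nu> \<nu>' unfolding D1_iff by auto
qed

lemma D1_cmult:
  assumes \<nu>: "\<nu> \<in> D1"
  shows "(\<lambda>f. c * \<nu> f) \<in> D1"
proof (cases "c = 0")
  case True
  have "continuous_map (Can_topology \<iota> M) euclidean (\<lambda>_. 0::'k)" by simp
  then have "(\<lambda>_. 0) \<in> distributions \<iota> M" by (auto simp: distributions_def)
  then show ?thesis using True by (simp add: D1_iff)
next
  case False
  note d = distributionD[OF D1_distribution[OF \<nu>]]
  have c: "absv c > 0" using False by (rule absv_pos)
  have "continuous_on UNIV (\<lambda>z::'k. c * z)"
    unfolding continuous_on_iff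
  proof (intro ballI allI impI)
    fix x :: 'k and e :: real assume "0 < e"
    have "dist (c * x') (c * x) = absv c * dist x' x" for x'
      by (simp add: dist_absv right_diff_distrib[symmetric] absv_mult)
    then show "\<exists>\<delta>>0. \<forall>x'\<in>UNIV. dist x' x < \<delta> \<longrightarrow> dist (c * x') (c * x) < e"
      using c \<open>0 < e\<close> by (intro exI[of _ "e / absv c"]) (auto simp: pos_less_divide_eq mult.commute)
  qed
  then have "continuous_map euclidean euclidean (\<lambda>z::'k. c * z)" by simp
  from continuous_map_compose[OF d(4) this]
  have "continuous_map (Can_topology \<iota> M) euclidean (\<lambda>f. c * \<nu> f)" by (simp add: o_def)
  then have "(\<lambda>f. c * \<nu> f) \<in> distributions \<iota> M"
    using d by (auto simp: distributions_def algebra_simps)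
  then show ?thesis using \<nu> unfolding D1_iff by auto
qed

end


section \<open>Integration of analytic functions against measures\<close>

context compact_analytic_group
begin

text \<open>
  A bound for the oscillation of \<open>f\<close> on the cosets of \<open>N\<close>.
\<close>

definition varies_le :: "('h \<Rightarrow> 'k) \<Rightarrow> 'h set \<Rightarrow> real \<Rightarrow> bool" where
  "varies_le f N e \<longleftrightarrow> (\<forall>g\<in>carrier G. \<forall>h\<in>N #> g. absv (f h - f g) \<le> e)"

lemma varies_le_mono: "varies_le f N e \<Longrightarrow> N' \<subseteq> N \<Longrightarrow> e \<le> e' \<Longrightarrow> varies_le f N' e'"
  unfolding varies_le_def r_coset_def by fastforce

lemma varies_leD:
  assumes "varies_le f N e" "N \<in> ONS" "C \<in> carrier (G Mod N)" "x \<in> C" "y \<in> C"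
  shows "absv (f x - f y) \<le> e"
proof -
  obtain g where g: "g \<in> carrier G" "C = N #> g" using assms(3) by (auto simp: carrier_Mod)
  then have "y \<in> carrier G" using assms(5) r_coset_subset_carrier[OF assms(2)] by blast
  moreover have "x \<in> N #> y" using assms(4,5) r_coset_eq[OF assms(2) g(1)] g(2) by simp
  ultimately show ?thesis using assms(1) by (simp add: varies_le_def)
qed

lemma Can_locally_close:
  assumes f: "f \<in> Can \<iota> M" and g: "g \<in> carrier G" and e: "0 < e"
  obtains V where "openin X V" "g \<in> V" "\<And>x. x \<in> V \<Longrightarrow> absv (f x - f g) \<le> e"
proof -
  obtain U \<phi> where c: "(U, \<phi>) \<in> atlas M" "g \<in> U" using chart_at[OF g] .
  have c_in: "(\<lambda>x. if x \<in> carrier G then - f g else 0) \<in> Can \<iota> M" by (rule Can_const)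
  have f': "(\<lambda>x. f x + (if x \<in> carrier G then - f g else 0)) \<in> Can \<iota> M" by (rule Can_add[OF f c_in])
  obtain \<epsilon> a where \<epsilon>: "0 < \<epsilon>" "expands_on \<iota> d (\<phi> g) \<epsilon> a
      (\<lambda>y. f (inv_into U \<phi> y) + (if inv_into U \<phi> y \<in> carrier G then - f g else 0))"
    using CanD[OF f' c(1) chart(1)[OF c(1)] c(2) c(2)] .
  obtain \<epsilon>1 where \<epsilon>1: "0 < \<epsilon>1" "\<And>\<epsilon>'. 0 < \<epsilon>' \<Longrightarrow> \<epsilon>' \<le> \<epsilon>1 \<Longrightarrow> expands_le \<iota> d (\<phi> g) \<epsilon>'
      (\<lambda>y. f (inv_into U \<phi> y) + (if inv_into U \<phi> y \<in> carrier G then - f g else 0)) e"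
    by (rule expands_le_shrink[OF \<epsilon>(2,1) chart_point_vecs[OF c] e]) (use c g e in auto)
  define V where "V = {x \<in> U. \<phi> x \<in> polydisc d (\<phi> g) \<epsilon>1}"
  show thesis
  proof (rule that[of V])
    show "openin X V" unfolding V_def by (rule chart_preimage_open[OF c(1) openin_polydisc[OF \<epsilon>1(1)]])
    show "g \<in> V" using c \<epsilon>1(1) chart_point_vecs[OF c] by (simp add: V_def polydisc_center)
    fix x assume x: "x \<in> V"
    then have "absv (f (inv_into U \<phi> (\<phi> x)) + (if inv_into U \<phi> (\<phi> x) \<in> carrier G then - f g else 0)) \<le> e"
      using \<epsilon>1(1) by (intro expands_le_absv[OF \<epsilon>1(2)[OF \<epsilon>1(1) order_refl]]) (auto simp: V_def)
    then show "absv (f x - f g) \<le> e" using x c chart(2)[OF c(1)] by (auto simp: V_def subset_iff)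
  qed
qed

text \<open>
  Analytic functions are continuous, and by compactness uniformly so.
\<close>

lemma Can_varies_le:
  assumes f: "f \<in> Can \<iota> M" and e: "0 < e"
  obtains N where "N \<in> ONS" "varies_le f N e"
proof -
  have "\<exists>V. openin X V \<and> g \<in> V \<and> (\<forall>x\<in>V. absv (f x - f g) \<le> e)" if g: "g \<in> carrier G" for g
    by (rule Can_locally_close[OF f g e]) blast
  then obtain V where V: "\<And>g. g \<in> carrier G \<Longrightarrow> openin X (V g)" "\<And>g. g \<in> carrier G \<Longrightarrow> g \<in> V g"
    "\<And>g x. g \<in> carrier G \<Longrightarrow> x \<in> V g \<Longrightarrow> absv (f x - f g) \<le> e" by metis
  obtain N where N: "N \<in> ONS" "\<And>h. h \<in> carrier G \<Longrightarrow> \<exists>g\<in>carrier G. N #> h \<subseteq> V g"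
    by (rule uniform_cosets[of V, OF V(1,2)]) (assumption | rule that)+
  have "varies_le f N e"
    unfolding varies_le_def
  proof (intro ballI)
    fix g h assume g: "g \<in> carrier G" and h: "h \<in> N #> g"
    obtain g' where g': "g' \<in> carrier G" "N #> g \<subseteq> V g'" using N(2)[OF g] by blast
    have "absv ((f h - f g') - (f g - f g')) \<le> e"
      using g' h mem_r_coset_self[OF N(1) g] by (intro absv_diff_le V(3)) auto
    then show "absv (f h - f g) \<le> e" by simp
  qed
  with N(1) show thesis by (rule that)
qed

abbreviation RH :: "('k, 'h set \<Rightarrow> 'h set \<Rightarrow> 'k) module" where
  "RH \<equiv> completed_group_ring valuation_ring G X"

lemma RH_iff: "\<xi> \<in> carrier RH \<longleftrightarrow>
    (\<forall>U\<in>ONS. \<xi> U \<in> carrier (group_ring valuation_ring (G Mod U))) \<and>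
    (\<forall>U. U \<notin> ONS \<longrightarrow> \<xi> U = (\<lambda>_. 0)) \<and>
    (\<forall>U\<in>ONS. \<forall>V\<in>ONS. U \<subseteq> V \<longrightarrow> \<xi> V = group_ring_projection G U V (\<xi> U))"
  unfolding completed_group_ring_def partial_object.simps mem_Collect_eq by (rule refl)

lemma group_ring_iff: "a \<in> carrier (group_ring R Q) \<longleftrightarrow>
    finite {q. a q \<noteq> 0} \<and> (\<forall>q. a q \<in> R) \<and> (\<forall>q. q \<notin> carrier Q \<longrightarrow> a q = 0)"
  unfolding group_ring_def partial_object.simps mem_Collect_eq by (rule refl)

lemma RH_level:
  assumes "\<xi> \<in> carrier RH" "N \<in> ONS" shows "\<xi> N \<in> carrier (group_ring valuation_ring (G Mod N))"
  using assms(1)[unfolded RH_iff, THEN conjunct1] assms(2) by (rule bspec)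

lemma RH_absv:
  assumes "\<xi> \<in> carrier RH" "N \<in> ONS" shows "absv (\<xi> N C) \<le> 1"
  using RH_level[OF assms] by (simp add: group_ring_iff valuation_ring_def)

text \<open>
  The compatibility of an inverse system reads as finite additivity, if \<open>\<xi> N C\<close> is regarded as the mass of
  the coset \<open>C\<close>.
\<close>

lemma RH_proj:
  assumes "\<xi> \<in> carrier RH" "N \<in> ONS" "N' \<in> ONS" "N' \<subseteq> N" "C \<in> carrier (G Mod N)"
  shows "\<xi> N C = (\<Sum>D | D \<in> carrier (G Mod N') \<and> D \<subseteq> C. \<xi> N' D)"
proof -
  have "\<forall>U\<in>ONS. \<forall>V\<in>ONS. U \<subseteq> V \<longrightarrow> \<xi> V = group_ring_projection G U V (\<xi> U)"
    using assms(1) unfolding RH_iff by (elim conjE)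
  from this[rule_format, OF assms(3,2,4)] have "\<xi> N = group_ring_projection G N' N (\<xi> N')" .
  then show ?thesis using fun_cong[of "\<xi> N" _ C] assms(5) by (simp only: group_ring_projection_def if_True)
qed

lemma RH_outside:
  assumes "\<xi> \<in> carrier RH" "N \<notin> ONS \<or> C \<notin> carrier (G Mod N)" shows "\<xi> N C = 0"
proof (cases "N \<in> ONS")
  case True
  then show ?thesis using RH_level[OF assms(1) True] assms(2) by (simp add: group_ring_iff)
next
  case False
  then show ?thesis using assms(1) unfolding RH_iff by simp
qed

lemma coset_nonempty: "N \<in> ONS \<Longrightarrow> C \<in> carrier (G Mod N) \<Longrightarrow> C \<noteq> {}"
  using mem_r_coset_self by (auto simp: carrier_Mod)

lemma coset_eqI:
  assumes "N \<in> ONS" "C \<in> carrier (G Mod N)" "C' \<in> carrier (G Mod N)" "x \<in> C" "x \<in> C'"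
  shows "C = C'"
proof -
  obtain g g' where g: "g \<in> carrier G" "C = N #> g" and g': "g' \<in> carrier G" "C' = N #> g'"
    using assms(2,3) by (auto simp: carrier_Mod)
  have "N #> x = C" using r_coset_eq[OF assms(1) g(1)] assms(4) g(2) by simp
  moreover have "N #> x = C'" using r_coset_eq[OF assms(1) g'(1)] assms(5) g'(2) by simp
  ultimately show ?thesis by simp
qed

lemma coset_up:
  assumes N: "N \<in> ONS" "N0 \<in> ONS" "N \<subseteq> N0" and D: "D \<in> carrier (G Mod N)"
  shows "\<exists>C\<in>carrier (G Mod N0). D \<subseteq> C"
proof -
  obtain g where g: "g \<in> carrier G" "D = N #> g" using D by (auto simp: carrier_Mod)
  then have "D \<subseteq> N0 #> g" using N(3) by (auto simp: r_coset_def)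
  then show ?thesis using g(1) by (auto simp: carrier_Mod)
qed

lemma coset_subset_iff:
  assumes N: "N \<in> ONS" "N0 \<in> ONS" "N \<subseteq> N0" and D: "D \<in> carrier (G Mod N)" and C: "C \<in> carrier (G Mod N0)"
    and x: "x \<in> D"
  shows "x \<in> C \<longleftrightarrow> D \<subseteq> C"
proof
  assume "x \<in> C"
  obtain C' where C': "C' \<in> carrier (G Mod N0)" "D \<subseteq> C'" using coset_up[OF N D] by blast
  then have "C = C'" using coset_eqI[OF N(2) C C'(1) \<open>x \<in> C\<close>] x by blast
  then show "D \<subseteq> C" using C' by simp
qed (use x in blast)

text \<open>
  A choice of evaluation points for the finite sums that approximate an integral.
\<close>

definition transversal :: "'h set \<Rightarrow> ('h set \<Rightarrow> 'h) \<Rightarrow> bool" where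
  "transversal N r \<longleftrightarrow> (\<forall>C\<in>carrier (G Mod N). r C \<in> C)"

lemma transversal_some: "N \<in> ONS \<Longrightarrow> transversal N (\<lambda>C. SOME x. x \<in> C)"
  unfolding transversal_def by (metis coset_nonempty ex_in_conv someI)

definition riemann_sum :: "('h set \<Rightarrow> 'h set \<Rightarrow> 'k) \<Rightarrow> ('h \<Rightarrow> 'k) \<Rightarrow> 'h set \<Rightarrow> ('h set \<Rightarrow> 'h) \<Rightarrow> 'k" where
  "riemann_sum \<xi> f N r = (\<Sum>C\<in>carrier (G Mod N). \<xi> N C * f (r C))"

text \<open>
  By finite additivity both sums are sums over the finer cosets, with evaluation points in the same
  coarse coset. The masses are bounded by one, so the ultrametric inequality gives the oscillation of
  \<open>f\<close> as error, however many cosets there are.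
\<close>

lemma riemann_close:
  assumes \<xi>: "\<xi> \<in> carrier RH" and N: "N \<in> ONS" "N0 \<in> ONS" "N \<subseteq> N0"
    and f: "varies_le f N0 e" and e: "0 \<le> e" and r: "transversal N r" and r0: "transversal N0 r0"
  shows "absv (riemann_sum \<xi> f N r - riemann_sum \<xi> f N0 r0) \<le> e"
proof -
  (* The coarse coset containing a fine one. *)
  define up where "up D = (SOME C. C \<in> carrier (G Mod N0) \<and> D \<subseteq> C)" for D
  have up: "up D \<in> carrier (G Mod N0)" "D \<subseteq> up D" if "D \<in> carrier (G Mod N)" for D
  proof -
    have "\<exists>C. C \<in> carrier (G Mod N0) \<and> D \<subseteq> C" using coset_up[OF N that] by blast
    then have "up D \<in> carrier (G Mod N0) \<and> D \<subseteq> up D" unfolding up_def by (rule someI_ex)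
    then show "up D \<in> carrier (G Mod N0)" "D \<subseteq> up D" by auto
  qed
  have up_eq: "{D. D \<in> carrier (G Mod N) \<and> D \<subseteq> C} = {D \<in> carrier (G Mod N). up D = C}"
    if C: "C \<in> carrier (G Mod N0)" for C
  proof (intro equalityI subsetI)
    fix D assume "D \<in> {D. D \<in> carrier (G Mod N) \<and> D \<subseteq> C}"
    then have D: "D \<in> carrier (G Mod N)" "D \<subseteq> C" by auto
    obtain x where "x \<in> D" using coset_nonempty[OF N(1) D(1)] by blast
    then have "up D = C" using coset_eqI[OF N(2) up(1)[OF D(1)] C] up(2)[OF D(1)] D(2) by blast
    then show "D \<in> {D \<in> carrier (G Mod N). up D = C}" using D by simp
  qed (use up(2) in auto)
  have "riemann_sum \<xi> f N0 r0 = (\<Sum>C\<in>carrier (G Mod N0). \<Sum>D\<in>{D \<in> carrier (G Mod N). up D = C}. \<xi> N D * f (r0 (up D)))"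
    unfolding riemann_sum_def
  proof (rule sum.cong[OF refl])
    fix C assume C: "C \<in> carrier (G Mod N0)"
    have "\<xi> N0 C * f (r0 C) = (\<Sum>D\<in>{D \<in> carrier (G Mod N). up D = C}. \<xi> N D * f (r0 C))"
      unfolding RH_proj[OF \<xi> N(2,1,3) C] up_eq[OF C] by (rule sum_distrib_right)
    also have "\<dots> = (\<Sum>D\<in>{D \<in> carrier (G Mod N). up D = C}. \<xi> N D * f (r0 (up D)))"
      by (rule sum.cong) auto
    finally show "\<xi> N0 C * f (r0 C) = (\<Sum>D\<in>{D \<in> carrier (G Mod N). up D = C}. \<xi> N D * f (r0 (up D)))" .
  qed
  also have "\<dots> = (\<Sum>D\<in>carrier (G Mod N). \<xi> N D * f (r0 (up D)))"
    using finite_Mod[OF N(1)] finite_Mod[OF N(2)] up(1) by (intro sum.group) auto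
  finally have "riemann_sum \<xi> f N r - riemann_sum \<xi> f N0 r0 = (\<Sum>D\<in>carrier (G Mod N). \<xi> N D * (f (r D) - f (r0 (up D))))"
    by (simp add: riemann_sum_def sum_subtractf right_diff_distrib)
  moreover have "absv (\<xi> N D * (f (r D) - f (r0 (up D)))) \<le> e" if D: "D \<in> carrier (G Mod N)" for D
  proof -
    have "r D \<in> up D" "r0 (up D) \<in> up D"
      using r r0 up[OF D] D unfolding transversal_def by blast+
    then have "absv (f (r D) - f (r0 (up D))) \<le> e" using varies_leD[OF f N(2) up(1)[OF D]] by blast
    then have "absv (\<xi> N D) * absv (f (r D) - f (r0 (up D))) \<le> 1 * e"
      using RH_absv[OF \<xi> N(1)] by (intro mult_mono) auto
    then show ?thesis by (simp add: absv_mult)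
  qed
  ultimately show ?thesis by (simp only:) (rule absv_sum_le[OF _ e])
qed

lemma riemann_close2:
  assumes \<xi>: "\<xi> \<in> carrier RH" and N: "N \<in> ONS" "N' \<in> ONS"
    and f: "varies_le f N e" "varies_le f N' e" and e: "0 \<le> e" and r: "transversal N r" "transversal N' r'"
  shows "absv (riemann_sum \<xi> f N r - riemann_sum \<xi> f N' r') \<le> e"
proof -
  note I = ONS_Int[OF N]
  note t = transversal_some[OF I]
  let ?t = "\<lambda>C. SOME x. x \<in> C"
  have "absv ((riemann_sum \<xi> f (N \<inter> N') ?t - riemann_sum \<xi> f N' r') - (riemann_sum \<xi> f (N \<inter> N') ?t - riemann_sum \<xi> f N r)) \<le> e"
    by (intro absv_diff_le riemann_close[OF \<xi> I] N f e r t) auto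
  then show ?thesis by simp
qed

abbreviation pairing :: "('h set \<Rightarrow> 'h set \<Rightarrow> 'k) \<Rightarrow> ('h \<Rightarrow> 'k) \<Rightarrow> 'k" where
  "pairing \<equiv> measure_pairing G X"

text \<open>
  The integral exists because the sums for subgroups on which \<open>f\<close> oscillates by at most \<open>1 / (n + 1)\<close>
  form a Cauchy sequence, and its distance to every finite sum is at most the oscillation.
\<close>

lemma pairing_approx:
  assumes \<xi>: "\<xi> \<in> carrier RH" and f: "f \<in> Can \<iota> M" and N: "N \<in> ONS"
    and v: "varies_le f N e" and e: "0 \<le> e" and r: "transversal N r"
  shows "absv (pairing \<xi> f - riemann_sum \<xi> f N r) \<le> e"
proof -
  let ?t = "\<lambda>C. SOME x. x \<in> C"
  have "\<exists>N\<in>ONS. varies_le f N (inverse (real (Suc n)))" for n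
    by (rule Can_varies_le[OF f, of "inverse (real (Suc n))"]) auto
  then obtain A where A: "\<And>n. A n \<in> ONS" "\<And>n. varies_le f (A n) (inverse (real (Suc n)))" by metis
  define s where "s n = riemann_sum \<xi> f (A n) ?t" for n
  have s_close: "absv (s n - s m) \<le> inverse (real (Suc k))" if "k \<le> n" "k \<le> m" for n m k
  proof -
    have le: "inverse (real (Suc n)) \<le> inverse (real (Suc k))" if "k \<le> n" for n
      using that by (intro le_imp_inverse_le) auto
    have "varies_le f (A n) (inverse (real (Suc k)))" "varies_le f (A m) (inverse (real (Suc k)))"
      using varies_le_mono[OF A(2) order_refl le] \<open>k \<le> n\<close> \<open>k \<le> m\<close> by auto
    then show ?thesis
      unfolding s_def using A(1) by (intro riemann_close2[OF \<xi>] transversal_some) auto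
  qed
  have "Cauchy s"
  proof (rule metric_CauchyI)
    fix e :: real assume "e > 0"
    then obtain k where k: "inverse (real (Suc k)) < e" using reals_Archimedean by blast
    show "\<exists>k. \<forall>m\<ge>k. \<forall>n\<ge>k. dist (s m) (s n) < e"
      using le_less_trans[OF s_close k] unfolding dist_absv by (intro exI[of _ k] allI impI)
  qed
  from Cauchy_convergent[OF this] obtain L where L: "s \<longlonglongrightarrow> L" unfolding convergent_def by (elim exE)
  have approx: "absv (L - riemann_sum \<xi> f N r) \<le> e"
    if N: "N \<in> ONS" and v: "varies_le f N e" and e: "0 \<le> e" and r: "transversal N r" for N e r
  proof (rule ccontr)
    let ?a = "absv (L - riemann_sum \<xi> f N r)"
    assume "\<not> ?thesis"
    then have gt: "e < ?a" and pos: "0 < ?a" using e by auto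
    obtain k where k: "inverse (real (Suc k)) < ?a" using pos reals_Archimedean by blast
    obtain n0 where n0: "\<forall>n\<ge>n0. dist (s n) L < ?a"
      using L[unfolded lim_sequentially, rule_format, OF pos] by (elim exE)
    define n where "n = max k n0"
    have "inverse (real (Suc n)) \<le> inverse (real (Suc k))" by (intro le_imp_inverse_le) (auto simp: n_def)
    then have n: "inverse (real (Suc n)) < ?a" using k by linarith
    have "absv (s n - riemann_sum \<xi> f N r) \<le> max e (inverse (real (Suc n)))"
      unfolding s_def
      by (rule riemann_close2[OF \<xi> A(1) N varies_le_mono[OF A(2)] varies_le_mono[OF v] _ transversal_some[OF A(1)] r])
        (use e in auto)
    then have "absv (s n - riemann_sum \<xi> f N r) < ?a" using n gt by linarith
    moreover have "absv (L - s n) < ?a"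
      using n0[rule_format, of n] by (simp add: dist_absv absv_diff_commute n_def)
    ultimately have "max (absv (L - s n)) (absv (s n - riemann_sum \<xi> f N r)) < ?a" by simp
    moreover have "?a \<le> max (absv (L - s n)) (absv (s n - riemann_sum \<xi> f N r))"
      using absv_add[of "L - s n" "s n - riemann_sum \<xi> f N r"] by simp
    ultimately show False by linarith
  qed
  let ?Q = "\<lambda>s. \<forall>e>0. \<exists>U\<^sub>0 \<in> ONS. \<forall>U \<in> ONS. U \<subseteq> U\<^sub>0 \<longrightarrow>
      (\<forall>r. (\<forall>C \<in> carrier (G Mod U). r C \<in> C) \<longrightarrow>
        dist (\<Sum>C \<in> carrier (G Mod U). \<xi> U C * f (r C)) s < e)"
  have QL: "?Q L"
  proof (intro allI impI)
    fix e :: real assume e: "e > 0"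
    obtain N where N: "N \<in> ONS" "varies_le f N (e / 2)" using Can_varies_le[OF f, of "e / 2"] e by auto
    show "\<exists>U\<^sub>0 \<in> ONS. \<forall>U \<in> ONS. U \<subseteq> U\<^sub>0 \<longrightarrow> (\<forall>r. (\<forall>C \<in> carrier (G Mod U). r C \<in> C) \<longrightarrow>
        dist (\<Sum>C \<in> carrier (G Mod U). \<xi> U C * f (r C)) L < e)"
    proof (intro bexI[OF _ N(1)] ballI allI impI)
      fix U r assume U: "U \<in> ONS" "U \<subseteq> N" and r: "\<forall>C \<in> carrier (G Mod U). r C \<in> C"
      have "absv (L - riemann_sum \<xi> f U r) \<le> e / 2"
        using U r e varies_le_mono[OF N(2) U(2) order_refl] by (intro approx) (auto simp: transversal_def)
      then show "dist (\<Sum>C \<in> carrier (G Mod U). \<xi> U C * f (r C)) L < e"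
        using e by (simp add: dist_absv riemann_sum_def absv_diff_commute)
    qed
  qed
  (* Below two subgroups that serve for s' and for L there is a common one, and it has a transversal. *)
  have uniq: "s' = L" if Q: "?Q s'" for s'
  proof (rule ccontr)
    assume "s' \<noteq> L"
    then have pos: "0 < dist s' L / 2" by simp
    obtain U1 where U1: "U1 \<in> ONS" "\<And>U r. U \<in> ONS \<Longrightarrow> U \<subseteq> U1 \<Longrightarrow> transversal U r \<Longrightarrow> dist (riemann_sum \<xi> f U r) s' < dist s' L / 2"
      using Q[rule_format, OF pos] unfolding transversal_def riemann_sum_def by blast
    obtain U2 where U2: "U2 \<in> ONS" "\<And>U r. U \<in> ONS \<Longrightarrow> U \<subseteq> U2 \<Longrightarrow> transversal U r \<Longrightarrow> dist (riemann_sum \<xi> f U r) L < dist s' L / 2"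
      using QL[rule_format, OF pos] unfolding transversal_def riemann_sum_def by blast
    note I = ONS_Int[OF U1(1) U2(1)]
    have "dist (riemann_sum \<xi> f (U1 \<inter> U2) ?t) s' < dist s' L / 2" "dist (riemann_sum \<xi> f (U1 \<inter> U2) ?t) L < dist s' L / 2"
      using U1(2)[OF I _ transversal_some[OF I]] U2(2)[OF I _ transversal_some[OF I]] by auto
    then show False using dist_triangle_half_r[of "riemann_sum \<xi> f (U1 \<inter> U2) ?t" s' "dist s' L" L] by simp
  qed
  have "pairing \<xi> f = L" unfolding measure_pairing_def by (rule the_equality[where P = ?Q, OF QL]) (rule uniq)
  then show ?thesis using approx[OF N v e r] by simp
qed

lemma eq_if_close:
  fixes a b :: 'k
  assumes "\<And>e. e > 0 \<Longrightarrow> absv (a - b) \<le> K * e" "0 \<le> K"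
  shows "a = b"
proof (rule ccontr)
  assume "a \<noteq> b"
  then have pos: "0 < absv (a - b)" by (simp add: absv_pos)
  have "absv (a - b) \<le> K * (absv (a - b) / (K + 1))" using assms pos by (intro assms(1)) simp
  also have "\<dots> < absv (a - b)" using pos assms(2) by (simp add: field_simps)
  finally show False by simp
qed

text \<open>
  Linear relations between finite sums pass to the limit. One lemma serves additivity and homogeneity in
  both the measure and the function.
\<close>

lemma pairing_linear:
  assumes \<xi>: "\<xi> \<in> carrier RH" "\<eta> \<in> carrier RH" "\<zeta> \<in> carrier RH"
    and f: "f \<in> Can \<iota> M" "g \<in> Can \<iota> M" "h \<in> Can \<iota> M"
    and lin: "\<And>N r. N \<in> ONS \<Longrightarrow> riemann_sum \<zeta> h N r = a * riemann_sum \<xi> f N r + b * riemann_sum \<eta> g N r"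
  shows "pairing \<zeta> h = a * pairing \<xi> f + b * pairing \<eta> g"
proof (rule eq_if_close[of _ _ "max 1 (max (absv a) (absv b))"])
  fix e :: real assume e: "e > 0"
  let ?K = "max 1 (max (absv a) (absv b))"
  obtain A where A: "A \<in> ONS" "varies_le f A e" using Can_varies_le[OF f(1) e] .
  obtain B where B: "B \<in> ONS" "varies_le g B e" using Can_varies_le[OF f(2) e] .
  obtain C where C: "C \<in> ONS" "varies_le h C e" using Can_varies_le[OF f(3) e] .
  define N where "N = A \<inter> (B \<inter> C)"
  have N: "N \<in> ONS" unfolding N_def by (intro ONS_Int A B C)
  have v: "varies_le f N e" "varies_le g N e" "varies_le h N e"
    by (rule varies_le_mono[OF A(2)] varies_le_mono[OF B(2)] varies_le_mono[OF C(2)]; auto simp: N_def)+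
  let ?t = "\<lambda>C. SOME x. x \<in> C"
  note t = transversal_some[OF N]
  have mult: "absv (c * x) \<le> ?K * e" if "absv x \<le> e" "absv c \<le> ?K" for c x
    using that e unfolding absv_mult by (intro mult_mono) auto
  have h1: "absv (1 * (pairing \<zeta> h - riemann_sum \<zeta> h N ?t)) \<le> ?K * e"
    using e by (intro mult pairing_approx \<xi> f N v t) auto
  have f1: "absv (a * (pairing \<xi> f - riemann_sum \<xi> f N ?t)) \<le> ?K * e"
    using e by (intro mult pairing_approx \<xi> f N v t) auto
  have g1: "absv (b * (pairing \<eta> g - riemann_sum \<eta> g N ?t)) \<le> ?K * e"
    using e by (intro mult pairing_approx \<xi> f N v t) auto
  have "pairing \<zeta> h - (a * pairing \<xi> f + b * pairing \<eta> g) = 1 * (pairing \<zeta> h - riemann_sum \<zeta> h N ?t)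
      - (a * (pairing \<xi> f - riemann_sum \<xi> f N ?t) + b * (pairing \<eta> g - riemann_sum \<eta> g N ?t))"
    unfolding lin[OF N] by (simp add: algebra_simps)
  then show "absv (pairing \<zeta> h - (a * pairing \<xi> f + b * pairing \<eta> g)) \<le> ?K * e"
    by (simp only:) (intro absv_diff_le absv_add_le h1 f1 g1)
qed simp

lemma pairing_add_right:
  assumes "\<xi> \<in> carrier RH" "f \<in> Can \<iota> M" "g \<in> Can \<iota> M"
  shows "pairing \<xi> (\<lambda>x. f x + g x) = pairing \<xi> f + pairing \<xi> g"
  using pairing_linear[OF assms(1,1,1,2,3) Can_add[OF assms(2,3)], of 1 1]
  by (simp add: riemann_sum_def sum.distrib distrib_left)

lemma pairing_cmult_right:
  assumes "\<xi> \<in> carrier RH" "f \<in> Can \<iota> M"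
  shows "pairing \<xi> (\<lambda>x. c * f x) = c * pairing \<xi> f"
  using pairing_linear[OF assms(1,1,1,2,2) Can_cmult[OF assms(2), of c], of c 0]
  by (simp add: riemann_sum_def sum_distrib_left mult_ac)

text \<open>
  The integral of a function supported on a coset is controlled by the masses of the smaller cosets
  inside it; the rest of the measure does not contribute.
\<close>

lemma pairing_bound:
  assumes \<xi>: "\<xi> \<in> carrier RH" and f: "f \<in> Can \<iota> M" and V: "V \<in> ONS" and C0: "C0 \<in> carrier (G Mod V)"
    and out: "\<And>x. x \<notin> C0 \<Longrightarrow> f x = 0" and le: "\<And>x. x \<in> C0 \<Longrightarrow> absv (f x) \<le> \<epsilon>" and "0 \<le> \<epsilon>" "0 \<le> B"
    and B: "\<And>V' C. V' \<in> ONS \<Longrightarrow> V' \<subseteq> V \<Longrightarrow> C \<in> carrier (G Mod V') \<Longrightarrow> C \<subseteq> C0 \<Longrightarrow> absv (\<xi> V' C) \<le> B"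
  shows "absv (pairing \<xi> f) \<le> B * \<epsilon>"
proof (rule ccontr)
  assume "\<not> ?thesis"
  then have gt: "B * \<epsilon> < absv (pairing \<xi> f)" by simp
  moreover have "0 \<le> B * \<epsilon>" using assms by simp
  ultimately have pos: "0 < absv (pairing \<xi> f) / 2" by linarith
  obtain A where A: "A \<in> ONS" "varies_le f A (absv (pairing \<xi> f) / 2)" using Can_varies_le[OF f pos] .
  define N where "N = A \<inter> V"
  have N: "N \<in> ONS" "N \<subseteq> V" unfolding N_def by (auto intro: ONS_Int A V)
  have v: "varies_le f N (absv (pairing \<xi> f) / 2)" by (rule varies_le_mono[OF A(2)]) (auto simp: N_def)
  let ?t = "\<lambda>C. SOME x. x \<in> C"
  note t = transversal_some[OF N(1)]
  have close: "absv (pairing \<xi> f - riemann_sum \<xi> f N ?t) \<le> absv (pairing \<xi> f) / 2"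
    using pos by (intro pairing_approx[OF \<xi> f N(1) v _ t]) simp
  have "absv (riemann_sum \<xi> f N ?t) \<le> B * \<epsilon>"
    unfolding riemann_sum_def
  proof (rule absv_sum_le)
    fix C assume C: "C \<in> carrier (G Mod N)"
    have tC: "?t C \<in> C" using t C unfolding transversal_def by blast
    show "absv (\<xi> N C * f (?t C)) \<le> B * \<epsilon>"
    proof (cases "?t C \<in> C0")
      case True
      then have "C \<subseteq> C0" using coset_subset_iff[OF N(1) V N(2) C C0 tC] by simp
      then show ?thesis unfolding absv_mult using True assms(8) by (intro mult_mono B N C le) auto
    next
      case False
      then show ?thesis using out assms by simp
    qed
  qed (use assms in simp)
  then have "max (absv (pairing \<xi> f - riemann_sum \<xi> f N ?t)) (absv (riemann_sum \<xi> f N ?t)) < absv (pairing \<xi> f)"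
    using close gt pos by auto
  moreover have "absv (pairing \<xi> f) \<le> max (absv (pairing \<xi> f - riemann_sum \<xi> f N ?t)) (absv (riemann_sum \<xi> f N ?t))"
    using absv_add[of "pairing \<xi> f - riemann_sum \<xi> f N ?t" "riemann_sum \<xi> f N ?t"] by simp
  ultimately show False by linarith
qed

definition coset_indicator :: "'h set \<Rightarrow> 'h \<Rightarrow> 'k" where
  "coset_indicator C = (\<lambda>x. if x \<in> C then 1 else 0)"

lemma Can_restrict_coset:
  assumes "f \<in> Can \<iota> M" "V \<in> ONS" "C \<in> carrier (G Mod V)"
  shows "(\<lambda>x. coset_indicator C x * f x) \<in> Can \<iota> M"
proof -
  obtain g where g: "g \<in> carrier G" "C = V #> g" using assms(3) by (auto simp: carrier_Mod)
  have "(\<lambda>x. coset_indicator C x * f x) = (\<lambda>x. if x \<in> C then f x else 0)"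
    by (auto simp: coset_indicator_def)
  then show ?thesis
    using Can_restrict[OF assms(1), of C] openin_ONS_r_coset[OF assms(2) g(1)] compactin_r_coset(2)[OF assms(2) g(1)]
    by (simp add: g(2))
qed

lemma coset_subset_carrier: "V \<in> ONS \<Longrightarrow> C \<in> carrier (G Mod V) \<Longrightarrow> C \<subseteq> carrier G"
  using r_coset_subset_carrier by (auto simp: carrier_Mod)

lemma coset_indicator_Can:
  assumes "V \<in> ONS" "C \<in> carrier (G Mod V)"
  shows "coset_indicator C \<in> Can \<iota> M"
proof -
  have "(\<lambda>x. coset_indicator C x * (if x \<in> carrier G then 1 else 0)) = coset_indicator C"
    using coset_subset_carrier[OF assms] by (auto simp: coset_indicator_def fun_eq_iff)
  then show ?thesis using Can_restrict_coset[OF Can_const[of 1] assms] by simp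
qed

text \<open>
  The oscillation of the indicator function is zero, so the finite sum at level \<open>V\<close> is the integral. In
  particular a measure is determined by its values on indicator functions of cosets.
\<close>

lemma pairing_coset_indicator:
  assumes \<xi>: "\<xi> \<in> carrier RH" and V: "V \<in> ONS" and C: "C \<in> carrier (G Mod V)"
  shows "pairing \<xi> (coset_indicator C) = \<xi> V C"
proof -
  let ?t = "\<lambda>C. SOME x. x \<in> C"
  note t = transversal_some[OF V]
  have mem: "?t C' \<in> C \<longleftrightarrow> C' = C" if C': "C' \<in> carrier (G Mod V)" for C'
  proof -
    have "?t C' \<in> C'" using t C' unfolding transversal_def by blast
    then show ?thesis using coset_eqI[OF V C' C] by blast
  qed
  have "varies_le (coset_indicator C) V 0"
    unfolding varies_le_def
  proof (intro ballI)
    fix g h assume g: "g \<in> carrier G" and h: "h \<in> V #> g"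
    have D: "V #> g \<in> carrier (G Mod V)" using g by (auto simp: carrier_Mod)
    have "g \<in> C \<longleftrightarrow> h \<in> C"
      using coset_eqI[OF V D C] mem_r_coset_self[OF V g] h by blast
    then show "absv (coset_indicator C h - coset_indicator C g) \<le> 0" by (simp add: coset_indicator_def)
  qed
  from pairing_approx[OF \<xi> coset_indicator_Can[OF V C] V this order_refl t]
  have "absv (pairing \<xi> (coset_indicator C) - riemann_sum \<xi> (coset_indicator C) V ?t) = 0"
    using absv_nonneg by (intro antisym)
  then have "pairing \<xi> (coset_indicator C) = riemann_sum \<xi> (coset_indicator C) V ?t" by simp
  also have "\<dots> = (\<Sum>C'\<in>carrier (G Mod V). if C' = C then \<xi> V C' else 0)"
    unfolding riemann_sum_def by (rule sum.cong) (auto simp: coset_indicator_def mem)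
  also have "\<dots> = \<xi> V C" using C finite_Mod[OF V] by simp
  finally show ?thesis .
qed

end


section \<open>Tensor products\<close>

text \<open>
  Equality in the tensor product, on the level of representatives.
\<close>

definition tensor_equiv ::
    "'r set \<Rightarrow> ('r, 'm, 'c) module_scheme \<Rightarrow> ('r, 'n, 'd) module_scheme
      \<Rightarrow> (('m \<times> 'n) \<Rightarrow>\<^sub>0 int) \<Rightarrow> (('m \<times> 'n) \<Rightarrow>\<^sub>0 int) \<Rightarrow> bool" where
  "tensor_equiv R M N z w \<longleftrightarrow> z - w \<in> tensor_relations R M N"

lemma tensor_equiv_refl: "tensor_equiv R M N z z"
  using tensor_relations.zero[of R M N] by (simp add: tensor_equiv_def)

lemma tensor_equiv_diff:
  assumes "tensor_equiv R M N z w" "tensor_equiv R M N z' w'"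
  shows "tensor_equiv R M N (z - z') (w - w')"
proof -
  have "(z - w) - (z' - w') \<in> tensor_relations R M N"
    using assms unfolding tensor_equiv_def by (rule tensor_relations.diff)
  moreover have "(z - w) - (z' - w') = (z - z') - (w - w')" by simp
  ultimately show ?thesis unfolding tensor_equiv_def by (simp only:)
qed

lemma tensor_equiv_sym:
  assumes "tensor_equiv R M N z w" shows "tensor_equiv R M N w z"
proof -
  have "0 - (z - w) \<in> tensor_relations R M N"
    using tensor_relations.diff[OF tensor_relations.zero] assms unfolding tensor_equiv_def by blast
  then show ?thesis by (simp add: tensor_equiv_def)
qed

lemma tensor_equiv_trans:
  assumes "tensor_equiv R M N z w" "tensor_equiv R M N w u" shows "tensor_equiv R M N z u"
proof -
  have "u - w \<in> tensor_relations R M N" using tensor_equiv_sym[OF assms(2)] by (simp add: tensor_equiv_def)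
  with assms(1) have "(z - w) - (u - w) \<in> tensor_relations R M N"
    unfolding tensor_equiv_def by (rule tensor_relations.diff)
  then show ?thesis by (simp add: tensor_equiv_def)
qed

lemma tensor_equiv_add:
  assumes "tensor_equiv R M N z w" "tensor_equiv R M N z' w'"
  shows "tensor_equiv R M N (z + z') (w + w')"
proof -
  have 0: "tensor_equiv R M N 0 0" by (rule tensor_equiv_refl)
  from tensor_equiv_diff[OF assms(1) tensor_equiv_diff[OF 0 assms(2)]] show ?thesis by simp
qed

lemma tensor_equiv_sum:
  assumes "finite I" "\<And>i. i \<in> I \<Longrightarrow> tensor_equiv R M N (z i) (w i)"
  shows "tensor_equiv R M N (\<Sum>i\<in>I. z i) (\<Sum>i\<in>I. w i)"
  using assms by (induction I) (auto intro: tensor_equiv_refl tensor_equiv_add)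

lemma tensor_equiv_add_left:
  assumes "m \<in> carrier M" "m' \<in> carrier M" "n \<in> carrier N"
  shows "tensor_equiv R M N (frag_of (m \<oplus>\<^bsub>M\<^esub> m', n)) (frag_of (m, n) + frag_of (m', n))"
  using tensor_relations.add_left[where R = R, OF assms] by (simp add: tensor_equiv_def diff_diff_eq)

lemma tensor_equiv_add_right:
  assumes "m \<in> carrier M" "n \<in> carrier N" "n' \<in> carrier N"
  shows "tensor_equiv R M N (frag_of (m, n \<oplus>\<^bsub>N\<^esub> n')) (frag_of (m, n) + frag_of (m, n'))"
  using tensor_relations.add_right[where R = R, OF assms] by (simp add: tensor_equiv_def diff_diff_eq)

lemma tensor_equiv_balanced:
  assumes "r \<in> R" "m \<in> carrier M" "n \<in> carrier N"
  shows "tensor_equiv R M N (frag_of (r \<odot>\<^bsub>M\<^esub> m, n)) (frag_of (m, r \<odot>\<^bsub>N\<^esub> n))"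
  using tensor_relations.balanced[OF assms] by (simp add: tensor_equiv_def)

text \<open>
  Used to show that \<open>m \<otimes> n\<close> is zero as soon as \<open>m + m = m\<close> or \<open>n + n = n\<close>.
\<close>

lemma tensor_equiv_zero_if_double:
  assumes "tensor_equiv R M N z (z + z)" shows "tensor_equiv R M N z 0"
  using tensor_equiv_sym[OF assms] by (simp add: tensor_equiv_def)

lemma tensor_class_cong: "tensor_equiv R M N z w \<Longrightarrow> tensor_class R M N z = tensor_class R M N w"
  unfolding tensor_class_def tensor_equiv_def[symmetric]
  using tensor_equiv_trans tensor_equiv_sym by blast

lemma tensor_class_self: "z \<in> free_pairs M N \<Longrightarrow> z \<in> tensor_class R M N z"
  by (simp add: tensor_class_def tensor_equiv_def[symmetric] tensor_equiv_refl)

lemma tensor_class_mem: "w \<in> tensor_class R M N z \<Longrightarrow> tensor_equiv R M N w z"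
  by (simp add: tensor_class_def tensor_equiv_def)

lemma free_pairs_add: "z \<in> free_pairs M N \<Longrightarrow> w \<in> free_pairs M N \<Longrightarrow> z + w \<in> free_pairs M N"
  unfolding free_pairs_def using keys_add[of z w] by blast

lemma free_pairs_of: "m \<in> carrier M \<Longrightarrow> n \<in> carrier N \<Longrightarrow> frag_of (m, n) \<in> free_pairs M N"
  by (simp add: free_pairs_def)

lemma UN_constant_value: "x \<in> A \<Longrightarrow> (\<And>a. a \<in> A \<Longrightarrow> F a = S) \<Longrightarrow> (\<Union>a\<in>A. F a) = S"
  by blast

lemma tensor_product_add:
  assumes "z \<in> free_pairs M N" "w \<in> free_pairs M N"
  shows "tensor_class R M N z \<oplus>\<^bsub>tensor_product R M N\<^esub> tensor_class R M N w = tensor_class R M N (z + w)"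
proof -
  have "tensor_class R M N (a + b) = tensor_class R M N (z + w)"
    if "a \<in> tensor_class R M N z" "b \<in> tensor_class R M N w" for a b
    using that by (intro tensor_class_cong tensor_equiv_add tensor_class_mem)
  then have "(\<Union>a\<in>tensor_class R M N z. \<Union>b\<in>tensor_class R M N w. tensor_class R M N (a + b))
      = tensor_class R M N (z + w)"
    by (intro UN_constant_value[OF tensor_class_self[OF assms(1)]]
        UN_constant_value[OF tensor_class_self[OF assms(2)]])
  then show ?thesis by (simp add: tensor_product_def)
qed

text \<open>
  The balanced biadditive maps of the universal property. They make the choice of a representative in
  \<open>tensor_lift\<close> irrelevant.
\<close>

locale balanced_map =
  fixes R :: "'r set" and M :: "('r, 'm, 'c) module_scheme" and N :: "('r, 'n, 'd) module_scheme"
    and \<beta> :: "'m \<Rightarrow> 'n \<Rightarrow> 'f \<Rightarrow> 'k::comm_ring_1"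
  assumes add_left: "\<And>m m' n f. m \<in> carrier M \<Longrightarrow> m' \<in> carrier M \<Longrightarrow> n \<in> carrier N \<Longrightarrow>
      \<beta> (m \<oplus>\<^bsub>M\<^esub> m') n f = \<beta> m n f + \<beta> m' n f"
    and add_right: "\<And>m n n' f. m \<in> carrier M \<Longrightarrow> n \<in> carrier N \<Longrightarrow> n' \<in> carrier N \<Longrightarrow>
      \<beta> m (n \<oplus>\<^bsub>N\<^esub> n') f = \<beta> m n f + \<beta> m n' f"
    and balanced: "\<And>r m n f. r \<in> R \<Longrightarrow> m \<in> carrier M \<Longrightarrow> n \<in> carrier N \<Longrightarrow>
      \<beta> (r \<odot>\<^bsub>M\<^esub> m) n f = \<beta> m (r \<odot>\<^bsub>N\<^esub> n) f"
begin

lemma tensor_eval_relation: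
  assumes "w \<in> tensor_relations R M N" shows "tensor_eval \<beta> w f = 0"
  using assms
proof induction
  case zero
  then show ?case by (simp add: tensor_eval_def)
qed (simp_all add: tensor_eval_diff tensor_eval_frag_of add_left add_right balanced)

lemma tensor_eval_equiv: "tensor_equiv R M N z w \<Longrightarrow> tensor_eval \<beta> z f = tensor_eval \<beta> w f"
  using tensor_eval_relation[of "z - w" f] by (simp add: tensor_equiv_def tensor_eval_diff)

lemma tensor_lift_class': "z \<in> free_pairs M N \<Longrightarrow> tensor_lift \<beta> (tensor_class R M N z) = tensor_eval \<beta> z"
  by (rule tensor_lift_class[where N = N]) (simp_all add: add_left add_right balanced)

end

lemma tensor_eval_0 [simp]: "tensor_eval \<beta> 0 f = 0"
  by (simp add: tensor_eval_def)

lemma tensor_eval_add: "tensor_eval \<beta> (z + w) f = tensor_eval \<beta> z f + tensor_eval \<beta> w f"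
  using tensor_eval_diff[of \<beta> "z + w" w f] by simp

lemma tensor_eval_sum: "finite I \<Longrightarrow> tensor_eval \<beta> (\<Sum>i\<in>I. z i) f = (\<Sum>i\<in>I. tensor_eval \<beta> (z i) f)"
  by (induction I rule: finite_induct) (simp_all add: tensor_eval_add)


section \<open>The Iwasawa algebra\<close>

lemma valuation_ring_add: "a \<in> valuation_ring \<Longrightarrow> b \<in> valuation_ring \<Longrightarrow> a + b \<in> valuation_ring"
  by (simp add: valuation_ring_def absv_add_le)

lemma valuation_ring_mult: "a \<in> valuation_ring \<Longrightarrow> b \<in> valuation_ring \<Longrightarrow> a * b \<in> valuation_ring"
  by (simp add: valuation_ring_def absv_mult mult_le_one)

context compact_analytic_group
begin

lemma RH_add:
  assumes \<xi>: "\<xi> \<in> carrier RH" and \<eta>: "\<eta> \<in> carrier RH"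
  shows "(\<lambda>U C. \<xi> U C + \<eta> U C) \<in> carrier RH"
  unfolding RH_iff
proof (intro conjI ballI allI impI)
  fix U assume U: "U \<in> ONS"
  have "finite ({q. \<xi> U q \<noteq> 0} \<union> {q. \<eta> U q \<noteq> 0})"
    using RH_level[OF \<xi> U] RH_level[OF \<eta> U] by (simp add: group_ring_iff)
  then have "finite {q. \<xi> U q + \<eta> U q \<noteq> 0}" by (rule finite_subset[rotated]) auto
  then show "(\<lambda>C. \<xi> U C + \<eta> U C) \<in> carrier (group_ring valuation_ring (G Mod U))"
    using RH_level[OF \<xi> U] RH_level[OF \<eta> U] by (simp add: group_ring_iff valuation_ring_add)
next
  fix U assume "U \<notin> ONS"
  then show "(\<lambda>C. \<xi> U C + \<eta> U C) = (\<lambda>_. 0)" using RH_outside[OF \<xi>] RH_outside[OF \<eta>] by simp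
next
  fix U V assume U: "U \<in> ONS" and V: "V \<in> ONS" and UV: "U \<subseteq> V"
  show "(\<lambda>C. \<xi> V C + \<eta> V C) = group_ring_projection G U V (\<lambda>C. \<xi> U C + \<eta> U C)"
  proof
    fix C
    show "\<xi> V C + \<eta> V C = group_ring_projection G U V (\<lambda>C. \<xi> U C + \<eta> U C) C"
    proof (cases "C \<in> carrier (G Mod V)")
      case True
      have "\<xi> V C + \<eta> V C = (\<Sum>D | D \<in> carrier (G Mod U) \<and> D \<subseteq> C. \<xi> U D) + (\<Sum>D | D \<in> carrier (G Mod U) \<and> D \<subseteq> C. \<eta> U D)"
        using RH_proj[OF \<xi> V U UV True] RH_proj[OF \<eta> V U UV True] by (simp only:)
      then show ?thesis unfolding group_ring_projection_def using True by (simp only: sum.distrib if_True)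
    next
      case False
      then show ?thesis using RH_outside[OF \<xi>] RH_outside[OF \<eta>] by (simp add: group_ring_projection_def)
    qed
  qed
qed

lemma RH_smult:
  assumes r: "r \<in> valuation_ring" and \<xi>: "\<xi> \<in> carrier RH"
  shows "(\<lambda>U C. r * \<xi> U C) \<in> carrier RH"
  unfolding RH_iff
proof (intro conjI ballI allI impI)
  fix U assume U: "U \<in> ONS"
  have "finite {q. \<xi> U q \<noteq> 0}" using RH_level[OF \<xi> U] by (simp add: group_ring_iff)
  then have "finite {q. r * \<xi> U q \<noteq> 0}" by (rule finite_subset[rotated]) auto
  then show "(\<lambda>C. r * \<xi> U C) \<in> carrier (group_ring valuation_ring (G Mod U))"
    using RH_level[OF \<xi> U] r by (simp add: group_ring_iff valuation_ring_mult)
next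
  fix U assume "U \<notin> ONS"
  then show "(\<lambda>C. r * \<xi> U C) = (\<lambda>_. 0)" using RH_outside[OF \<xi>] by simp
next
  fix U V assume U: "U \<in> ONS" and V: "V \<in> ONS" and UV: "U \<subseteq> V"
  show "(\<lambda>C. r * \<xi> V C) = group_ring_projection G U V (\<lambda>C. r * \<xi> U C)"
  proof
    fix C
    show "r * \<xi> V C = group_ring_projection G U V (\<lambda>C. r * \<xi> U C) C"
    proof (cases "C \<in> carrier (G Mod V)")
      case True
      have "r * \<xi> V C = r * (\<Sum>D | D \<in> carrier (G Mod U) \<and> D \<subseteq> C. \<xi> U D)"
        using RH_proj[OF \<xi> V U UV True] by (simp only:)
      then show ?thesis unfolding group_ring_projection_def using True by (simp only: sum_distrib_left if_True)
    next
      case False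
      then show ?thesis using RH_outside[OF \<xi>] by (simp add: group_ring_projection_def)
    qed
  qed
qed

lemma RH_zero: "(\<lambda>U C. 0) \<in> carrier RH"
  unfolding RH_iff by (auto simp: group_ring_iff valuation_ring_def group_ring_projection_def)

lemma RH_ops: "\<xi> \<oplus>\<^bsub>RH\<^esub> \<eta> = (\<lambda>U C. \<xi> U C + \<eta> U C)" "r \<odot>\<^bsub>RH\<^esub> \<xi> = (\<lambda>U C. r * \<xi> U C)"
  by (simp_all add: completed_group_ring_def)

lemma field_ops: "carrier (field_algebra :: ('k, 'k) module) = UNIV"
  "c \<oplus>\<^bsub>field_algebra\<^esub> c' = c + (c'::'k)" "c \<odot>\<^bsub>field_algebra\<^esub> c' = c * (c'::'k)"
  by (simp_all add: field_algebra_def)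

abbreviation IW :: "('k, (('k \<times> ('h set \<Rightarrow> 'h set \<Rightarrow> 'k)) \<Rightarrow>\<^sub>0 int) set) module" where
  "IW \<equiv> iwasawa_algebra G X"

abbreviation iw_equiv where
  "iw_equiv \<equiv> tensor_equiv valuation_ring (field_algebra :: ('k, 'k) module) RH"

definition pure :: "'k \<Rightarrow> ('h set \<Rightarrow> 'h set \<Rightarrow> 'k) \<Rightarrow> (('k \<times> ('h set \<Rightarrow> 'h set \<Rightarrow> 'k)) \<Rightarrow>\<^sub>0 int) set" where
  "pure c \<xi> = tensor_class valuation_ring field_algebra RH (frag_of (c, \<xi>))"

lemma pure_free: "\<xi> \<in> carrier RH \<Longrightarrow> frag_of (c, \<xi>) \<in> free_pairs (field_algebra :: ('k, 'k) module) RH"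
  by (rule free_pairs_of) (simp_all add: field_ops)

lemma pure_IW: "\<xi> \<in> carrier RH \<Longrightarrow> pure c \<xi> \<in> carrier IW"
  by (simp add: iwasawa_algebra_def tensor_product_def pure_def pure_free)

lemma iw_equiv_scale:
  assumes "\<xi> \<in> carrier RH" "r \<in> valuation_ring"
  shows "iw_equiv (frag_of (r * c, \<xi>)) (frag_of (c, \<lambda>U C. r * \<xi> U C))"
  using tensor_equiv_balanced[of r valuation_ring c "field_algebra :: ('k, 'k) module" \<xi> RH] assms
  by (simp add: field_ops RH_ops)

lemma iw_equiv_diff_right:
  assumes \<xi>: "\<xi> \<in> carrier RH" and \<eta>: "\<eta> \<in> carrier RH"
  shows "iw_equiv (frag_of (c, \<xi>) - frag_of (c, \<eta>)) (frag_of (c, \<lambda>U C. \<xi> U C + - 1 * \<eta> U C))"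
proof -
  have m1: "- 1 \<in> (valuation_ring :: 'k set)" by (simp add: valuation_ring_def)
  note \<zeta> = RH_add[OF \<xi> RH_smult[OF m1 \<eta>]]
  have "iw_equiv (frag_of (c, \<xi>)) (frag_of (c, \<lambda>U C. \<xi> U C + - 1 * \<eta> U C) + frag_of (c, \<eta>))"
    using tensor_equiv_add_right[of c "field_algebra :: ('k, 'k) module" _ RH \<eta> valuation_ring, OF _ \<zeta> \<eta>]
    by (simp add: field_ops RH_ops)
  from tensor_equiv_diff[OF this tensor_equiv_refl[of _ _ _ "frag_of (c, \<eta>)"]] show ?thesis by simp
qed

text \<open>
  Divisibility in the valuation ring is decided by absolute values.
\<close>

lemma absv_quotient:
  assumes "absv (c'::'k) \<le> absv c"
  obtains r where "r \<in> valuation_ring" "c' = r * c"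
proof (cases "c = 0")
  case True
  then have "c' = 0" using assms absv_nonneg[of c'] by (simp add: antisym)
  then show thesis using True by (intro that[of 0]) (auto simp: valuation_ring_def)
next
  case False
  then have "absv (c' / c) \<le> 1" using assms absv_pos[OF False]
    by (simp add: divide_inverse absv_mult absv_inverse) (simp add: divide_inverse[symmetric])
  then show thesis using False by (intro that[of "c' / c"]) (auto simp: valuation_ring_def)
qed

text \<open>
  Common denominators: of two scalars one divides the other by an element of the valuation ring, which
  can be moved to the right-hand factor. So the difference of two pure tensors is a pure tensor.
\<close>

lemma iw_equiv_pure:
  assumes "z \<in> free_pairs (field_algebra :: ('k, 'k) module) RH"
  shows "\<exists>c. \<exists>\<xi>\<in>carrier RH. iw_equiv z (frag_of (c, \<xi>))"
proof -
  have "Poly_Mapping.keys z \<subseteq> UNIV \<times> carrier RH" using assms by (simp add: free_pairs_def field_ops)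
  then show ?thesis
  proof (induction rule: frag_induction)
    case zero
    have "iw_equiv (frag_of (0, \<lambda>U C. 0)) (frag_of (0, \<lambda>U C. 0) + frag_of (0, \<lambda>U C. 0))"
      using tensor_equiv_add_left[of 0 "field_algebra :: ('k, 'k) module" 0 "\<lambda>U C. 0" RH valuation_ring] RH_zero
      by (simp add: field_ops)
    from tensor_equiv_sym[OF tensor_equiv_zero_if_double[OF this]] show ?case using RH_zero by blast
  next
    case (one p)
    then obtain c \<xi> where p: "p = (c, \<xi>)" "\<xi> \<in> carrier RH" by auto
    show ?case unfolding p(1) by (rule exI[of _ c], rule bexI[OF tensor_equiv_refl p(2)])
  next
    case (diff a b)
    then obtain c \<xi> c' \<xi>' where a: "\<xi> \<in> carrier RH" "iw_equiv a (frag_of (c, \<xi>))"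
      and b: "\<xi>' \<in> carrier RH" "iw_equiv b (frag_of (c', \<xi>'))" by blast
    note ab = tensor_equiv_diff[OF a(2) b(2)]
    have m1: "- 1 \<in> (valuation_ring :: 'k set)" by (simp add: valuation_ring_def)
    show ?case
    proof (cases "absv c' \<le> absv c")
      case True
      then obtain r where r: "r \<in> valuation_ring" "c' = r * c" by (rule absv_quotient)
      note r\<xi> = RH_smult[OF r(1) b(1)]
      have "iw_equiv (frag_of (c, \<xi>) - frag_of (c', \<xi>')) (frag_of (c, \<xi>) - frag_of (c, \<lambda>U C. r * \<xi>' U C))"
        unfolding r(2) by (intro tensor_equiv_diff tensor_equiv_refl iw_equiv_scale b r)
      from tensor_equiv_trans[OF ab tensor_equiv_trans[OF this iw_equiv_diff_right[OF a(1) r\<xi>]]]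
      show ?thesis by (intro exI[of _ c] bexI[OF _ RH_add[OF a(1) RH_smult[OF m1 r\<xi>]]])
    next
      case False
      then have "absv c \<le> absv c'" by simp
      then obtain r where r: "r \<in> valuation_ring" "c = r * c'" by (rule absv_quotient)
      note r\<xi> = RH_smult[OF r(1) a(1)]
      have "iw_equiv (frag_of (c, \<xi>) - frag_of (c', \<xi>')) (frag_of (c', \<lambda>U C. r * \<xi> U C) - frag_of (c', \<xi>'))"
        unfolding r(2) by (intro tensor_equiv_diff tensor_equiv_refl iw_equiv_scale a r)
      from tensor_equiv_trans[OF ab tensor_equiv_trans[OF this iw_equiv_diff_right[OF r\<xi> b(1)]]]
      show ?thesis by (intro exI[of _ c'] bexI[OF _ RH_add[OF r\<xi> RH_smult[OF m1 b(1)]]])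
    qed
  qed
qed

lemma IW_pure:
  assumes "\<mu> \<in> carrier IW"
  obtains c \<xi> where "\<xi> \<in> carrier RH" "\<mu> = pure c \<xi>"
proof -
  obtain z where z: "z \<in> free_pairs (field_algebra :: ('k, 'k) module) RH"
    "\<mu> = tensor_class valuation_ring field_algebra RH z"
    using assms by (auto simp: iwasawa_algebra_def tensor_product_def)
  obtain c \<xi> where p: "\<xi> \<in> carrier RH" "iw_equiv z (frag_of (c, \<xi>))" using iw_equiv_pure[OF z(1)] by blast
  have "\<mu> = pure c \<xi>" unfolding z(2) pure_def by (rule tensor_class_cong[OF p(2)])
  with p(1) show thesis by (rule that)
qed

lemma pure_add:
  assumes "\<xi> \<in> carrier RH" "\<xi>' \<in> carrier RH"
  shows "pure c \<xi> \<oplus>\<^bsub>IW\<^esub> pure c' \<xi>' =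
    tensor_class valuation_ring field_algebra RH (frag_of (c, \<xi>) + frag_of (c', \<xi>'))"
  unfolding iwasawa_algebra_def pure_def by (intro tensor_product_add pure_free assms)

lemma pure_smult:
  assumes \<xi>: "\<xi> \<in> carrier RH"
  shows "s \<odot>\<^bsub>IW\<^esub> pure c \<xi> = pure (s * c) \<xi>"
proof -
  let ?F = "field_algebra :: ('k, 'k) module"
  let ?e = "frag_extend (\<lambda>(m, n). frag_of (s \<odot>\<^bsub>?F\<^esub> m, n)) :: (('k \<times> ('h set \<Rightarrow> 'h set \<Rightarrow> 'k)) \<Rightarrow>\<^sub>0 int) \<Rightarrow> _"
  have rel: "?e w \<in> tensor_relations valuation_ring ?F RH" if "w \<in> tensor_relations valuation_ring ?F RH" for w
    using that
  proof induction
    case zero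
    show ?case using tensor_relations.zero[of valuation_ring ?F RH] by simp
  next
    case (diff z w)
    then show ?case by (simp add: frag_extend_diff tensor_relations.diff)
  next
    case (add_left m m' n)
    then show ?case
      using tensor_relations.add_left[of "s * m" ?F "s * m'" n RH valuation_ring]
      by (simp add: frag_extend_diff field_ops distrib_left)
  next
    case (add_right m n n')
    then show ?case
      using tensor_relations.add_right[of "s * m" ?F n RH n' valuation_ring]
      by (simp add: frag_extend_diff field_ops)
  next
    case (balanced r m n)
    then show ?case
      using tensor_relations.balanced[of r valuation_ring "s * m" ?F n RH]
      by (simp add: frag_extend_diff field_ops mult.left_commute)
  qed
  have "tensor_class valuation_ring ?F RH (?e a) = pure (s * c) \<xi>" if "a \<in> pure c \<xi>" for a
  proof -
    have "a - frag_of (c, \<xi>) \<in> tensor_relations valuation_ring ?F RH"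
      using that by (simp add: pure_def tensor_class_def)
    from rel[OF this] have "iw_equiv (?e a) (frag_of (s * c, \<xi>))"
      by (simp add: tensor_equiv_def frag_extend_diff field_ops)
    then show ?thesis unfolding pure_def by (rule tensor_class_cong)
  qed
  moreover have "frag_of (c, \<xi>) \<in> pure c \<xi>" unfolding pure_def by (rule tensor_class_self[OF pure_free[OF \<xi>]])
  ultimately have "(\<Union>a\<in>pure c \<xi>. tensor_class valuation_ring ?F RH (?e a)) = pure (s * c) \<xi>"
    by (intro UN_constant_value)
  then show ?thesis by (simp add: iwasawa_algebra_def tensor_product_def)
qed

lemma IW_add: "\<mu> \<in> carrier IW \<Longrightarrow> \<mu>' \<in> carrier IW \<Longrightarrow> \<mu> \<oplus>\<^bsub>IW\<^esub> \<mu>' \<in> carrier IW"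
proof -
  assume "\<mu> \<in> carrier IW" "\<mu>' \<in> carrier IW"
  from IW_pure[OF this(1)] obtain c \<xi> where p: "\<xi> \<in> carrier RH" "\<mu> = pure c \<xi>" .
  from IW_pure[OF \<open>\<mu>' \<in> carrier IW\<close>] obtain c' \<xi>' where p': "\<xi>' \<in> carrier RH" "\<mu>' = pure c' \<xi>'" .
  show ?thesis
    unfolding p(2) p'(2) pure_add[OF p(1) p'(1)]
    unfolding iwasawa_algebra_def tensor_product_def
    by (simp add: free_pairs_add pure_free p(1) p'(1))
qed

lemma IW_smult: "\<mu> \<in> carrier IW \<Longrightarrow> s \<odot>\<^bsub>IW\<^esub> \<mu> \<in> carrier IW"
  by (erule IW_pure) (simp add: pure_smult pure_IW)

abbreviation \<Phi> where "\<Phi> \<equiv> iwasawa_to_dist \<iota> G M"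

text \<open>
  The balanced map whose lift is \<open>iwasawa_to_dist\<close>.
\<close>

definition \<beta> :: "'k \<Rightarrow> ('h set \<Rightarrow> 'h set \<Rightarrow> 'k) \<Rightarrow> ('h \<Rightarrow> 'k) \<Rightarrow> 'k" where
  "\<beta> = (\<lambda>c \<xi> f. if f \<in> Can \<iota> M then c * pairing \<xi> f else 0)"

lemma balanced_\<beta>: "balanced_map valuation_ring (field_algebra :: ('k, 'k) module) RH \<beta>"
proof
  fix c c' :: 'k and \<xi> f assume "\<xi> \<in> carrier RH"
  show "\<beta> (c \<oplus>\<^bsub>field_algebra\<^esub> c') \<xi> f = \<beta> c \<xi> f + \<beta> c' \<xi> f" by (simp add: \<beta>_def field_ops distrib_right)
next
  fix c :: 'k and \<xi> \<eta> f assume "\<xi> \<in> carrier RH" "\<eta> \<in> carrier RH"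
  then have "pairing (\<lambda>U C. \<xi> U C + \<eta> U C) f = pairing \<xi> f + pairing \<eta> f" if "f \<in> Can \<iota> M"
    using pairing_linear[of \<xi> \<eta> "\<lambda>U C. \<xi> U C + \<eta> U C" f f f 1 1] that RH_add
    by (simp add: riemann_sum_def sum.distrib distrib_right)
  then show "\<beta> c (\<xi> \<oplus>\<^bsub>RH\<^esub> \<eta>) f = \<beta> c \<xi> f + \<beta> c \<eta> f" by (simp add: \<beta>_def RH_ops distrib_left)
next
  fix r c :: 'k and \<xi> f assume "r \<in> valuation_ring" "\<xi> \<in> carrier RH"
  then have "pairing (\<lambda>U C. r * \<xi> U C) f = r * pairing \<xi> f" if "f \<in> Can \<iota> M"
    using pairing_linear[of \<xi> \<xi> "\<lambda>U C. r * \<xi> U C" f f f r 0] that RH_smult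
    by (simp add: riemann_sum_def sum_distrib_left mult.assoc)
  then show "\<beta> (r \<odot>\<^bsub>field_algebra\<^esub> c) \<xi> f = \<beta> c (r \<odot>\<^bsub>RH\<^esub> \<xi>) f"
    by (simp add: \<beta>_def RH_ops field_ops mult_ac)
qed

lemma \<Phi>_class:
  assumes "z \<in> free_pairs (field_algebra :: ('k, 'k) module) RH"
  shows "\<Phi> (tensor_class valuation_ring field_algebra RH z) = tensor_eval \<beta> z"
  unfolding iwasawa_to_dist_def \<beta>_def[symmetric]
  by (rule balanced_map.tensor_lift_class'[OF balanced_\<beta> assms])

lemma \<Phi>_pure:
  assumes "\<xi> \<in> carrier RH" "f \<in> Can \<iota> M"
  shows "\<Phi> (pure c \<xi>) f = c * pairing \<xi> f"
  using assms unfolding pure_def \<Phi>_class[OF pure_free[OF assms(1)]] by (simp add: tensor_eval_frag_of \<beta>_def)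

lemma \<Phi>_add_left:
  assumes "\<mu> \<in> carrier IW" "\<mu>' \<in> carrier IW"
  shows "\<Phi> (\<mu> \<oplus>\<^bsub>IW\<^esub> \<mu>') f = \<Phi> \<mu> f + \<Phi> \<mu>' f"
proof -
  obtain c \<xi> where p: "\<xi> \<in> carrier RH" "\<mu> = pure c \<xi>" using IW_pure[OF assms(1)] .
  obtain c' \<xi>' where p': "\<xi>' \<in> carrier RH" "\<mu>' = pure c' \<xi>'" using IW_pure[OF assms(2)] .
  show ?thesis
    unfolding p(2) p'(2) pure_add[OF p(1) p'(1)] \<Phi>_class[OF free_pairs_add[OF pure_free[OF p(1)] pure_free[OF p'(1)]]]
    unfolding pure_def \<Phi>_class[OF pure_free[OF p(1)]] \<Phi>_class[OF pure_free[OF p'(1)]]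
    by (rule tensor_eval_add)
qed

lemma \<Phi>_add_right:
  assumes "\<mu> \<in> carrier IW" "f \<in> Can \<iota> M" "g \<in> Can \<iota> M"
  shows "\<Phi> \<mu> (\<lambda>x. f x + g x) = \<Phi> \<mu> f + \<Phi> \<mu> g"
proof -
  obtain c \<xi> where p: "\<xi> \<in> carrier RH" "\<mu> = pure c \<xi>" using IW_pure[OF assms(1)] .
  then show ?thesis
    using \<Phi>_pure[OF p(1) Can_add[OF assms(2,3)]] \<Phi>_pure[OF p(1) assms(2)] \<Phi>_pure[OF p(1) assms(3)]
      pairing_add_right[OF p(1) assms(2,3)] by (simp add: distrib_left)
qed

lemma \<Phi>_smult:
  assumes "\<mu> \<in> carrier IW" "f \<in> Can \<iota> M"
  shows "\<Phi> (s \<odot>\<^bsub>IW\<^esub> \<mu>) f = \<Phi> \<mu> (\<lambda>x. s * f x)"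
proof -
  obtain c \<xi> where p: "\<xi> \<in> carrier RH" "\<mu> = pure c \<xi>" using IW_pure[OF assms(1)] .
  then show ?thesis
    using \<Phi>_pure[OF p(1) Can_cmult[OF assms(2)]] \<Phi>_pure[OF p(1) assms(2)]
      pairing_cmult_right[OF p(1) assms(2)] by (simp add: pure_smult mult_ac)
qed

text \<open>
  Injectivity of \<open>K \<otimes> R[[H]]\<close> into families of masses: if all masses of \<open>c \<otimes> \<xi>\<close> are zero, then \<open>c = 0\<close> or
  \<open>\<xi> = 0\<close>, and the tensor is its own double.
\<close>

lemma pure_null_double:
  assumes \<xi>: "\<xi> \<in> carrier RH" and null: "\<And>U C. c * \<xi> U C = 0"
  shows "pure c \<xi> \<oplus>\<^bsub>IW\<^esub> pure c \<xi> = pure c \<xi>"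
proof -
  have "iw_equiv (frag_of (c, \<xi>)) (frag_of (c, \<xi>) + frag_of (c, \<xi>))"
  proof (cases "c = 0")
    case True
    then show ?thesis
      using tensor_equiv_add_left[of 0 "field_algebra :: ('k, 'k) module" 0 \<xi> RH valuation_ring] \<xi>
      by (simp add: field_ops)
  next
    case False
    then have "\<xi> = (\<lambda>U C. 0)" using null by (auto simp: fun_eq_iff)
    then show ?thesis
      using tensor_equiv_add_right[of c "field_algebra :: ('k, 'k) module" \<xi> RH \<xi> valuation_ring] \<xi>
      by (simp add: field_ops RH_ops)
  qed
  from tensor_class_cong[OF tensor_equiv_sym[OF this]] show ?thesis
    unfolding pure_add[OF \<xi> \<xi>] unfolding pure_def .
qed

end


section \<open>Linear independence of functionals\<close>

text \<open>
  Induction on the number of functionals: a vector \<open>f0\<close> on which only the last one is nonzero allows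
  subtracting a multiple of it, and without such a vector the last one can be omitted.
\<close>

lemma functional_in_span:
  fixes \<nu> :: "'i \<Rightarrow> ('x \<Rightarrow> 'k::field) \<Rightarrow> 'k"
  assumes "finite I"
    and V: "\<And>f g. f \<in> V \<Longrightarrow> g \<in> V \<Longrightarrow> (\<lambda>x. f x + g x) \<in> V" "\<And>c f. f \<in> V \<Longrightarrow> (\<lambda>x. c * f x) \<in> V"
    and \<nu>: "\<And>i f g. i \<in> I \<Longrightarrow> f \<in> V \<Longrightarrow> g \<in> V \<Longrightarrow> \<nu> i (\<lambda>x. f x + g x) = \<nu> i f + \<nu> i g"
      "\<And>i c f. i \<in> I \<Longrightarrow> f \<in> V \<Longrightarrow> \<nu> i (\<lambda>x. c * f x) = c * \<nu> i f"
    and \<mu>: "\<And>f g. f \<in> V \<Longrightarrow> g \<in> V \<Longrightarrow> \<mu> (\<lambda>x. f x + g x) = \<mu> f + \<mu> g"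
      "\<And>c f. f \<in> V \<Longrightarrow> \<mu> (\<lambda>x. c * f x) = c * \<mu> f"
    and null: "\<And>f. f \<in> V \<Longrightarrow> (\<And>i. i \<in> I \<Longrightarrow> \<nu> i f = 0) \<Longrightarrow> \<mu> f = 0"
  shows "\<exists>c. \<forall>f\<in>V. \<mu> f = (\<Sum>i\<in>I. c i * \<nu> i f)"
  using assms(1) \<nu> \<mu> null
proof (induction I arbitrary: \<mu> rule: finite_induct)
  case empty
  then show ?case by auto
next
  case (insert j I)
  show ?case
  proof (cases "\<exists>f\<in>V. (\<forall>i\<in>I. \<nu> i f = 0) \<and> \<nu> j f \<noteq> 0")
    case True
    then obtain f0 where f0: "f0 \<in> V" "\<And>i. i \<in> I \<Longrightarrow> \<nu> i f0 = 0" "\<nu> j f0 \<noteq> 0" by blast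
    define r where "r = \<mu> f0 / \<nu> j f0"
    have "\<exists>c. \<forall>f\<in>V. \<mu> f - r * \<nu> j f = (\<Sum>i\<in>I. c i * \<nu> i f)"
    proof (rule insert.IH)
      fix f assume f: "f \<in> V" and zero: "\<And>i. i \<in> I \<Longrightarrow> \<nu> i f = 0"
      define s where "s = - (\<nu> j f / \<nu> j f0)"
      have g: "(\<lambda>x. f x + s * f0 x) \<in> V" by (intro V f f0)
      have "\<nu> i (\<lambda>x. f x + s * f0 x) = 0" if "i \<in> insert j I" for i
        using that insert.prems(1)[OF that f V(2)[OF f0(1), of s]] insert.prems(2)[OF that f0(1), of s] zero f0
        by (auto simp: s_def)
      then have "\<mu> (\<lambda>x. f x + s * f0 x) = 0" using insert.prems(5)[OF g] by blast
      then show "\<mu> f - r * \<nu> j f = 0"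
        using insert.prems(3)[OF f V(2)[OF f0(1), of s]] insert.prems(4)[OF f0(1), of s]
        by (simp add: s_def r_def)
    qed (use insert.prems in \<open>simp_all add: algebra_simps\<close>)
    then obtain c where c: "\<And>f. f \<in> V \<Longrightarrow> \<mu> f - r * \<nu> j f = (\<Sum>i\<in>I. c i * \<nu> i f)" by blast
    have "\<mu> f = (\<Sum>i\<in>insert j I. (c(j := r)) i * \<nu> i f)" if "f \<in> V" for f
    proof -
      have "(\<Sum>i\<in>I. (c(j := r)) i * \<nu> i f) = (\<Sum>i\<in>I. c i * \<nu> i f)"
        using insert.hyps by (intro sum.cong) auto
      then show ?thesis using c[OF that] insert.hyps by (simp add: algebra_simps)
    qed
    then show ?thesis by blast
  next
    case False
    have "\<exists>c. \<forall>f\<in>V. \<mu> f = (\<Sum>i\<in>I. c i * \<nu> i f)"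
    proof (rule insert.IH)
      fix f assume f: "f \<in> V" and zero: "\<And>i. i \<in> I \<Longrightarrow> \<nu> i f = 0"
      then have "\<nu> j f = 0" using False by blast
      then show "\<mu> f = 0" using insert.prems(5)[OF f] zero by blast
    qed (use insert.prems in simp_all)
    then obtain c where c: "\<And>f. f \<in> V \<Longrightarrow> \<mu> f = (\<Sum>i\<in>I. c i * \<nu> i f)" by blast
    have "\<mu> f = (\<Sum>i\<in>insert j I. (c(j := 0)) i * \<nu> i f)" if "f \<in> V" for f
    proof -
      have "(\<Sum>i\<in>I. (c(j := 0)) i * \<nu> i f) = (\<Sum>i\<in>I. c i * \<nu> i f)"
        using insert.hyps by (intro sum.cong) auto
      then show ?thesis using c[OF that] insert.hyps by simp
    qed
    then show ?thesis by blast
  qed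
qed


section \<open>Vanishing of the measures and injectivity\<close>

context compact_analytic_group
begin

text \<open>
  For \<open>y\<close> in \<open>V\<close>, the points \<open>x y\<close> and \<open>x\<close> lie in the same coset of \<open>V\<close>, and \<open>\<nu>\<close> sees only such \<open>y\<close>.
\<close>

lemma act_indicator:
  assumes \<nu>: "\<nu> \<in> D1" and f: "f \<in> Can \<iota> M" and V: "V \<in> ONS" and C: "C \<in> carrier (G Mod V)"
  shows "act \<nu> (\<lambda>x. coset_indicator C x * f x) = (\<lambda>x. coset_indicator C x * act \<nu> f x)"
proof
  fix x
  show "act \<nu> (\<lambda>x. coset_indicator C x * f x) x = coset_indicator C x * act \<nu> f x"
  proof (cases "x \<in> carrier G")
    case True
    obtain g where g: "g \<in> carrier G" "C = V #> g" using C by (auto simp: carrier_Mod)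
    have mem: "x \<otimes> y \<in> C \<longleftrightarrow> x \<in> C" if y: "y \<in> V" for y
    proof -
      have "V \<lhd> G" using V by (simp add: ONS_iff)
      then have "x <# V = V #> x" using True normal.coset_eq by metis
      moreover have "x \<otimes> y \<in> x <# V" using y by (auto simp: l_coset_def)
      ultimately have xy: "x \<otimes> y \<in> V #> x" by simp
      have D: "V #> x \<in> carrier (G Mod V)" using True by (auto simp: carrier_Mod)
      show ?thesis
        using coset_eqI[OF V D C xy] coset_eqI[OF V D C mem_r_coset_self[OF V True]]
          xy mem_r_coset_self[OF V True] by blast
    qed
    have "\<nu> (translate (\<lambda>x. coset_indicator C x * f x) x) = \<nu> (\<lambda>y. coset_indicator C x * translate f x y)"
    proof (rule at_one_local[OF \<nu>])
      show "translate (\<lambda>x. coset_indicator C x * f x) x \<in> Can \<iota> M"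
        by (intro translate_Can Can_restrict_coset[OF f V C] True)
      show "(\<lambda>y. coset_indicator C x * translate f x y) \<in> Can \<iota> M"
        by (intro Can_cmult translate_Can f True)
      show "openin X V" "\<one> \<in> V" using V ONS_one by (auto simp: ONS_iff)
      fix y assume "y \<in> V"
      then show "translate (\<lambda>x. coset_indicator C x * f x) x y = coset_indicator C x * translate f x y"
        using mem by (simp add: translate_def coset_indicator_def)
    qed
    then show ?thesis
      using True distributionD(2)[OF D1_distribution[OF \<nu>] translate_Can[OF f True]] by (simp add: act_def)
  qed (simp add: act_def)
qed

lemma translate_translate:
  assumes "f \<in> Can \<iota> M" "p \<in> carrier G"
  shows "translate (translate f (inv p)) p = f"
proof
  fix y
  show "translate (translate f (inv p)) p y = f y"
  proof (cases "y \<in> carrier G")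
    case True
    then have "inv p \<otimes> (p \<otimes> y) = y" using assms(2) by (simp add: m_assoc[symmetric])
    then show ?thesis using True assms(2) by (simp add: translate_def)
  qed (use Can_zero_outside[OF assms(1)] in \<open>simp add: translate_def\<close>)
qed

text \<open>
  Choose \<open>V\<close> so small that on the coset of \<open>p\<close> the matrix \<open>h\<close> differs from the identity matrix by at most
  one half. Since \<open>\<Sum>\<^sub>i c\<^sub>i \<integral> 1\<^sub>C h\<^sub>i\<^sub>j d\<xi>\<^sub>i = 0\<close>, the mass of \<open>C\<close> for \<open>c\<^sub>j \<xi>\<^sub>j\<close> is \<open>\<Sum>\<^sub>i c\<^sub>i \<integral> 1\<^sub>C (\<delta>\<^sub>i\<^sub>j - h\<^sub>i\<^sub>j) d\<xi>\<^sub>i\<close>, which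
  is at most half of any common bound for the masses. Iterating gives zero.
\<close>

lemma measures_vanish_near:
  assumes I: "finite I" and \<xi>: "\<And>i. i \<in> I \<Longrightarrow> \<xi> i \<in> carrier RH" and \<nu>: "\<And>i. i \<in> I \<Longrightarrow> \<nu> i \<in> D1"
    and f: "\<And>j. j \<in> I \<Longrightarrow> f j \<in> Can \<iota> M"
    and dual: "\<And>i j. i \<in> I \<Longrightarrow> j \<in> I \<Longrightarrow> \<nu> i (f j) = (if i = j then 1 else 0)"
    and zero: "\<And>f. f \<in> Can \<iota> M \<Longrightarrow> (\<Sum>i\<in>I. c i * pairing (\<xi> i) (act (\<nu> i) f)) = 0"
    and p: "p \<in> carrier G"
  shows "\<exists>V\<in>ONS. \<forall>i\<in>I. \<forall>V'\<in>ONS. \<forall>C\<in>carrier (G Mod V'). V' \<subseteq> V \<longrightarrow> C \<subseteq> V #> p \<longrightarrow> c i * \<xi> i V' C = 0"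
proof -
  define h where "h i j = act (\<nu> i) (translate (f j) (inv p))" for i j
  have F: "translate (f j) (inv p) \<in> Can \<iota> M" if "j \<in> I" for j
    using translate_Can[OF f[OF that]] p by simp
  have h: "h i j \<in> Can \<iota> M" if "i \<in> I" "j \<in> I" for i j
    unfolding h_def by (rule act_Can[OF \<nu>[OF that(1)] F[OF that(2)]])
  have hp: "h i j p = (if i = j then 1 else 0)" if "i \<in> I" "j \<in> I" for i j
    using dual[OF that] p translate_translate[OF f[OF that(2)] p] by (simp add: h_def act_def)
  have "\<exists>N. N \<in> ONS \<and> varies_le (h (fst q) (snd q)) N (1 / 2)" if "q \<in> I \<times> I" for q
  proof -
    have q: "fst q \<in> I" "snd q \<in> I" and half: "0 < (1 / 2 :: real)" using that by auto
    show ?thesis by (rule Can_varies_le[OF h[OF q] half]) blast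
  qed
  then obtain N where N: "\<And>q. q \<in> I \<times> I \<Longrightarrow> N q \<in> ONS"
    "\<And>q. q \<in> I \<times> I \<Longrightarrow> varies_le (h (fst q) (snd q)) (N q) (1 / 2)" by metis
  have "finite (N ` (I \<times> I))" "N ` (I \<times> I) \<subseteq> ONS" using I N(1) by auto
  from ONS_Inter[OF this] obtain V where V: "V \<in> ONS" "\<And>q. q \<in> I \<times> I \<Longrightarrow> V \<subseteq> N q" by blast
  have close: "absv (h i j x - (if i = j then 1 else 0)) \<le> 1 / 2" if ij: "i \<in> I" "j \<in> I" and x: "x \<in> V #> p" for i j x
  proof -
    have "varies_le (h i j) V (1 / 2)"
      using varies_le_mono[OF N(2)[of "(i, j)"] V(2) order_refl] ij by simp
    then show ?thesis using p x hp[OF ij] by (auto simp: varies_le_def)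
  qed
  have Vp: "V #> p \<in> carrier (G Mod V)" using p by (auto simp: carrier_Mod)
  (* Masses of elements of the completed group ring are at most one; this starts the iteration. *)
  define K where "K = (\<Sum>i\<in>I. absv (c i))"
  have K: "0 \<le> K" unfolding K_def by (intro sum_nonneg) simp
  have bound: "absv (c i * \<xi> i V' C) \<le> K * (1 / 2) ^ n"
    if "i \<in> I" "V' \<in> ONS" "C \<in> carrier (G Mod V')" "V' \<subseteq> V" "C \<subseteq> V #> p" for i V' C n
    using that
  proof (induction n arbitrary: i V' C)
    case 0
    have "absv (c i) \<le> K" unfolding K_def using I 0(1) by (intro member_le_sum) auto
    then have "absv (c i) * absv (\<xi> i V' C) \<le> K * 1"
      using RH_absv[OF \<xi>[OF 0(1)] 0(2)] K by (intro mult_mono) auto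
    then show ?case by (simp add: absv_mult)
  next
    case (Suc n)
    note j = Suc.prems(1) and V' = Suc.prems(2,4) and C = Suc.prems(3,5)
    let ?j = i
    let ?B = "K * (1 / 2) ^ n"
    have B: "0 \<le> ?B" using K by simp
    (* e i is the function 1_C (\<delta>_ij - h_ij), written so that it vanishes outside the group. *)
    define \<delta> where "\<delta> i = (if i = ?j then 1 else 0 :: 'k)" for i
    define e where "e i = (\<lambda>x. coset_indicator C x * ((if x \<in> carrier G then \<delta> i else 0) + - 1 * h i ?j x))" for i
    have e: "e i \<in> Can \<iota> M" if "i \<in> I" for i
      unfolding e_def by (intro Can_restrict_coset[OF _ V'(1) C(1)] Can_add Can_cmult Can_const h that j)
    have ind: "coset_indicator C \<in> Can \<iota> M" by (rule coset_indicator_Can[OF V'(1) C(1)])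
    have term_eq: "c i * pairing (\<xi> i) (e i) =
        c i * \<delta> i * pairing (\<xi> i) (coset_indicator C) - c i * pairing (\<xi> i) (\<lambda>x. coset_indicator C x * h i ?j x)"
      if i: "i \<in> I" for i
    proof -
      have ih: "(\<lambda>x. coset_indicator C x * h i ?j x) \<in> Can \<iota> M"
        by (rule Can_restrict_coset[OF h[OF i j] V'(1) C(1)])
      have "e i = (\<lambda>x. \<delta> i * coset_indicator C x + - 1 * (coset_indicator C x * h i ?j x))"
        using coset_subset_carrier[OF V'(1) C(1)]
        by (auto simp: e_def fun_eq_iff coset_indicator_def)
      then have "pairing (\<xi> i) (e i) = pairing (\<xi> i) (\<lambda>x. \<delta> i * coset_indicator C x) +
          pairing (\<xi> i) (\<lambda>x. - 1 * (coset_indicator C x * h i ?j x))"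
        using pairing_add_right[OF \<xi>[OF i] Can_cmult[OF ind, of "\<delta> i"] Can_cmult[OF ih, of "- 1"]] by simp
      also have "\<dots> = \<delta> i * pairing (\<xi> i) (coset_indicator C) + - 1 * pairing (\<xi> i) (\<lambda>x. coset_indicator C x * h i ?j x)"
        using pairing_cmult_right[OF \<xi>[OF i] ind, of "\<delta> i"] pairing_cmult_right[OF \<xi>[OF i] ih, of "- 1"] by simp
      finally show ?thesis by (simp only:) (simp add: algebra_simps)
    qed
    have "(\<Sum>i\<in>I. c i * pairing (\<xi> i) (act (\<nu> i) (\<lambda>x. coset_indicator C x * translate (f ?j) (inv p) x))) = 0"
      by (intro zero Can_restrict_coset[OF F[OF j] V'(1) C(1)])
    moreover have "act (\<nu> i) (\<lambda>x. coset_indicator C x * translate (f ?j) (inv p) x) = (\<lambda>x. coset_indicator C x * h i ?j x)"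
      if "i \<in> I" for i
      unfolding h_def by (rule act_indicator[OF \<nu>[OF that] F[OF j] V'(1) C(1)])
    ultimately have z: "(\<Sum>i\<in>I. c i * pairing (\<xi> i) (\<lambda>x. coset_indicator C x * h i ?j x)) = 0" by simp
    have "(\<Sum>i\<in>I. c i * pairing (\<xi> i) (e i)) = (\<Sum>i\<in>I. c i * \<delta> i * pairing (\<xi> i) (coset_indicator C))"
      using z by (simp add: term_eq sum_subtractf)
    also have "\<dots> = (\<Sum>i\<in>I. if i = ?j then c i * pairing (\<xi> i) (coset_indicator C) else 0)"
      by (rule sum.cong) (auto simp: \<delta>_def)
    also have "\<dots> = c ?j * pairing (\<xi> ?j) (coset_indicator C)" using I j by simp
    also have "\<dots> = c ?j * \<xi> ?j V' C" by (simp add: pairing_coset_indicator[OF \<xi>[OF j] V'(1) C(1)])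
    finally have eq: "c ?j * \<xi> ?j V' C = (\<Sum>i\<in>I. c i * pairing (\<xi> i) (e i))" by simp
    have "absv (c i * pairing (\<xi> i) (e i)) \<le> ?B * (1 / 2)" if i: "i \<in> I" for i
    proof (cases "c i = 0")
      case False
      then have ci: "0 < absv (c i)" by (rule absv_pos)
      have "absv (pairing (\<xi> i) (e i)) \<le> ?B / absv (c i) * (1 / 2)"
      proof (rule pairing_bound[OF \<xi>[OF i] e[OF i] V'(1) C(1)])
        show "e i x = 0" if "x \<notin> C" for x using that by (simp add: e_def coset_indicator_def)
        show "absv (e i x) \<le> 1 / 2" if x: "x \<in> C" for x
        proof -
          have "x \<in> carrier G" using x coset_subset_carrier[OF V'(1) C(1)] by blast
          then have "e i x = - (h i ?j x - (if i = ?j then 1 else 0))"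
            using x by (simp add: e_def coset_indicator_def \<delta>_def)
          then show ?thesis using close[OF i j, of x] x C(2) by (simp only: absv_minus) blast
        qed
        fix W C' assume W: "W \<in> ONS" "W \<subseteq> V'" and C': "C' \<in> carrier (G Mod W)" "C' \<subseteq> C"
        have "absv (c i * \<xi> i W C') \<le> ?B"
          using W C' V'(2) C(2) by (intro Suc.IH[OF i W(1) C'(1)]) auto
        then show "absv (\<xi> i W C') \<le> ?B / absv (c i)" using ci by (simp add: absv_mult pos_le_divide_eq mult.commute)
      qed (use B ci in auto)
      then have "absv (c i) * absv (pairing (\<xi> i) (e i)) \<le> absv (c i) * (?B / absv (c i) * (1 / 2))"
        by (intro mult_left_mono) auto
      also have "\<dots> = ?B * (1 / 2)" using ci by (simp del: absv_eq_0_iff)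
      finally show ?thesis by (simp add: absv_mult)
    qed (use B in simp)
    then have "absv (\<Sum>i\<in>I. c i * pairing (\<xi> i) (e i)) \<le> ?B * (1 / 2)" using B by (intro absv_sum_le) auto
    then show ?case unfolding eq by (simp add: mult_ac)
  qed
  have "c i * \<xi> i V' C = 0"
    if "i \<in> I" "V' \<in> ONS" "C \<in> carrier (G Mod V')" "V' \<subseteq> V" "C \<subseteq> V #> p" for i V' C
  proof -
    have "(\<lambda>n. K * (1 / 2) ^ n) \<longlonglongrightarrow> K * 0" by (intro tendsto_intros LIMSEQ_power_zero) auto
    then have "absv (c i * \<xi> i V' C) \<le> K * 0" using bound[OF that] by (intro LIMSEQ_le_const) auto
    then have "absv (c i * \<xi> i V' C) = 0" using absv_nonneg[of "c i * \<xi> i V' C"] by linarith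
    then show ?thesis by simp
  qed
  then show ?thesis using V(1) by blast
qed

text \<open>
  Compactness makes the neighbourhoods of all points uniform, and the mass of any coset is a sum of
  masses of small ones.
\<close>

lemma measures_vanish:
  assumes I: "finite I" and \<xi>: "\<And>i. i \<in> I \<Longrightarrow> \<xi> i \<in> carrier RH" and \<nu>: "\<And>i. i \<in> I \<Longrightarrow> \<nu> i \<in> D1"
    and f: "\<And>j. j \<in> I \<Longrightarrow> f j \<in> Can \<iota> M"
    and dual: "\<And>i j. i \<in> I \<Longrightarrow> j \<in> I \<Longrightarrow> \<nu> i (f j) = (if i = j then 1 else 0)"
    and zero: "\<And>f. f \<in> Can \<iota> M \<Longrightarrow> (\<Sum>i\<in>I. c i * pairing (\<xi> i) (act (\<nu> i) f)) = 0"
    and j: "j \<in> I"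
  shows "c j * \<xi> j U C = 0"
proof (cases "U \<in> ONS \<and> C \<in> carrier (G Mod U)")
  case True
  then have U: "U \<in> ONS" and C: "C \<in> carrier (G Mod U)" by auto
  have "\<forall>p\<in>carrier G. \<exists>V. V \<in> ONS \<and>
      (\<forall>V'\<in>ONS. \<forall>C\<in>carrier (G Mod V'). V' \<subseteq> V \<longrightarrow> C \<subseteq> V #> p \<longrightarrow> c j * \<xi> j V' C = 0)"
  proof
    fix p assume p: "p \<in> carrier G"
    have "\<exists>V\<in>ONS. \<forall>i\<in>I. \<forall>V'\<in>ONS. \<forall>C\<in>carrier (G Mod V').
        V' \<subseteq> V \<longrightarrow> C \<subseteq> V #> p \<longrightarrow> c i * \<xi> i V' C = 0"
      by (rule measures_vanish_near[of I \<xi> \<nu> f c p, OF I \<xi> \<nu> f dual zero p]; assumption)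
    then obtain V where V: "V \<in> ONS" and all: "\<forall>i\<in>I. \<forall>V'\<in>ONS. \<forall>C\<in>carrier (G Mod V').
        V' \<subseteq> V \<longrightarrow> C \<subseteq> V #> p \<longrightarrow> c i * \<xi> i V' C = 0"
      by (elim bexE) (rule that)
    from V bspec[OF all j] show "\<exists>V. V \<in> ONS \<and>
      (\<forall>V'\<in>ONS. \<forall>C\<in>carrier (G Mod V'). V' \<subseteq> V \<longrightarrow> C \<subseteq> V #> p \<longrightarrow> c j * \<xi> j V' C = 0)"
      by (intro exI[of _ V] conjI)
  qed
  from bchoice[OF this] obtain V where all: "\<forall>p\<in>carrier G. V p \<in> ONS \<and>
      (\<forall>V'\<in>ONS. \<forall>C\<in>carrier (G Mod V'). V' \<subseteq> V p \<longrightarrow> C \<subseteq> V p #> p \<longrightarrow> c j * \<xi> j V' C = 0)"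
    by (elim exE)
  have V: "V p \<in> ONS" if "p \<in> carrier G" for p using all that by simp
  have V0: "c j * \<xi> j V' C = 0"
    if "p \<in> carrier G" "V' \<in> ONS" "C \<in> carrier (G Mod V')" "V' \<subseteq> V p" "C \<subseteq> V p #> p" for p V' C
    using all that by simp
  obtain N where N: "N \<in> ONS" "\<And>h. h \<in> carrier G \<Longrightarrow> \<exists>p\<in>carrier G. N #> h \<subseteq> V p #> p"
    by (rule uniform_cosets[of "\<lambda>p. V p #> p", OF openin_ONS_r_coset[OF V] mem_r_coset_self[OF V]])
      (assumption | rule that)+
  define W where "W = N \<inter> U"
  have W: "W \<in> ONS" "W \<subseteq> U" unfolding W_def by (auto intro: ONS_Int N(1) U)
  have "c j * \<xi> j W D = 0" if D: "D \<in> carrier (G Mod W)" for D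
  proof -
    obtain h where h: "h \<in> carrier G" "D = W #> h" using D by (auto simp: carrier_Mod)
    obtain p where p: "p \<in> carrier G" "N #> h \<subseteq> V p #> p"
      using N(2)[OF h(1)] by (elim bexE) (rule that)
    have DN: "D \<subseteq> N #> h" unfolding h(2) by (auto simp: W_def r_coset_def)
    have "h \<in> V p #> p" using mem_r_coset_self[OF N(1) h(1)] p(2) by blast
    then have Vh: "V p #> h = V p #> p" by (rule r_coset_eq[OF V[OF p(1)] p(1)])
    (* The inclusion of cosets implies the inclusion of subgroups: cancel h. *)
    have "N \<subseteq> V p"
    proof
      fix n assume n: "n \<in> N"
      then have "n \<otimes> h \<in> N #> h" by (auto simp: r_coset_def)
      then have "n \<otimes> h \<in> V p #> h" using p(2) unfolding Vh by blast
      then obtain v where v: "v \<in> V p" "n \<otimes> h = v \<otimes> h" by (auto simp: r_coset_def)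
      have "n \<in> carrier G" using subgroup.mem_carrier[OF ONS_subgroup[OF N(1)] n] .
      moreover have "v \<in> carrier G" using subgroup.mem_carrier[OF ONS_subgroup[OF V[OF p(1)]] v(1)] .
      ultimately show "n \<in> V p" using v h(1) by simp
    qed
    then have "W \<subseteq> V p" by (auto simp: W_def)
    then show ?thesis using V0[OF p(1) W(1) D _ order_trans[OF DN p(2)]] by simp
  qed
  then have "(\<Sum>D | D \<in> carrier (G Mod W) \<and> D \<subseteq> C. c j * \<xi> j W D) = 0" by (intro sum.neutral) auto
  moreover have "\<xi> j U C = (\<Sum>D | D \<in> carrier (G Mod W) \<and> D \<subseteq> C. \<xi> j W D)"
    by (rule RH_proj[OF \<xi>[OF j] U W C])
  ultimately show ?thesis by (simp only: sum_distrib_left)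
next
  case False
  then show ?thesis using RH_outside[OF \<xi>[OF j]] by auto
qed

abbreviation DA :: "('k, ('h \<Rightarrow> 'k) \<Rightarrow> 'k) module" where "DA \<equiv> dist_algebra_at_one \<iota> G M"

lemma DA_ops: "\<nu> \<oplus>\<^bsub>DA\<^esub> \<nu>' = (\<lambda>f. \<nu> f + \<nu>' f)" "r \<odot>\<^bsub>DA\<^esub> \<nu> = (\<lambda>f. r * \<nu> f)"
  by (simp_all add: dist_algebra_at_one_def dist_algebra_def)

text \<open>
  The balanced map whose lift is the natural map.
\<close>

definition conv where "conv = (\<lambda>\<mu> \<nu>. \<Phi> \<mu> \<otimes>\<^bsub>dist_algebra \<iota> G M\<^esub> \<nu>)"

lemma conv_eq: "conv \<mu> \<nu> f = (if f \<in> Can \<iota> M then \<Phi> \<mu> (act \<nu> f) else 0)"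
  unfolding conv_def act_def translate_def by (simp add: dist_algebra_def convolution_def)

lemma act_add: "act (\<lambda>f. \<nu> f + \<nu>' f) f = (\<lambda>x. act \<nu> f x + act \<nu>' f x)"
  by (auto simp: act_def)

lemma act_cmult: "act (\<lambda>f. r * \<nu> f) f = (\<lambda>x. r * act \<nu> f x)"
  by (auto simp: act_def)

lemma balanced_conv: "balanced_map UNIV IW DA conv"
proof
  fix \<mu> \<mu>' \<nu> f assume "\<mu> \<in> carrier IW" "\<mu>' \<in> carrier IW" "\<nu> \<in> D1"
  then show "conv (\<mu> \<oplus>\<^bsub>IW\<^esub> \<mu>') \<nu> f = conv \<mu> \<nu> f + conv \<mu>' \<nu> f" by (simp add: conv_eq \<Phi>_add_left)
next
  fix \<mu> \<nu> \<nu>' f assume "\<mu> \<in> carrier IW" "\<nu> \<in> D1" "\<nu>' \<in> D1"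
  then show "conv \<mu> (\<nu> \<oplus>\<^bsub>DA\<^esub> \<nu>') f = conv \<mu> \<nu> f + conv \<mu> \<nu>' f"
    by (simp add: conv_eq DA_ops act_add \<Phi>_add_right act_Can)
next
  fix r \<mu> \<nu> f assume "\<mu> \<in> carrier IW" "\<nu> \<in> D1"
  then show "conv (r \<odot>\<^bsub>IW\<^esub> \<mu>) \<nu> f = conv \<mu> (r \<odot>\<^bsub>DA\<^esub> \<nu>) f"
    by (simp add: conv_eq DA_ops act_cmult \<Phi>_smult act_Can)
qed

abbreviation T_equiv where "T_equiv \<equiv> tensor_equiv (UNIV :: 'k set) IW DA"

lemma T_equiv_sum_right:
  assumes "finite I" "I \<noteq> {}" "\<mu> \<in> carrier IW" "\<And>i. i \<in> I \<Longrightarrow> \<nu> i \<in> D1"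
  shows "(\<lambda>f. \<Sum>i\<in>I. c i * \<nu> i f) \<in> D1 \<and>
    T_equiv (frag_of (\<mu>, \<lambda>f. \<Sum>i\<in>I. c i * \<nu> i f)) (\<Sum>i\<in>I. frag_of (c i \<odot>\<^bsub>IW\<^esub> \<mu>, \<nu> i))"
proof -
  have bal: "T_equiv (frag_of (\<mu>, \<lambda>f. c j * \<nu> j f)) (frag_of (c j \<odot>\<^bsub>IW\<^esub> \<mu>, \<nu> j))"
    if "\<nu> j \<in> D1" for j
    using tensor_equiv_sym[OF tensor_equiv_balanced[of "c j" UNIV \<mu> IW "\<nu> j" DA]] assms(3) that
    by (simp add: DA_ops)
  show ?thesis
    using assms(1,2,4)
  proof (induction I rule: finite_ne_induct)
    case (singleton j)
    then show ?case using bal D1_cmult by simp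
  next
    case (insert j I)
    have j: "\<nu> j \<in> D1" using insert.prems by simp
    have IH: "(\<lambda>f. \<Sum>i\<in>I. c i * \<nu> i f) \<in> D1"
      "T_equiv (frag_of (\<mu>, \<lambda>f. \<Sum>i\<in>I. c i * \<nu> i f)) (\<Sum>i\<in>I. frag_of (c i \<odot>\<^bsub>IW\<^esub> \<mu>, \<nu> i))"
      using insert.IH insert.prems by auto
    have eq: "(\<lambda>f. \<Sum>i\<in>insert j I. c i * \<nu> i f) = (\<lambda>f. c j * \<nu> j f + (\<Sum>i\<in>I. c i * \<nu> i f))"
      using insert.hyps by simp
    have "T_equiv (frag_of (\<mu>, \<lambda>f. c j * \<nu> j f + (\<Sum>i\<in>I. c i * \<nu> i f)))
        (frag_of (\<mu>, \<lambda>f. c j * \<nu> j f) + frag_of (\<mu>, \<lambda>f. \<Sum>i\<in>I. c i * \<nu> i f))"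
      using tensor_equiv_add_right[where R = UNIV, OF assms(3) D1_cmult[OF j, of "c j"] IH(1)]
      by (simp add: DA_ops)
    from tensor_equiv_trans[OF this tensor_equiv_add[OF bal[OF j] IH(2)]]
    have "T_equiv (frag_of (\<mu>, \<lambda>f. \<Sum>i\<in>insert j I. c i * \<nu> i f))
        (\<Sum>i\<in>insert j I. frag_of (c i \<odot>\<^bsub>IW\<^esub> \<mu>, \<nu> i))"
      unfolding eq using insert.hyps by simp
    moreover have "(\<lambda>f. \<Sum>i\<in>insert j I. c i * \<nu> i f) \<in> D1"
      unfolding eq by (rule D1_add[OF D1_cmult[OF j] IH(1)])
    ultimately show ?case by blast
  qed
qed

text \<open>
  Substituting \<open>\<nu>\<^sub>j = \<Sum>\<^sub>i c\<^sub>i \<nu>\<^sub>i\<close> and moving the scalars to the left-hand factors absorbs the term of index \<open>j\<close>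
  into the others.
\<close>

lemma shorten_dependent_sum:
  assumes I: "finite I" and j: "j \<in> I" and \<mu>: "\<And>i. i \<in> I \<Longrightarrow> \<mu> i \<in> carrier IW" and \<nu>: "\<And>i. i \<in> I \<Longrightarrow> \<nu> i \<in> D1"
    and dep: "\<And>f. \<nu> j f = (\<Sum>i\<in>I - {j}. c i * \<nu> i f)"
  shows "T_equiv (\<Sum>i\<in>I. frag_of (\<mu> i, \<nu> i)) (\<Sum>i\<in>I - {j}. frag_of (\<mu> i \<oplus>\<^bsub>IW\<^esub> (c i \<odot>\<^bsub>IW\<^esub> \<mu> j), \<nu> i))"
proof -
  let ?J = "I - {j}"
  have \<nu>j: "\<nu> j = (\<lambda>f. \<Sum>i\<in>?J. c i * \<nu> i f)" using dep by (rule ext)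
  have "T_equiv (frag_of (\<mu> j, \<nu> j)) (\<Sum>i\<in>?J. frag_of (c i \<odot>\<^bsub>IW\<^esub> \<mu> j, \<nu> i))"
  proof (cases "?J = {}")
    case True
    have "\<nu> j f = 0" for f unfolding dep True by simp
    then have "\<nu> j \<oplus>\<^bsub>DA\<^esub> \<nu> j = \<nu> j" unfolding DA_ops by (intro ext) simp
    with tensor_equiv_add_right[where R = UNIV, OF \<mu>[OF j] \<nu>[OF j] \<nu>[OF j]]
    have "T_equiv (frag_of (\<mu> j, \<nu> j)) (frag_of (\<mu> j, \<nu> j) + frag_of (\<mu> j, \<nu> j))" by simp
    from tensor_equiv_zero_if_double[OF this] show ?thesis unfolding True by simp
  next
    case False
    have "finite ?J" using I by simp
    from T_equiv_sum_right[OF this False \<mu>[OF j], of \<nu> c] \<nu>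
    have "T_equiv (frag_of (\<mu> j, \<lambda>f. \<Sum>i\<in>?J. c i * \<nu> i f)) (\<Sum>i\<in>?J. frag_of (c i \<odot>\<^bsub>IW\<^esub> \<mu> j, \<nu> i))"
      by simp
    then show ?thesis unfolding \<nu>j[symmetric] .
  qed
  moreover have "T_equiv (\<Sum>i\<in>?J. frag_of (\<mu> i, \<nu> i)) (\<Sum>i\<in>?J. frag_of (\<mu> i, \<nu> i))" by (rule tensor_equiv_refl)
  ultimately have "T_equiv (frag_of (\<mu> j, \<nu> j) + (\<Sum>i\<in>?J. frag_of (\<mu> i, \<nu> i)))
      ((\<Sum>i\<in>?J. frag_of (c i \<odot>\<^bsub>IW\<^esub> \<mu> j, \<nu> i)) + (\<Sum>i\<in>?J. frag_of (\<mu> i, \<nu> i)))" by (rule tensor_equiv_add)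
  then have "T_equiv (\<Sum>i\<in>I. frag_of (\<mu> i, \<nu> i))
      (\<Sum>i\<in>?J. frag_of (\<mu> i, \<nu> i) + frag_of (c i \<odot>\<^bsub>IW\<^esub> \<mu> j, \<nu> i))"
    using I j by (simp add: sum.remove[of I j] sum.distrib add.commute)
  moreover have "T_equiv (\<Sum>i\<in>?J. frag_of (\<mu> i, \<nu> i) + frag_of (c i \<odot>\<^bsub>IW\<^esub> \<mu> j, \<nu> i))
      (\<Sum>i\<in>?J. frag_of (\<mu> i \<oplus>\<^bsub>IW\<^esub> (c i \<odot>\<^bsub>IW\<^esub> \<mu> j), \<nu> i))"
    using I by (intro tensor_equiv_sum tensor_equiv_sym[OF tensor_equiv_add_left] \<mu> \<nu> IW_smult j) auto
  ultimately show ?thesis by (rule tensor_equiv_trans)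
qed

text \<open>
  Induction on the number of terms: if the \<open>\<nu>\<^sub>i\<close> are dependent, the sum is shortened; otherwise dual
  functions exist and all \<open>\<mu>\<^sub>i\<close> vanish.
\<close>

lemma conv_kernel:
  assumes "finite I" "\<And>i. i \<in> I \<Longrightarrow> \<mu> i \<in> carrier IW" "\<And>i. i \<in> I \<Longrightarrow> \<nu> i \<in> D1"
    and "\<And>f. tensor_eval conv (\<Sum>i\<in>I. frag_of (\<mu> i, \<nu> i)) f = 0"
  shows "T_equiv (\<Sum>i\<in>I. frag_of (\<mu> i, \<nu> i)) 0"
  using assms
proof (induction "card I" arbitrary: I \<mu> rule: less_induct)
  case (less I \<mu>)
  note I = less.prems(1) and \<mu> = less.prems(2) and \<nu> = less.prems(3) and ker = less.prems(4)
  show ?case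
  proof (cases "\<exists>j\<in>I. \<exists>c. \<forall>f. \<nu> j f = (\<Sum>i\<in>I - {j}. c i * \<nu> i f)")
    case True
    then obtain j c where j: "j \<in> I" and dep: "\<And>f. \<nu> j f = (\<Sum>i\<in>I - {j}. c i * \<nu> i f)" by blast
    have sh: "T_equiv (\<Sum>i\<in>I. frag_of (\<mu> i, \<nu> i))
        (\<Sum>i\<in>I - {j}. frag_of (\<mu> i \<oplus>\<^bsub>IW\<^esub> (c i \<odot>\<^bsub>IW\<^esub> \<mu> j), \<nu> i))"
      by (rule shorten_dependent_sum[of I j \<mu> \<nu> c, OF I j \<mu> \<nu> dep]; assumption)
    have "T_equiv (\<Sum>i\<in>I - {j}. frag_of (\<mu> i \<oplus>\<^bsub>IW\<^esub> (c i \<odot>\<^bsub>IW\<^esub> \<mu> j), \<nu> i)) 0"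
    proof (rule less.hyps)
      show "card (I - {j}) < card I" using I j by (rule card_Diff1_less)
      show "tensor_eval conv (\<Sum>i\<in>I - {j}. frag_of (\<mu> i \<oplus>\<^bsub>IW\<^esub> (c i \<odot>\<^bsub>IW\<^esub> \<mu> j), \<nu> i)) f = 0" for f
        using balanced_map.tensor_eval_equiv[OF balanced_conv sh, of f] ker[of f] by simp
    qed (use I \<mu> \<nu> IW_add IW_smult j in auto)
    with sh show ?thesis by (rule tensor_equiv_trans)
  next
    case False
    have "\<exists>f. f \<in> Can \<iota> M \<and> (\<forall>i\<in>I. \<nu> i f = (if i = j then 1 else 0))" if j: "j \<in> I" for j
    proof -
      have "\<exists>f. f \<in> Can \<iota> M \<and> (\<forall>i\<in>I - {j}. \<nu> i f = 0) \<and> \<nu> j f \<noteq> 0"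
      proof (rule ccontr)
        assume no: "\<not> ?thesis"
        have "\<exists>c. \<forall>f\<in>Can \<iota> M. \<nu> j f = (\<Sum>i\<in>I - {j}. c i * \<nu> i f)"
        proof (rule functional_in_span)
          show "\<nu> j f = 0" if "f \<in> Can \<iota> M" "\<And>i. i \<in> I - {j} \<Longrightarrow> \<nu> i f = 0" for f
            using no that by blast
        qed (use I j \<nu> Can_add Can_cmult distributionD(1,2)[OF D1_distribution] in auto)
        then obtain c where c: "\<And>f. f \<in> Can \<iota> M \<Longrightarrow> \<nu> j f = (\<Sum>i\<in>I - {j}. c i * \<nu> i f)" by blast
        have "\<nu> j f = (\<Sum>i\<in>I - {j}. c i * \<nu> i f)" for f
        proof (cases "f \<in> Can \<iota> M")
          case False
          then show ?thesis using \<nu> j distributionD(3)[OF D1_distribution] by (simp add: sum.neutral)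
        qed (rule c)
        then show False using \<open>\<not> (\<exists>j\<in>I. \<exists>c. \<forall>f. \<nu> j f = (\<Sum>i\<in>I - {j}. c i * \<nu> i f))\<close> j by blast
      qed
      then obtain f where f: "f \<in> Can \<iota> M" "\<And>i. i \<in> I - {j} \<Longrightarrow> \<nu> i f = 0" "\<nu> j f \<noteq> 0" by blast
      have "\<nu> i (\<lambda>x. inverse (\<nu> j f) * f x) = (if i = j then 1 else 0)" if i: "i \<in> I" for i
        using distributionD(2)[OF D1_distribution[OF \<nu>[OF i]] f(1), of "inverse (\<nu> j f)"] f(2)[of i] f(3) i by auto
      then show ?thesis using Can_cmult[OF f(1)] by blast
    qed
    then have "\<forall>j\<in>I. \<exists>f. f \<in> Can \<iota> M \<and> (\<forall>i\<in>I. \<nu> i f = (if i = j then 1 else 0))" by (rule ballI)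
    from bchoice[OF this] obtain f
      where fd: "\<forall>j\<in>I. f j \<in> Can \<iota> M \<and> (\<forall>i\<in>I. \<nu> i (f j) = (if i = j then 1 else 0))" by (elim exE)
    have f: "f j \<in> Can \<iota> M" if "j \<in> I" for j using fd that by simp
    have dual: "\<nu> i (f j) = (if i = j then 1 else 0)" if "i \<in> I" "j \<in> I" for i j using fd that by simp
    have "\<exists>q. snd q \<in> carrier RH \<and> \<mu> i = pure (fst q) (snd q)" if i: "i \<in> I" for i
    proof -
      obtain c \<xi> where "\<xi> \<in> carrier RH" "\<mu> i = pure c \<xi>" using IW_pure[OF \<mu>[OF i]] .
      then show ?thesis by (intro exI[of _ "(c, \<xi>)"]) simp
    qed
    then have "\<forall>i\<in>I. \<exists>q. snd q \<in> carrier RH \<and> \<mu> i = pure (fst q) (snd q)" by (rule ballI)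
    from bchoice[OF this] obtain q where q: "\<forall>i\<in>I. snd (q i) \<in> carrier RH \<and> \<mu> i = pure (fst (q i)) (snd (q i))"
      by (elim exE)
    define c where "c i = fst (q i)" for i
    define \<xi> where "\<xi> i = snd (q i)" for i
    have \<xi>: "\<xi> i \<in> carrier RH" and \<mu>_eq: "\<mu> i = pure (c i) (\<xi> i)" if "i \<in> I" for i
      using q that by (simp_all add: c_def \<xi>_def)
    have zero: "(\<Sum>i\<in>I. c i * pairing (\<xi> i) (act (\<nu> i) g)) = 0" if g: "g \<in> Can \<iota> M" for g
    proof -
      have "(\<Sum>i\<in>I. c i * pairing (\<xi> i) (act (\<nu> i) g)) = (\<Sum>i\<in>I. conv (\<mu> i) (\<nu> i) g)"
        using g by (intro sum.cong) (auto simp: conv_eq \<mu>_eq \<Phi>_pure \<xi> act_Can \<nu>)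
      then show ?thesis using ker[of g] I by (simp add: tensor_eval_sum tensor_eval_frag_of)
    qed
    have "T_equiv (frag_of (\<mu> i, \<nu> i)) 0" if i: "i \<in> I" for i
    proof -
      have "c i * \<xi> i U C = 0" for U C
        by (rule measures_vanish[of I \<xi> \<nu> f c i, OF I \<xi> \<nu> f dual zero i]; assumption)
      then have dbl: "\<mu> i \<oplus>\<^bsub>IW\<^esub> \<mu> i = \<mu> i" unfolding \<mu>_eq[OF i] by (rule pure_null_double[OF \<xi>[OF i]])
      have "T_equiv (frag_of (\<mu> i \<oplus>\<^bsub>IW\<^esub> \<mu> i, \<nu> i)) (frag_of (\<mu> i, \<nu> i) + frag_of (\<mu> i, \<nu> i))"
        by (rule tensor_equiv_add_left[OF \<mu>[OF i] \<mu>[OF i] \<nu>[OF i]])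
      then show ?thesis unfolding dbl by (rule tensor_equiv_zero_if_double)
    qed
    from tensor_equiv_sum[OF I this] show ?thesis by simp
  qed
qed

lemma T_equiv_sum_of_pure:
  assumes "z \<in> free_pairs IW DA"
  shows "\<exists>n \<mu> \<nu>. (\<forall>i<n::nat. \<mu> i \<in> carrier IW \<and> \<nu> i \<in> D1) \<and> T_equiv z (\<Sum>i<n. frag_of (\<mu> i, \<nu> i))"
proof -
  have "Poly_Mapping.keys z \<subseteq> carrier IW \<times> D1" using assms by (simp add: free_pairs_def)
  then show ?thesis
  proof (induction rule: frag_induction)
    case zero
    show ?case by (rule exI[of _ 0]) (simp add: tensor_equiv_refl)
  next
    case (one p)
    then obtain \<mu> \<nu> where p: "p = (\<mu>, \<nu>)" "\<mu> \<in> carrier IW" "\<nu> \<in> D1" by auto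
    show ?case
      by (rule exI[of _ 1], rule exI[of _ "\<lambda>_. \<mu>"], rule exI[of _ "\<lambda>_. \<nu>"]) (simp add: p tensor_equiv_refl)
  next
    case (diff a b)
    then obtain n \<mu> \<nu> n' \<mu>' \<nu>'
      where a: "\<And>i. i < n \<Longrightarrow> \<mu> i \<in> carrier IW \<and> \<nu> i \<in> D1" "T_equiv a (\<Sum>i<n::nat. frag_of (\<mu> i, \<nu> i))"
        and b: "\<And>i. i < n' \<Longrightarrow> \<mu>' i \<in> carrier IW \<and> \<nu>' i \<in> D1" "T_equiv b (\<Sum>i<n'::nat. frag_of (\<mu>' i, \<nu>' i))"
      by blast
    define \<mu>2 where "\<mu>2 i = (if i < n then \<mu> i else \<mu>' (i - n))" for i
    (* Signs of the free abelian group are absorbed into the distributions. *)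
    define \<nu>2 where "\<nu>2 i = (if i < n then \<nu> i else (\<lambda>f. - 1 * \<nu>' (i - n) f))" for i
    have neg: "T_equiv (- frag_of (\<mu>' i, \<nu>' i)) (frag_of (\<mu>' i, \<lambda>f. - 1 * \<nu>' i f))" if "i < n'" for i
    proof -
      have m: "\<mu>' i \<in> carrier IW" "\<nu>' i \<in> D1" using b(1)[OF that] by auto
      note m' = D1_cmult[OF m(2), of "- 1"]
      have z: "(\<lambda>f. \<nu>' i f + - 1 * \<nu>' i f) = (\<lambda>f. 0)" by simp
      have s: "T_equiv (frag_of (\<mu>' i, \<lambda>f. 0)) (frag_of (\<mu>' i, \<nu>' i) + frag_of (\<mu>' i, \<lambda>f. - 1 * \<nu>' i f))"
        using tensor_equiv_add_right[where R = UNIV, OF m m'] unfolding DA_ops z .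
      have z0: "(\<lambda>f. 0) \<in> D1" using D1_cmult[OF m(2), of 0] by simp
      have "T_equiv (frag_of (\<mu>' i, \<lambda>f. 0)) (frag_of (\<mu>' i, \<lambda>f. 0) + frag_of (\<mu>' i, \<lambda>f. 0))"
        using tensor_equiv_add_right[where R = UNIV, OF m(1) z0 z0] by (simp add: DA_ops)
      from tensor_equiv_trans[OF tensor_equiv_sym[OF s] tensor_equiv_zero_if_double[OF this]]
      have "T_equiv (frag_of (\<mu>' i, \<nu>' i) + frag_of (\<mu>' i, \<lambda>f. - 1 * \<nu>' i f)) 0" .
      from tensor_equiv_diff[OF tensor_equiv_refl[of _ _ _ "frag_of (\<mu>' i, \<lambda>f. - 1 * \<nu>' i f)"] this]
      show ?thesis by simp
    qed
    have "T_equiv (\<Sum>i<n'. - frag_of (\<mu>' i, \<nu>' i)) (\<Sum>i<n'. frag_of (\<mu>' i, \<lambda>f. - 1 * \<nu>' i f))"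
      using neg by (intro tensor_equiv_sum) auto
    from tensor_equiv_add[OF tensor_equiv_refl this]
    have "T_equiv ((\<Sum>i<n. frag_of (\<mu> i, \<nu> i)) - (\<Sum>i<n'. frag_of (\<mu>' i, \<nu>' i)))
        ((\<Sum>i<n. frag_of (\<mu> i, \<nu> i)) + (\<Sum>i<n'. frag_of (\<mu>' i, \<lambda>f. - 1 * \<nu>' i f)))"
      by (simp add: sum_negf)
    from tensor_equiv_trans[OF tensor_equiv_diff[OF a(2) b(2)] this]
    have "T_equiv (a - b) (\<Sum>i<n + n'. frag_of (\<mu>2 i, \<nu>2 i))"
      by (simp add: sum_lessThan_add \<mu>2_def \<nu>2_def)
    moreover have "\<mu>2 i \<in> carrier IW \<and> \<nu>2 i \<in> D1" if "i < n + n'" for i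
      using that a(1)[of i] b(1)[of "i - n"] D1_cmult[of "\<nu>' (i - n)" "- 1"] by (auto simp: \<mu>2_def \<nu>2_def)
    ultimately show ?case by blast
  qed
qed

theorem natural_map_inj: "inj_on (natural_map \<iota> G M) (carrier (iwasawa_tensor_dist_at_one \<iota> G M))"
proof (rule inj_onI)
  fix A B assume "A \<in> carrier (iwasawa_tensor_dist_at_one \<iota> G M)" "B \<in> carrier (iwasawa_tensor_dist_at_one \<iota> G M)"
    and eq: "natural_map \<iota> G M A = natural_map \<iota> G M B"
  then obtain z w where z: "z \<in> free_pairs IW DA" "A = tensor_class UNIV IW DA z"
    and w: "w \<in> free_pairs IW DA" "B = tensor_class UNIV IW DA w"
    by (auto simp: iwasawa_tensor_dist_at_one_def tensor_product_def)
  have nat: "natural_map \<iota> G M (tensor_class UNIV IW DA z) = tensor_eval conv z" if "z \<in> free_pairs IW DA" for z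
    unfolding natural_map_def conv_def[symmetric] by (rule balanced_map.tensor_lift_class'[OF balanced_conv that])
  have ev: "tensor_eval conv (z - w) f = 0" for f
    using eq nat[OF z(1)] nat[OF w(1)] by (simp add: z(2) w(2) tensor_eval_diff)
  have "z - w \<in> free_pairs IW DA"
    using z(1) w(1) keys_diff[of z w] unfolding free_pairs_def by blast
  then obtain n \<mu> \<nu> where p: "\<forall>i<n::nat. \<mu> i \<in> carrier IW \<and> \<nu> i \<in> D1"
    and zw: "T_equiv (z - w) (\<Sum>i<n. frag_of (\<mu> i, \<nu> i))"
    using T_equiv_sum_of_pure by blast
  have "T_equiv (\<Sum>i<n. frag_of (\<mu> i, \<nu> i)) 0"
    using p balanced_map.tensor_eval_equiv[OF balanced_conv zw] ev by (intro conv_kernel) auto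
  from tensor_equiv_trans[OF zw this] have "T_equiv z w" by (simp add: tensor_equiv_def)
  then show "A = B" unfolding z(2) w(2) by (rule tensor_class_cong)
qed

end

theorem theoremB:
  fixes p :: nat
    and \<iota> :: "'l::{nonarch_field, field_char_0} \<Rightarrow> 'k::{nonarch_field, complete_space}"
    and G :: "('h, 'b) monoid_scheme"
    and M :: "('h, 'l) manifold"
  assumes "prime p"
    and "finite_extension_of_Qp p TYPE('l)"
    and "discretely_valued_extension \<iota>"
    and "analytic_group G M"
    and "compact_space (mtop M)"
  shows "inj_on (natural_map \<iota> G M) (carrier (iwasawa_tensor_dist_at_one \<iota> G M))"
proof -
  have emb: "\<iota> 1 = 1" "\<And>x y. \<iota> (x + y) = \<iota> x + \<iota> y" "\<And>x y. \<iota> (x * y) = \<iota> x * \<iota> y" "\<And>x. absv (\<iota> x) = absv x"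
    and uniformizer: "\<exists>\<pi>::'k. \<pi> \<noteq> 0 \<and> absv \<pi> < 1"
    using assms(3) unfolding discretely_valued_extension_def by blast+
  interpret compact_analytic_group \<iota> G M
    by unfold_locales (fact emb assms(4,5) uniformizer)+
  show ?thesis by (rule natural_map_inj)
qed

end
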